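(* Consider the discounted MDP, the parametrized policies $\{\pi_\theta\}_{\theta\in\mathbb R^d}$ and the algorithm N-PG-IGT described in the context. Assume: (i) for all $(s,a)$, $\theta\mapsto\pi_\theta(a|s)$ is positive and twice continuously differentiable, and there are $M_g,M_h>0$ with $\|\nabla\log\pi_\theta(a|s)\|\le M_g$ and $\|\nabla^2\log\pi_\theta(a|s)\|\le M_h$ for all $\theta,s,a$; (ii) there is $l_2>0$ with $\|\nabla^2\log\pi_\theta(a|s)-\nabla^2\log\pi_{\theta'}(a|s)\|\le l_2\|\theta-\theta'\|$ for all $\theta,\theta',s,a$. Set $\gamma_t=\left(\frac{2}{t+2}\right)^{5/7}$, $\eta_t=\left(\frac{2}{t+2}\right)^{4/7}$ and $H=(1-\gamma)^{-1}\log(T+1)$. Let $\bar\theta_T$ be sampled from the iterates $\{\theta_0,\dots,\theta_{T-1}\}$ of N-PG-IGT with probability distribution $\mathbb P(\bar\theta_T=\theta_t)=\gamma_t/\sum_{s=0}^{T-1}\gamma_s$. Then for every integer $T\ge1$, $\bar\theta_T$ satisfies $$\mathbb E\big[\|\nabla J(\bar\theta_T)\|\big]\le\mathcal O\left(\frac{J^*-J(\theta_0)}{(T+1)^{2/7}}+\frac{L_g}{(T+1)^{5/7}}+\frac{D_g}{T+1}+\frac{D_h}{(T+1)^{13/7}}+\frac{(L_h+\sigma_g)\log(T+1)}{(T+1)^{2/7}}\right),$$ where $\mathcal O(\cdot)$ hides only absolute numerical constants.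
   Context: **MDP.** $(\mathcal S,\mathcal A,\mathcal P,r,\rho,\gamma)$: (possibly continuous) state and action spaces, transition density $\mathcal P(s'|s,a)$, reward $r:\mathcal S\times\mathcal A\to[-r_{\max},r_{\max}]$ with $r_{\max}>0$, initial distribution $\rho$, discount $\gamma\in(0,1)$. For $\theta\in\mathbb R^d$, $\pi_\theta(\cdot|s)$ is a probability density on $\mathcal A$. For a policy $\pi$, $J(\pi)=\mathbb E_{\rho,\pi}[\sum_{t\ge0}\gamma^tr(s_t,a_t)]$, with $s_0\sim\rho$, $a_t\sim\pi(\cdot|s_t)$, $s_{t+1}\sim\mathcal P(\cdot|s_t,a_t)$; $J(\theta)=J(\pi_\theta)$. $J^*$ is the optimal expected return. Derivatives are in $\theta$; norms are Euclidean/operator norms. **Trajectories and gradient estimator.** $\tau=(s_0,a_0,\dots,s_{H-1},a_{H-1})\sim p(\cdot|\pi_\theta)$ is a trajectory of length $H$ under $\rho,\pi_\theta$ (rounding of $H$ to an integer is left implicit), and $g(\tau,\theta)=\sum_{t=0}^{H-1}\big(\sum_{h=t}^{H-1}\gamma^hr(s_h,a_h)\big)\nabla\log\pi_\theta(a_t|s_t)$. **Algorithm N-PG-IGT.** Inputs: $\theta_0,\theta_1,d_0\in\mathbb R^d$, $T$, momentum parameters $\{\eta_t\}_{t\ge0}$, step-sizes $\{\gamma_t\}_{t\ge0}$. For $t=1,\dots,T-1$: $\tilde\theta_t=\theta_t+\frac{1-\eta_t}{\eta_t}(\theta_t-\theta_{t-1})$; sample $\tilde\tau_t\sim p(\cdot|\pi_{\tilde\theta_t})$;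 $d_t=(1-\eta_t)d_{t-1}+\eta_tg(\tilde\tau_t,\tilde\theta_t)$; $\theta_{t+1}=\theta_t+\gamma_td_t/\|d_t\|$ (with $\theta_{t+1}=\theta_t$ if $d_t=0$). (The step-sizes $\gamma_t$ are distinct from the discount factor $\gamma$.) **Constants.** $L_g=\frac{r_{\max}(M_g^2+M_h)}{(1-\gamma)^2}$, $\sigma_g^2=\frac{r_{\max}^2M_g^2}{(1-\gamma)^3}$, $D_g=\frac{M_gr_{\max}}{1-\gamma}\sqrt{\frac1{1-\gamma}+H}$, $D_h=\frac{r_{\max}(M_h+M_g^2)}{1-\gamma}\big(H+\frac1{1-\gamma}\big)$, $L_h=\frac{r_{\max}M_gM_h}{(1-\gamma)^2}+\frac{r_{\max}M_g^3(1+\gamma)}{(1-\gamma)^3}+\frac{r_{\max}M_g}{1-\gamma}\max\{M_h,\frac{\gamma M_g^2}{1-\gamma},\frac{l_2}{M_g},\frac{M_h\gamma}{1-\gamma},\frac{M_g(1+\gamma)+M_h\gamma(1-\gamma)}{1-\gamma^2}\}$ (a Lipschitz constant of $\nabla^2 J$).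
   Formalization: The inputs θ_1, d_0 (possibly random) must satisfy ‖θ_1−θ_0‖ ≤ γ_0 a.s. and E‖d_0‖ ≤ σ_g, as the bound fails for arbitrary inputs; that L_h is a Lipschitz constant of ∇²J is assumed, as the context says; H is rounded up. *)

theory Defs
  imports "HOL-Probability.Probability"
begin

section \<open>Gradients and Hessians\<close>

definition grad :: "(real^'n \<Rightarrow> real) \<Rightarrow> real^'n \<Rightarrow> real^'n" where
  "grad f x = (THE D. GDERIV f x :> D)"

text \<open>The Hessian is a bounded linear map, so \<^term>\<open>norm\<close> and \<^term>\<open>dist\<close> on it are the operator
  norm and its metric.\<close>

definition hess :: "(real^'n \<Rightarrow> real) \<Rightarrow> real^'n \<Rightarrow> ((real^'n) \<Rightarrow>\<^sub>L (real^'n))" where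
  "hess f x = Blinfun (frechet_derivative (grad f) (at x))"

definition twice_cont_diff :: "(real^'n \<Rightarrow> real) \<Rightarrow> bool" where
  "twice_cont_diff f \<longleftrightarrow>
     (\<forall>x. f differentiable (at x)) \<and> (\<forall>x. grad f differentiable (at x)) \<and>
     continuous_on UNIV (hess f)"


section \<open>Discounted Markov decision processes\<close>

text \<open>Densities on states and actions are taken with respect to the sigma-finite reference
  measures \<open>states\<close> and \<open>actions\<close> (Lebesgue measure, counting measure, ...).\<close>

record ('s, 'a) mdp =
  states :: "'s measure"
  actions :: "'a measure"
  transition :: "'s \<Rightarrow> 'a \<Rightarrow> 's \<Rightarrow> real"  \<comment> \<open>\<open>transition m s a s'\<close> is the density of \<open>s'\<close> given \<open>(s, a)\<close>\<close>
  reward :: "'s \<Rightarrow> 'a \<Rightarrow> real"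
  reward_bound :: real
  init :: "'s measure"
  discount :: real

abbreviation state_actions :: "('s, 'a) mdp \<Rightarrow> ('s \<times> 'a) measure" where
  "state_actions m \<equiv> states m \<Otimes>\<^sub>M actions m"

definition is_mdp :: "('s, 'a) mdp \<Rightarrow> bool" where
  "is_mdp m \<longleftrightarrow>
     sigma_finite_measure (states m) \<and> sigma_finite_measure (actions m) \<and>
     (\<lambda>((s, a), s'). transition m s a s') \<in> borel_measurable (state_actions m \<Otimes>\<^sub>M states m) \<and>
     (\<forall>s\<in>space (states m). \<forall>a\<in>space (actions m).
        (\<forall>s'\<in>space (states m). 0 \<le> transition m s a s') \<and>
        (\<integral>\<^sup>+ s'. ennreal (transition m s a s') \<partial>states m) = 1) \<and>
     (\<lambda>(s, a). reward m s a) \<in> borel_measurable (state_actions m) \<and>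
     0 < reward_bound m \<and>
     (\<forall>s\<in>space (states m). \<forall>a\<in>space (actions m). \<bar>reward m s a\<bar> \<le> reward_bound m) \<and>
     prob_space (init m) \<and> sets (init m) = sets (states m) \<and>
     0 < discount m \<and> discount m < 1"

definition policies :: "('s, 'a) mdp \<Rightarrow> ('s \<Rightarrow> 'a measure) set" where
  "policies m = states m \<rightarrow>\<^sub>M prob_algebra (actions m)"

definition draw_action :: "('s, 'a) mdp \<Rightarrow> ('s \<Rightarrow> 'a measure) \<Rightarrow> 's \<Rightarrow> ('s \<times> 'a) measure" where
  "draw_action m \<pi> s = distr (\<pi> s) (state_actions m) (\<lambda>a. (s, a))"

fun traj_kernel ::
  "('s, 'a) mdp \<Rightarrow> ('s \<Rightarrow> 'a measure) \<Rightarrow> nat \<Rightarrow> (nat \<Rightarrow> 's \<times> 'a) \<Rightarrow> ('s \<times> 'a) measure" where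
  "traj_kernel m \<pi> 0 \<omega> = init m \<bind> draw_action m \<pi>"
| "traj_kernel m \<pi> (Suc t) \<omega> =
     density (states m) (\<lambda>s'. ennreal (transition m (fst (\<omega> t)) (snd (\<omega> t)) s')) \<bind> draw_action m \<pi>"

text \<open>The law of the infinite trajectory \<open>(s\<^sub>t, a\<^sub>t)\<close>, \<open>t \<ge> 0\<close>, obtained from the one-step
  kernels by the Ionescu-Tulcea theorem.\<close>

definition traj_law :: "('s, 'a) mdp \<Rightarrow> ('s \<Rightarrow> 'a measure) \<Rightarrow> (nat \<Rightarrow> 's \<times> 'a) measure" where
  "traj_law m \<pi> = projective_family.lim UNIV
     (Ionescu_Tulcea.CI (traj_kernel m \<pi>) (\<lambda>_. state_actions m)) (\<lambda>_. state_actions m)"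

definition traj_law_upto ::
  "('s, 'a) mdp \<Rightarrow> nat \<Rightarrow> ('s \<Rightarrow> 'a measure) \<Rightarrow> (nat \<Rightarrow> 's \<times> 'a) measure" where
  "traj_law_upto m H \<pi> =
     distr (traj_law m \<pi>) (PiM {..<H} (\<lambda>_. state_actions m)) (\<lambda>\<omega>. restrict \<omega> {..<H})"

definition expected_return :: "('s, 'a) mdp \<Rightarrow> ('s \<Rightarrow> 'a measure) \<Rightarrow> real" where
  "expected_return m \<pi> =
     (\<integral>\<omega>. (\<Sum>t. discount m ^ t * reward m (fst (\<omega> t)) (snd (\<omega> t))) \<partial>traj_law m \<pi>)"

definition optimal_return :: "('s, 'a) mdp \<Rightarrow> real" where
  "optimal_return m = (SUP \<pi>\<in>policies m. expected_return m \<pi>)"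


section \<open>Parametrized policies\<close>

text \<open>\<open>p \<theta> s a\<close> is the density at \<open>a\<close> of the action taken in state \<open>s\<close> under parameter \<open>\<theta>\<close>.\<close>

definition is_policy_family ::
  "('s, 'a) mdp \<Rightarrow> (real^'n \<Rightarrow> 's \<Rightarrow> 'a \<Rightarrow> real) \<Rightarrow> bool" where
  "is_policy_family m p \<longleftrightarrow>
     (\<forall>\<theta>. (\<lambda>(s, a). p \<theta> s a) \<in> borel_measurable (state_actions m) \<and>
        (\<forall>s\<in>space (states m).
           (\<forall>a\<in>space (actions m). 0 \<le> p \<theta> s a) \<and>
           (\<integral>\<^sup>+ a. ennreal (p \<theta> s a) \<partial>actions m) = 1))"

definition param_policy ::
  "('s, 'a) mdp \<Rightarrow> (real^'n \<Rightarrow> 's \<Rightarrow> 'a \<Rightarrow> real) \<Rightarrow> real^'n \<Rightarrow> 's \<Rightarrow> 'a measure" where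
  "param_policy m p \<theta> s = density (actions m) (\<lambda>a. ennreal (p \<theta> s a))"

definition J :: "('s, 'a) mdp \<Rightarrow> (real^'n \<Rightarrow> 's \<Rightarrow> 'a \<Rightarrow> real) \<Rightarrow> real^'n \<Rightarrow> real" where
  "J m p \<theta> = expected_return m (param_policy m p \<theta>)"

definition pg_estimator ::
  "('s, 'a) mdp \<Rightarrow> (real^'n \<Rightarrow> 's \<Rightarrow> 'a \<Rightarrow> real) \<Rightarrow> nat \<Rightarrow>
   (nat \<Rightarrow> 's \<times> 'a) \<Rightarrow> real^'n \<Rightarrow> real^'n" where
  "pg_estimator m p H \<tau> \<theta> =
     (\<Sum>t<H. (\<Sum>h=t..<H. discount m ^ h * reward m (fst (\<tau> h)) (snd (\<tau> h))) *\<^sub>R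
        grad (\<lambda>\<theta>'. ln (p \<theta>' (fst (\<tau> t)) (snd (\<tau> t)))) \<theta>)"


section \<open>The algorithm N-PG-IGT\<close>

text \<open>A configuration after iteration \<open>t\<close> consists of the sequence of iterates, meaningful at the
  indices \<open>0, ..., t + 1\<close> only, and of the direction \<open>d\<^sub>t\<close>.\<close>

abbreviation config_space :: "((nat \<Rightarrow> real^'n) \<times> (real^'n)) measure" where
  "config_space \<equiv> PiM UNIV (\<lambda>_. borel) \<Otimes>\<^sub>M borel"

definition lookahead :: "(nat \<Rightarrow> real) \<Rightarrow> nat \<Rightarrow> (nat \<Rightarrow> real^'n) \<Rightarrow> real^'n" where
  "lookahead \<eta> t \<theta> = \<theta> t + ((1 - \<eta> t) / \<eta> t) *\<^sub>R (\<theta> t - \<theta> (t - 1))"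

definition igt_update ::
  "('s, 'a) mdp \<Rightarrow> (real^'n \<Rightarrow> 's \<Rightarrow> 'a \<Rightarrow> real) \<Rightarrow> nat \<Rightarrow> (nat \<Rightarrow> real) \<Rightarrow> (nat \<Rightarrow> real) \<Rightarrow> nat \<Rightarrow>
   (nat \<Rightarrow> real^'n) \<times> (real^'n) \<Rightarrow> (nat \<Rightarrow> 's \<times> 'a) \<Rightarrow> (nat \<Rightarrow> real^'n) \<times> (real^'n)" where
  "igt_update m p H \<eta> \<alpha> t c \<tau> =
     (let (\<theta>, d) = c;
          d' = (1 - \<eta> t) *\<^sub>R d + \<eta> t *\<^sub>R pg_estimator m p H \<tau> (lookahead \<eta> t \<theta>)
      in (\<theta>(Suc t := \<theta> t + (if d' = 0 then 0 else (\<alpha> t / norm d') *\<^sub>R d')), d'))"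

text \<open>\<open>igt_run m p H \<eta> \<alpha> \<theta>\<^sub>0 I t\<close> is the law of the configuration after iterations \<open>1, ..., t\<close>, with
  momentum parameters \<open>\<eta>\<close> and step sizes \<open>\<alpha>\<close>. The inputs \<open>(\<theta>\<^sub>1, d\<^sub>0)\<close> have joint law \<open>I\<close>; fixed inputs
  correspond to a point mass. The trajectory drawn in each iteration depends on the past only
  through the lookahead point.\<close>

primrec igt_run ::
  "('s, 'a) mdp \<Rightarrow> (real^'n \<Rightarrow> 's \<Rightarrow> 'a \<Rightarrow> real) \<Rightarrow> nat \<Rightarrow> (nat \<Rightarrow> real) \<Rightarrow> (nat \<Rightarrow> real) \<Rightarrow>
   real^'n \<Rightarrow> ((real^'n) \<times> (real^'n)) measure \<Rightarrow> nat \<Rightarrow> ((nat \<Rightarrow> real^'n) \<times> (real^'n)) measure" where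
  "igt_run m p H \<eta> \<alpha> \<theta>\<^sub>0 I 0 =
     distr I config_space (\<lambda>(\<theta>\<^sub>1, d\<^sub>0). (\<lambda>k. if k = 0 then \<theta>\<^sub>0 else \<theta>\<^sub>1, d\<^sub>0))"
| "igt_run m p H \<eta> \<alpha> \<theta>\<^sub>0 I (Suc n) =
     igt_run m p H \<eta> \<alpha> \<theta>\<^sub>0 I n \<bind>
       (\<lambda>c. distr (traj_law_upto m H (param_policy m p (lookahead \<eta> (Suc n) (fst c))))
               config_space (igt_update m p H \<eta> \<alpha> (Suc n) c))"

text \<open>The random iterate: an index \<open>k < T\<close>, independent of the run, with probability proportional
  to \<open>\<alpha> k\<close>.\<close>

definition igt_index :: "(nat \<Rightarrow> real) \<Rightarrow> nat \<Rightarrow> nat measure" where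
  "igt_index \<alpha> T = point_measure {..<T} (\<lambda>t. ennreal (\<alpha> t / (\<Sum>s<T. \<alpha> s)))"

definition igt_output ::
  "('s, 'a) mdp \<Rightarrow> (real^'n \<Rightarrow> 's \<Rightarrow> 'a \<Rightarrow> real) \<Rightarrow> nat \<Rightarrow> (nat \<Rightarrow> real) \<Rightarrow> (nat \<Rightarrow> real) \<Rightarrow>
   real^'n \<Rightarrow> ((real^'n) \<times> (real^'n)) measure \<Rightarrow> nat \<Rightarrow> (real^'n) measure" where
  "igt_output m p H \<eta> \<alpha> \<theta>\<^sub>0 I T =
     distr (igt_run m p H \<eta> \<alpha> \<theta>\<^sub>0 I (T - 1) \<Otimes>\<^sub>M igt_index \<alpha> T) borel (\<lambda>((\<theta>, d), k). \<theta> k)"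

definition step_size :: "nat \<Rightarrow> real" where
  "step_size t = (2 / (real t + 2)) powr (5 / 7)"

definition momentum :: "nat \<Rightarrow> real" where
  "momentum t = (2 / (real t + 2)) powr (4 / 7)"

definition horizon :: "real \<Rightarrow> nat \<Rightarrow> nat" where
  "horizon \<gamma> T = nat \<lceil>ln (real T + 1) / (1 - \<gamma>)\<rceil>"


section \<open>Constants\<close>

definition L_grad :: "real \<Rightarrow> real \<Rightarrow> real \<Rightarrow> real \<Rightarrow> real" where
  "L_grad r \<gamma> M\<^sub>g M\<^sub>h = r * (M\<^sub>g\<^sup>2 + M\<^sub>h) / (1 - \<gamma>)\<^sup>2"

definition sigma_grad :: "real \<Rightarrow> real \<Rightarrow> real \<Rightarrow> real" where
  "sigma_grad r \<gamma> M\<^sub>g = sqrt (r\<^sup>2 * M\<^sub>g\<^sup>2 / (1 - \<gamma>) ^ 3)"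

definition D_grad :: "real \<Rightarrow> real \<Rightarrow> real \<Rightarrow> nat \<Rightarrow> real" where
  "D_grad r \<gamma> M\<^sub>g H = M\<^sub>g * r / (1 - \<gamma>) * sqrt (1 / (1 - \<gamma>) + real H)"

definition D_hess :: "real \<Rightarrow> real \<Rightarrow> real \<Rightarrow> real \<Rightarrow> nat \<Rightarrow> real" where
  "D_hess r \<gamma> M\<^sub>g M\<^sub>h H = r * (M\<^sub>h + M\<^sub>g\<^sup>2) / (1 - \<gamma>) * (real H + 1 / (1 - \<gamma>))"

definition L_hess :: "real \<Rightarrow> real \<Rightarrow> real \<Rightarrow> real \<Rightarrow> real \<Rightarrow> real" where
  "L_hess r \<gamma> M\<^sub>g M\<^sub>h l\<^sub>2 =
     r * M\<^sub>g * M\<^sub>h / (1 - \<gamma>)\<^sup>2 + r * M\<^sub>g ^ 3 * (1 + \<gamma>) / (1 - \<gamma>) ^ 3 +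
     r * M\<^sub>g / (1 - \<gamma>) *
       Max {M\<^sub>h, \<gamma> * M\<^sub>g\<^sup>2 / (1 - \<gamma>), l\<^sub>2 / M\<^sub>g, M\<^sub>h * \<gamma> / (1 - \<gamma>),
            (M\<^sub>g * (1 + \<gamma>) + M\<^sub>h * \<gamma> * (1 - \<gamma>)) / (1 - \<gamma>\<^sup>2)}"

end

theory Submission
  imports Defs
begin

text \<open>
  Let \<open>d\<close> be the direction and \<open>\<theta>\<close> the iterates of the algorithm. Replacing each gradient estimate
  by its conditional mean gives a direction that is a function of \<open>\<theta>\<close>; its distance to \<open>\<nabla>J(\<theta>\<^sub>t)\<close>
  is controlled deterministically, since at the lookahead point the second-order Taylor terms cancel,
  and the truncation bias is at most \<open>D\<^sub>g \<gamma>\<^sup>H\<close>. What remains is a martingale with increments of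
  variance at most \<open>\<sigma>\<^sub>g\<^sup>2\<close>. Both errors are of order \<open>(t + 1) powr (-2/7)\<close>, and a descent inequality
  for the normalized step bounds the weighted sum of the gradient norms.

  Summing \<open>L\<^sub>g\<close> over the squared steps would only give \<open>L\<^sub>g / T powr (2/7)\<close>. The smoothness
  constant \<open>2 \<sigma>\<^sub>g + L\<^sub>h\<close>, which follows from \<open>\<bar>\<nabla>J\<bar> \<le> \<sigma>\<^sub>g\<close> and the Lipschitz Hessian, avoids this: its
  contribution is absorbed in the last term.

  The law of a trajectory of length \<open>n\<close> under \<open>\<theta>'\<close> has density \<open>\<Prod>\<^sub>t \<pi>\<^sub>\<theta>\<^sub>'(a\<^sub>t|s\<^sub>t) / \<pi>\<^sub>\<theta>(a\<^sub>t|s\<^sub>t)\<close> with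
  respect to the law under \<open>\<theta>\<close>. As the scores are bounded, this density and its derivatives are locally
  bounded, so the expected reward at each time may be differentiated twice under the integral.
\<close>

section \<open>Gradients, differentiation under integrals and series\<close>

text \<open>The exponents express one balance in the unit \<open>schedule k\<close>, the power 2/7
  of 2/(k+2): the momentum \<eta> is its square, the step size \<alpha> its 5/2 power. Noise adds
  variance \<open>\<sigma>\<^sup>2 * \<eta>\<^sup>2\<close> per iteration and is damped at rate
  \<eta>, so it settles at \<open>\<sigma>\<^sup>2 * \<eta>\<close>, a deviation of order \<sigma>
  times the unit. The Taylor remainder \<open>L * \<alpha>\<^sup>2 / \<eta>\<close> is L * \<eta>
  times the unit up to an index shift, and settles at L times the unit. Since \<alpha> times the
  unit is 2/(k+2), the weighted errors sum to a logarithm, which is divided by a total step size of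
  order at least \<open>T powr (2/7)\<close>. Two obstacles shape the route. Gradient and Hessian
  are description-style definitions, so the Lipschitz bound on \<open>hess (J m p)\<close> gives
  Taylor estimates only after \<open>grad (J m p)\<close> is shown to be differentiable; this is the
  purpose of differentiating twice, and the bounds obtained there only have to be integrable and
  summable. Moreover the initial direction may have no second moment, so a plain variance recursion
  could not start.\<close>

lemma grad_eqI:
  assumes "GDERIV f x :> D"
  shows "grad f x = D"
proof -
  have "D' = D" if "GDERIV f x :> D'" for D'
    using has_derivative_unique[OF that[unfolded gderiv_def] assms[unfolded gderiv_def]]
    by (metis inner_commute vector_eq_ldot)
  then show ?thesis
    unfolding grad_def using assms by blast
qed

text \<open>Riesz representation in coordinates: the values of the derivative on the basis assemble
  into the gradient vector.\<close>

lemma GDERIV_grad: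
  fixes f :: "real^'n \<Rightarrow> real"
  assumes "f differentiable (at x)"
  shows "GDERIV f x :> grad f x"
proof -
  obtain f' where f': "(f has_derivative f') (at x)"
    using assms by (auto simp: differentiable_def)
  interpret linear f'
    by (rule has_derivative_linear[OF f'])
  have "f' h = h \<bullet> (\<Sum>b\<in>Basis. f' b *\<^sub>R b)" for h
  proof -
    have "f' h = f' (\<Sum>b\<in>Basis. (h \<bullet> b) *\<^sub>R b)"
      by (simp add: euclidean_representation)
    also have "\<dots> = (\<Sum>b\<in>Basis. (h \<bullet> b) * f' b)"
      by (simp add: sum scale)
    finally show ?thesis
      by (simp add: inner_sum_right mult.commute)
  qed
  then have "GDERIV f x :> (\<Sum>b\<in>Basis. f' b *\<^sub>R b)"
    unfolding gderiv_def by (intro has_derivative_subst[OF f'] ext)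
  then show ?thesis
    by (simp add: grad_eqI)
qed

text \<open>\<open>Blinfun\<close> is meaningful only for bounded linear maps; differentiability
  guarantees this for the Frechet derivative inside \<open>hess\<close>.\<close>

lemma has_derivative_grad:
  assumes "grad f differentiable (at x)"
  shows "(grad f has_derivative blinfun_apply (hess f x)) (at x)"
proof -
  from assms have "(grad f has_derivative frechet_derivative (grad f) (at x)) (at x)"
    by (simp add: frechet_derivative_works)
  then show ?thesis
    unfolding hess_def using bounded_linear_Blinfun_apply[OF has_derivative_bounded_linear] by metis
qed

text \<open>Simple functions \<open>F i\<close> converge to the identity on the parameter space.
  Composing with \<open>F i\<close> leaves finitely many sections, hence a measurable function, and
  continuity in the parameter passes to the limit.\<close>

lemma borel_measurable_Caratheodory:
  fixes f :: "'b::{metric_space, second_countable_topology} \<Rightarrow> 'w \<Rightarrow> real"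
  assumes meas: "\<And>\<theta>. f \<theta> \<in> borel_measurable M"
    and cont: "\<And>x. x \<in> space M \<Longrightarrow> continuous_on UNIV (\<lambda>\<theta>. f \<theta> x)"
  shows "(\<lambda>(\<theta>, x). f \<theta> x) \<in> borel_measurable (borel \<Otimes>\<^sub>M M)"
proof -
  obtain F :: "nat \<Rightarrow> 'b \<Rightarrow> 'b" where F: "\<And>i. simple_function borel (F i)"
      and lim: "\<And>x. (\<lambda>i. F i x) \<longlonglongrightarrow> x"
    using borel_measurable_implies_sequence_metric[of "\<lambda>x::'b. x" borel undefined] by auto
  have "(\<lambda>z. f (F i (fst z)) (snd z)) \<in> borel_measurable (borel \<Otimes>\<^sub>M M)" for i
  proof (rule measurable_compose_countable'[where I="range (F i)" and g="\<lambda>z. F i (fst z)"])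
    show "(\<lambda>x. f t (snd x)) \<in> borel_measurable (borel \<Otimes>\<^sub>M M)" for t
      using meas by measurable
    show "(\<lambda>z. F i (fst z)) \<in> borel \<Otimes>\<^sub>M M \<rightarrow>\<^sub>M count_space (range (F i))"
      using F[of i] measurable_simple_function[OF F, of i]
      by (intro measurable_compose[OF measurable_fst])
        (auto simp: measurable_count_space_eq2 simple_function_def)
    show "countable (range (F i))"
      using F[of i] by (simp add: simple_function_def countable_finite)
  qed
  moreover have "(\<lambda>i. f (F i (fst z)) (snd z)) \<longlonglongrightarrow> f (fst z) (snd z)"
    if "z \<in> space (borel \<Otimes>\<^sub>M M)" for z
    using continuous_on_tendsto_compose[OF cont lim[of "fst z"], of "snd z"] that
    by (auto simp: space_pair_measure)
  ultimately have "(\<lambda>z. f (fst z) (snd z)) \<in> borel_measurable (borel \<Otimes>\<^sub>M M)"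
    by (rule borel_measurable_LIMSEQ_real[rotated])
  then show ?thesis
    by (simp add: case_prod_beta')
qed

text \<open>The sequential form exhibits derivatives as limits of measurable functions, which is how
  scores and derivatives under the integral become measurable.\<close>

lemma has_derivative_difference_quotient:
  fixes f :: "'a::real_normed_vector \<Rightarrow> 'b::real_normed_vector"
  assumes f: "(f has_derivative f') (at x)"
  shows "(\<lambda>n. real (Suc n) *\<^sub>R (f (x + (1 / real (Suc n)) *\<^sub>R v) - f x)) \<longlonglongrightarrow> f' v"
proof (cases "v = 0")
  case True
  then show ?thesis
    using f has_derivative_linear linear_0 by fastforce
next
  case False
  define X where "X n = x + (1 / real (Suc n)) *\<^sub>R v" for n
  define q where "q y = (f y - f x - f' (y - x)) /\<^sub>R norm (y - x)" for y
  have "(\<lambda>n. (1 / real (Suc n)) *\<^sub>R v) \<longlonglongrightarrow> 0 *\<^sub>R v"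
    by (intro tendsto_intros LIMSEQ_Suc lim_1_over_n)
  then have "X \<longlonglongrightarrow> x"
    unfolding X_def using tendsto_add[OF tendsto_const, of _ 0] by fastforce
  moreover have "\<forall>i. X i \<in> UNIV - {x}"
    using False by (simp add: X_def)
  moreover have "(q \<longlongrightarrow> 0) (at x)"
    using f unfolding q_def has_derivative_at_within by simp
  ultimately have "(\<lambda>n. q (X n)) \<longlonglongrightarrow> 0"
    unfolding tendsto_at_iff_sequentially comp_def by blast
  then have "(\<lambda>n. norm v *\<^sub>R q (X n) + f' v) \<longlonglongrightarrow> norm v *\<^sub>R 0 + f' v"
    by (intro tendsto_intros)
  moreover have "norm v *\<^sub>R q (X n) + f' v = real (Suc n) *\<^sub>R (f (X n) - f x)" for n
  proof -
    have "f' ((1 / real (Suc n)) *\<^sub>R v) = (1 / real (Suc n)) *\<^sub>R f' v"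
      using f has_derivative_linear linear_scale by blast
    then show ?thesis
      using False by (simp add: q_def X_def scaleR_diff_right del: of_nat_Suc)
  qed
  ultimately show ?thesis
    unfolding X_def by simp
qed

lemma borel_measurable_derivative:
  fixes f :: "'a::real_normed_vector \<Rightarrow> 'w \<Rightarrow> 'b::{real_normed_vector, second_countable_topology}"
  assumes "\<And>\<theta>. f \<theta> \<in> borel_measurable M"
    and "\<And>w. w \<in> space M \<Longrightarrow> ((\<lambda>\<theta>. f \<theta> w) has_derivative f' w) (at \<theta>)"
  shows "(\<lambda>w. f' w v) \<in> borel_measurable M"
proof (rule borel_measurable_LIMSEQ_metric)
  show "(\<lambda>w. real (Suc n) *\<^sub>R (f (\<theta> + (1 / real (Suc n)) *\<^sub>R v) w - f \<theta> w)) \<in> borel_measurable M" for n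
    using assms(1) by measurable
  show "(\<lambda>n. real (Suc n) *\<^sub>R (f (\<theta> + (1 / real (Suc n)) *\<^sub>R v) w - f \<theta> w)) \<longlonglongrightarrow> f' w v"
    if "w \<in> space M" for w
    using has_derivative_difference_quotient[OF assms(2)[OF that]] .
qed

text \<open>Dominated convergence for the remainder quotients. The mean value inequality on the unit
  ball bounds each quotient by \<open>2 * B\<close>, which is integrable for a finite measure. The
  bound is required only near \<open>\<theta>\<^sub>0\<close> because likelihood ratios are bounded
  only locally in the parameter.\<close>

lemma has_derivative_integral_bounded:
  fixes f :: "'a::euclidean_space \<Rightarrow> 'w \<Rightarrow> 'b::{banach, second_countable_topology}"
  assumes M: "finite_measure M" and meas: "\<And>\<theta>. f \<theta> \<in> borel_measurable M"
    and int: "\<And>\<theta>. integrable M (f \<theta>)"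
    and der: "\<And>\<theta> w. w \<in> space M \<Longrightarrow> ((\<lambda>\<theta>. f \<theta> w) has_derivative f' \<theta> w) (at \<theta>)"
    and bound: "\<And>\<theta> w v. \<theta> \<in> ball \<theta>\<^sub>0 1 \<Longrightarrow> w \<in> space M \<Longrightarrow> norm (f' \<theta> w v) \<le> B * norm v"
  shows "integrable M (\<lambda>w. f' \<theta>\<^sub>0 w v)"
    and "((\<lambda>\<theta>. \<integral>w. f \<theta> w \<partial>M) has_derivative (\<lambda>v. \<integral>w. f' \<theta>\<^sub>0 w v \<partial>M)) (at \<theta>\<^sub>0)"
proof -
  interpret finite_measure M by fact
  have meas': "(\<lambda>w. f' \<theta>\<^sub>0 w v) \<in> borel_measurable M" for v
    using borel_measurable_derivative[OF meas der] .
  have int': "integrable M (\<lambda>w. f' \<theta>\<^sub>0 w v)" for v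
    using bound[of \<theta>\<^sub>0 _ v] by (intro integrable_const_bound[where B="B * norm v"] meas') auto
  then show "integrable M (\<lambda>w. f' \<theta>\<^sub>0 w v)" .
  have lin: "linear (f' \<theta> w)" if "w \<in> space M" for w \<theta>
    using der[OF that] has_derivative_linear by blast
  have lip: "norm (f y w - f \<theta>\<^sub>0 w) \<le> B * norm (y - \<theta>\<^sub>0)" if "y \<in> ball \<theta>\<^sub>0 1" "w \<in> space M" for y w
  proof (rule differentiable_bound[of "ball \<theta>\<^sub>0 1"])
    show "((\<lambda>\<theta>. f \<theta> w) has_derivative f' \<theta> w) (at \<theta> within ball \<theta>\<^sub>0 1)" for \<theta>
      using der[OF that(2)] has_derivative_at_withinI by blast
    show "onorm (f' \<theta> w) \<le> B" if "\<theta> \<in> ball \<theta>\<^sub>0 1" for \<theta>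
      using bound[OF that \<open>w \<in> space M\<close>] by (rule onorm_le)
  qed (use that in auto)
  \<comment> \<open>Linearity suffices, since the parameter space is finite-dimensional.\<close>
  have bl: "bounded_linear (\<lambda>v. \<integral>w. f' \<theta>\<^sub>0 w v \<partial>M)"
  proof (rule linear_conv_bounded_linear[THEN iffD1], rule linearI)
    show "(\<integral>w. f' \<theta>\<^sub>0 w (x + y) \<partial>M) = (\<integral>w. f' \<theta>\<^sub>0 w x \<partial>M) + (\<integral>w. f' \<theta>\<^sub>0 w y \<partial>M)" for x y
      by (subst Bochner_Integration.integral_add[symmetric])
        (auto intro!: int' Bochner_Integration.integral_cong simp: linear_add[OF lin])
    show "(\<integral>w. f' \<theta>\<^sub>0 w (r *\<^sub>R x) \<partial>M) = r *\<^sub>R (\<integral>w. f' \<theta>\<^sub>0 w x \<partial>M)" for r x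
      by (subst integral_scaleR_right[symmetric], rule Bochner_Integration.integral_cong)
        (auto simp: linear_scale[OF lin])
  qed
  have "((\<lambda>y. ((\<integral>w. f y w \<partial>M) - (\<integral>w. f \<theta>\<^sub>0 w \<partial>M) - (\<integral>w. f' \<theta>\<^sub>0 w (y - \<theta>\<^sub>0) \<partial>M)) /\<^sub>R norm (y - \<theta>\<^sub>0)) \<longlongrightarrow> 0) (at \<theta>\<^sub>0)"
    unfolding tendsto_at_iff_sequentially
  proof (intro allI impI)
    fix X :: "nat \<Rightarrow> 'a" assume X: "\<forall>i. X i \<in> UNIV - {\<theta>\<^sub>0}" "X \<longlonglongrightarrow> \<theta>\<^sub>0"
    define q where "q n w = (f (X n) w - f \<theta>\<^sub>0 w - f' \<theta>\<^sub>0 w (X n - \<theta>\<^sub>0)) /\<^sub>R norm (X n - \<theta>\<^sub>0)" for n w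
    \<comment> \<open>Only a tail of the sequence lies in the unit ball where the bound holds;
      dominated convergence is applied to that tail.\<close>
    obtain N where N: "\<And>n. n \<ge> N \<Longrightarrow> X n \<in> ball \<theta>\<^sub>0 1"
      using X(2) by (metis dist_commute lim_sequentially mem_ball zero_less_one)
    have q_bound: "norm (q n w) \<le> 2 * B" if "n \<ge> N" "w \<in> space M" for n w
    proof -
      have pos: "norm (X n - \<theta>\<^sub>0) > 0"
        using X(1) by auto
      have "norm (f (X n) w - f \<theta>\<^sub>0 w - f' \<theta>\<^sub>0 w (X n - \<theta>\<^sub>0)) \<le>
          norm (f (X n) w - f \<theta>\<^sub>0 w) + norm (f' \<theta>\<^sub>0 w (X n - \<theta>\<^sub>0))"
        by (rule norm_triangle_ineq4)
      also have "\<dots> \<le> 2 * B * norm (X n - \<theta>\<^sub>0)"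
        using lip[OF N[OF that(1)] that(2)] bound[of \<theta>\<^sub>0 w "X n - \<theta>\<^sub>0"] that by simp
      finally show ?thesis
        using pos by (simp add: q_def divide_simps mult.commute)
    qed
    have "(\<lambda>n. \<integral>w. q (n + N) w \<partial>M) \<longlonglongrightarrow> (\<integral>w. 0 \<partial>M)"
    proof (rule integral_dominated_convergence)
      show "integrable M (\<lambda>w. 2 * B)" by simp
      show "q (n + N) \<in> borel_measurable M" for n
        unfolding q_def using meas meas' by measurable
      show "AE w in M. norm (q (n + N) w) \<le> 2 * B" for n
        using q_bound by auto
      show "AE w in M. (\<lambda>n. q (n + N) w) \<longlonglongrightarrow> 0"
      proof (rule AE_I2)
        fix w assume "w \<in> space M"
        from der[OF this, of \<theta>\<^sub>0] have "((\<lambda>y. (f y w - f \<theta>\<^sub>0 w - f' \<theta>\<^sub>0 w (y - \<theta>\<^sub>0)) /\<^sub>R norm (y - \<theta>\<^sub>0)) \<longlongrightarrow> 0) (at \<theta>\<^sub>0)"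
          unfolding has_derivative_at_within by simp
        then have "(\<lambda>n. q n w) \<longlonglongrightarrow> 0"
          using X unfolding tendsto_at_iff_sequentially q_def comp_def by blast
        then show "(\<lambda>n. q (n + N) w) \<longlonglongrightarrow> 0"
          by (rule LIMSEQ_ignore_initial_segment)
      qed
    qed simp
    then have "(\<lambda>n. \<integral>w. q n w \<partial>M) \<longlonglongrightarrow> 0"
      by (simp add: LIMSEQ_offset)
    moreover have "(\<integral>w. q n w \<partial>M) =
      ((\<integral>w. f (X n) w \<partial>M) - (\<integral>w. f \<theta>\<^sub>0 w \<partial>M) - (\<integral>w. f' \<theta>\<^sub>0 w (X n - \<theta>\<^sub>0) \<partial>M)) /\<^sub>R norm (X n - \<theta>\<^sub>0)" for n
      unfolding q_def using int int' by simp
    ultimately show "((\<lambda>y. ((\<integral>w. f y w \<partial>M) - (\<integral>w. f \<theta>\<^sub>0 w \<partial>M) - (\<integral>w. f' \<theta>\<^sub>0 w (y - \<theta>\<^sub>0) \<partial>M)) /\<^sub>R norm (y - \<theta>\<^sub>0)) \<circ> X) \<longlonglongrightarrow> 0"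
      by (simp add: comp_def)
  qed
  then show "((\<lambda>\<theta>. \<integral>w. f \<theta> w \<partial>M) has_derivative (\<lambda>v. \<integral>w. f' \<theta>\<^sub>0 w v \<partial>M)) (at \<theta>\<^sub>0)"
    using bl unfolding has_derivative_at_within by simp
qed

text \<open>Weierstrass test for derivatives: the tails of \<open>B\<close> bound the operator norms
  of the tails of the derivative series, uniformly in the point.\<close>

lemma has_derivative_suminf_bounded:
  fixes f :: "nat \<Rightarrow> 'a::real_normed_vector \<Rightarrow> 'b::banach"
  assumes der: "\<And>n x. (f n has_derivative f' n x) (at x)"
    and bound: "\<And>n x v. norm (f' n x v) \<le> B n * norm v" and B: "summable B"
    and summ: "\<And>x. summable (\<lambda>n. f n x)"
  shows "((\<lambda>x. \<Sum>n. f n x) has_derivative (\<lambda>v. \<Sum>n. f' n x v)) (at x)"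
proof -
  have summ': "summable (\<lambda>n. f' n x v)" for x v
    using bound by (intro summable_comparison_test'[OF summable_mult2[OF B]]) auto
  have "\<exists>g. \<forall>x\<in>UNIV. (\<lambda>n. f n x) sums g x \<and> (g has_derivative (\<lambda>v. \<Sum>n. f' n x v)) (at x within UNIV)"
  proof (rule has_derivative_series)
    show "(\<lambda>n. f n x) sums (\<Sum>n. f n x)"
      using summ by (rule summable_sums)
    fix e :: real assume "e > 0"
    have "(\<lambda>n. \<Sum>k. B (k + n)) \<longlonglongrightarrow> 0"
      using suminf_exist_split2[OF B] .
    then have "\<forall>\<^sub>F n in sequentially. (\<Sum>k. B (k + n)) < e"
      using \<open>e > 0\<close> by (rule order_tendstoD)
    then show "\<forall>\<^sub>F n in sequentially. \<forall>x\<in>UNIV. \<forall>h::'a. norm ((\<Sum>i<n. f' i x h) - (\<Sum>n. f' n x h)) \<le> e * norm h"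
    proof (eventually_elim, intro ballI allI)
      fix n x and h :: 'a assume n: "(\<Sum>k. B (k + n)) < e"
      have *: "summable (\<lambda>k. B (k + n) * norm h)"
        using B by (intro summable_mult2 summable_ignore_initial_segment)
      have "norm ((\<Sum>i<n. f' i x h) - (\<Sum>n. f' n x h)) = norm (\<Sum>k. f' (k + n) x h)"
        using suminf_split_initial_segment[OF summ', of x h n] by (simp add: norm_minus_commute)
      also have "\<dots> \<le> (\<Sum>k. norm (f' (k + n) x h))"
        using bound by (intro summable_norm summable_comparison_test'[OF *]) auto
      also have "\<dots> \<le> (\<Sum>k. B (k + n) * norm h)"
        using bound by (intro suminf_le * summable_comparison_test'[OF *]) auto
      also have "\<dots> = (\<Sum>k. B (k + n)) * norm h"
        using B by (intro suminf_mult2[symmetric] summable_ignore_initial_segment)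
      also have "\<dots> \<le> e * norm h"
        using n by (intro mult_right_mono) auto
      finally show "norm ((\<Sum>i<n. f' i x h) - (\<Sum>n. f' n x h)) \<le> e * norm h" .
    qed
  qed (use der in auto)
  then obtain g where g: "\<And>x. (\<lambda>n. f n x) sums g x"
      "\<And>x. (g has_derivative (\<lambda>v. \<Sum>n. f' n x v)) (at x)"
    by auto
  have "(\<lambda>x. \<Sum>n. f n x) = g"
    using g(1) by (auto simp: sums_iff)
  with g(2) show ?thesis by simp
qed

section \<open>Trajectory laws\<close>

text \<open>Tonelli makes the mass of each set measurable in the parameter. This serves for the
  transitions, for the policies and for the trajectory law as a function of \<theta>.\<close>

lemma measurable_density_prob_algebra:
  assumes "sigma_finite_measure S"
    and f: "(\<lambda>(x, y). f x y) \<in> borel_measurable (N \<Otimes>\<^sub>M S)"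
    and one: "\<And>x. x \<in> space N \<Longrightarrow> (\<integral>\<^sup>+ y. f x y \<partial>S) = 1"
  shows "(\<lambda>x. density S (f x)) \<in> N \<rightarrow>\<^sub>M prob_algebra S"
proof (rule measurable_prob_algebraI)
  interpret sigma_finite_measure S by fact
  have f_x: "f x \<in> borel_measurable S" if "x \<in> space N" for x
    using measurable_compose[OF measurable_Pair1'[OF that] f] by simp
  show prob: "prob_space (density S (f x))" if "x \<in> space N" for x
    using one[OF that] f_x[OF that] by (intro prob_spaceI) (simp add: emeasure_density cong: nn_integral_cong)
  show "(\<lambda>x. density S (f x)) \<in> N \<rightarrow>\<^sub>M subprob_algebra S"
  proof (rule measurable_subprob_algebra)
    show "subprob_space (density S (f x))" if "x \<in> space N" for x
      using prob[OF that] by (rule prob_space_imp_subprob_space)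
    fix A assume A[measurable]: "A \<in> sets S"
    have "(\<lambda>x. \<integral>\<^sup>+ y. f x y * indicator A y \<partial>S) \<in> borel_measurable N"
      using f by (intro borel_measurable_nn_integral) (simp add: case_prod_beta')
    then show "(\<lambda>x. emeasure (density S (f x)) A) \<in> borel_measurable N"
      by (rule measurable_cong[THEN iffD1, rotated]) (simp add: emeasure_density f_x)
  qed simp
qed

locale discounted_mdp =
  fixes m :: "('s, 'a) mdp"
  assumes is_mdp: "is_mdp m"
begin

abbreviation "X \<equiv> state_actions m"

lemma sigma_finite_states: "sigma_finite_measure (states m)"
  and sigma_finite_actions: "sigma_finite_measure (actions m)"
  and transition_measurable: "(\<lambda>((s, a), s'). transition m s a s') \<in> borel_measurable (X \<Otimes>\<^sub>M states m)"
  and transition_integral: "\<And>s a. s \<in> space (states m) \<Longrightarrow> a \<in> space (actions m) \<Longrightarrow>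
    (\<integral>\<^sup>+ s'. ennreal (transition m s a s') \<partial>states m) = 1"
  and reward_measurable[measurable]: "(\<lambda>(s, a). reward m s a) \<in> borel_measurable X"
  and reward_bound_pos: "0 < reward_bound m"
  and reward_le: "\<And>s a. s \<in> space (states m) \<Longrightarrow> a \<in> space (actions m) \<Longrightarrow> \<bar>reward m s a\<bar> \<le> reward_bound m"
  and prob_space_init: "prob_space (init m)"
  and sets_init: "sets (init m) = sets (states m)"
  and discount_pos: "0 < discount m"
  and discount_less_1: "discount m < 1"
  using is_mdp unfolding is_mdp_def by blast+

lemma draw_action_measurable:
  assumes "\<pi> \<in> policies m"
  shows "draw_action m \<pi> \<in> states m \<rightarrow>\<^sub>M prob_algebra X"
  unfolding draw_action_def
proof (rule measurable_distr_prob_space2)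
  show "\<pi> \<in> states m \<rightarrow>\<^sub>M prob_algebra (actions m)"
    using assms by (simp add: policies_def)
  show "(\<lambda>(s, a). (s, a)) \<in> X \<rightarrow>\<^sub>M X"
    by measurable
qed

text \<open>The index set \<open>{0..<n}\<close> is the form demanded by
  \<open>Ionescu_Tulcea\<close>; trajectories are otherwise indexed by \<open>{..<n}\<close>, hence
  the later conversions.\<close>

lemma traj_kernel_measurable:
  assumes "\<pi> \<in> policies m"
  shows "traj_kernel m \<pi> n \<in> PiM {0..<n} (\<lambda>_. X) \<rightarrow>\<^sub>M prob_algebra X"
proof (cases n)
  case 0
  have "traj_kernel m \<pi> 0 = (\<lambda>_. init m \<bind> draw_action m \<pi>)"
    by auto
  then show ?thesis
    unfolding 0 using draw_action_measurable[OF assms] prob_space_init sets_init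
    by (auto intro!: measurable_bind_prob_space[of _ _ "states m"] simp: space_prob_algebra)
next
  case (Suc t)
  have comp: "(\<lambda>z. ((fst z) t, snd z)) \<in> PiM {0..<Suc t} (\<lambda>_. X) \<Otimes>\<^sub>M states m \<rightarrow>\<^sub>M X \<Otimes>\<^sub>M states m"
    by (intro measurable_Pair measurable_compose[OF measurable_fst] measurable_component_singleton) auto
  have "(\<lambda>\<omega>. density (states m) (\<lambda>s'. ennreal (transition m (fst (\<omega> t)) (snd (\<omega> t)) s')))
    \<in> PiM {0..<Suc t} (\<lambda>_. X) \<rightarrow>\<^sub>M prob_algebra (states m)"
  proof (rule measurable_density_prob_algebra[OF sigma_finite_states])
    show "(\<lambda>(\<omega>, s'). ennreal (transition m (fst (\<omega> t)) (snd (\<omega> t)) s'))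
      \<in> borel_measurable (PiM {0..<Suc t} (\<lambda>_. X) \<Otimes>\<^sub>M states m)"
      using measurable_compose[OF comp transition_measurable] by (simp add: case_prod_beta')
    show "(\<integral>\<^sup>+ s'. ennreal (transition m (fst (\<omega> t)) (snd (\<omega> t)) s') \<partial>states m) = 1"
      if "\<omega> \<in> space (PiM {0..<Suc t} (\<lambda>_. X))" for \<omega>
      using that by (intro transition_integral)
        (force simp: space_PiM space_pair_measure PiE_iff)+
  qed
  moreover have "traj_kernel m \<pi> (Suc t) = (\<lambda>\<omega>. density (states m)
      (\<lambda>s'. ennreal (transition m (fst (\<omega> t)) (snd (\<omega> t)) s')) \<bind> draw_action m \<pi>)"
    by auto
  ultimately show ?thesis
    unfolding Suc using measurable_bind_prob_space[OF _ draw_action_measurable[OF assms]] by simp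
qed

lemma Ionescu_Tulcea_traj_kernel:
  assumes "\<pi> \<in> policies m"
  shows "Ionescu_Tulcea (traj_kernel m \<pi>) (\<lambda>_. X)"
  using traj_kernel_measurable[OF assms]
  by (intro Ionescu_Tulcea.intro measurable_prob_algebraD)
    (auto dest!: measurable_space[OF traj_kernel_measurable[OF assms]] simp: space_prob_algebra)

text \<open>The marginal of the projective limit on the first \<open>n\<close> coordinates is the
  finite composition \<open>IT.C 0 n\<close> of the kernels (fact \<open>upto\<close>). This yields
  the recursion behind the later inductions over the length.\<close>

lemma
  assumes "\<pi> \<in> policies m"
  shows sets_traj_law: "sets (traj_law m \<pi>) = sets (PiM UNIV (\<lambda>_. X))"
    and prob_space_traj_law: "prob_space (traj_law m \<pi>)"
    and traj_law_upto_0: "traj_law_upto m 0 \<pi> = return (PiM {..<0} (\<lambda>_. X)) (\<lambda>_. undefined)"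
    and traj_law_upto_Suc: "f \<in> borel_measurable (PiM {..<Suc n} (\<lambda>_. X)) \<Longrightarrow>
      (\<integral>\<^sup>+\<omega>. f \<omega> \<partial>traj_law_upto m (Suc n) \<pi>) =
      (\<integral>\<^sup>+\<omega>. \<integral>\<^sup>+x. f (fun_upd \<omega> n x) \<partial>traj_kernel m \<pi> n \<omega> \<partial>traj_law_upto m n \<pi>)"
proof -
  interpret IT: Ionescu_Tulcea "traj_kernel m \<pi>" "\<lambda>_. X"
    by (rule Ionescu_Tulcea_traj_kernel[OF assms])
  show sets_eq: "sets (traj_law m \<pi>) = sets (PiM UNIV (\<lambda>_. X))"
    unfolding traj_law_def by simp
  \<comment> \<open>The empty trajectory, the only point of the product over no coordinates, is the
    starting state of the composition.\<close>
  have [simp]: "(\<lambda>_. undefined) \<in> space (PiM {} (\<lambda>_. X))"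
    by (simp add: space_PiM)
  have upto: "traj_law_upto m n \<pi> = IT.C 0 n (\<lambda>_. undefined)" for n
  proof -
    have "traj_law_upto m n \<pi> = IT.CI {0..<n}"
      unfolding traj_law_upto_def traj_law_def lessThan_atLeast0 by (rule IT.distr_lim) simp
    also have "\<dots> = IT.C 0 n (\<lambda>_. undefined)"
    proof (rule measure_eqI)
      show "sets (IT.CI {0..<n}) = sets (IT.C 0 n (\<lambda>_. undefined))"
        by (simp add: IT.sets_C IT.CI_def)
      fix A assume "A \<in> sets (IT.CI {0..<n})"
      then have "A \<in> sets (PiM {0..<n} (\<lambda>_. X))"
        by (simp add: IT.CI_def)
      then show "emeasure (IT.CI {0..<n}) A = emeasure (IT.C 0 n (\<lambda>_. undefined)) A"
        using IT.emeasure_CI[of "{0..<n}" n A] prod_emb_id[of A "{0..<n}" "\<lambda>_. X"]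
        by (simp add: sets.sets_into_space[of A "PiM {0..<n} (\<lambda>_. X)", unfolded space_PiM])
    qed
    finally show ?thesis .
  qed
  \<comment> \<open>A push-forward keeps the total mass, so the mass of the full law can be read off
    from the marginal of length 0.\<close>
  have "prob_space (traj_law_upto m 0 \<pi>)"
    unfolding upto by (rule IT.prob_space_C) simp
  then show "prob_space (traj_law m \<pi>)"
    unfolding traj_law_upto_def
    by (rule prob_space_distrD[rotated]) (auto intro!: measurable_restrict simp: sets_eq cong: measurable_cong_sets)
  show "traj_law_upto m 0 \<pi> = return (PiM {..<0} (\<lambda>_. X)) (\<lambda>_. undefined)"
    unfolding upto by simp
  assume f: "f \<in> borel_measurable (PiM {..<Suc n} (\<lambda>_. X))"
  then have f': "f \<in> borel_measurable (PiM {0..<Suc n} (\<lambda>_. X))"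
    by (simp add: lessThan_atLeast0)
  have "(\<integral>\<^sup>+\<omega>. f \<omega> \<partial>IT.C 0 (Suc n) (\<lambda>_. undefined)) =
      (\<integral>\<^sup>+\<omega>. \<integral>\<^sup>+\<omega>'. f \<omega>' \<partial>IT.eP n \<omega> \<partial>IT.C 0 n (\<lambda>_. undefined))"
    using nn_integral_bind[OF f', of "IT.eP n" "IT.C 0 n (\<lambda>_. undefined)"]
    by (simp add: IT.measurable_eP measurable_cong_sets[OF IT.sets_C refl])
  also have "\<dots> = (\<integral>\<^sup>+\<omega>. \<integral>\<^sup>+x. f (fun_upd \<omega> n x) \<partial>traj_kernel m \<pi> n \<omega> \<partial>IT.C 0 n (\<lambda>_. undefined))"
    by (intro nn_integral_cong IT.nn_integral_eP f') (simp add: IT.space_C)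
  finally show "(\<integral>\<^sup>+\<omega>. f \<omega> \<partial>traj_law_upto m (Suc n) \<pi>) =
      (\<integral>\<^sup>+\<omega>. \<integral>\<^sup>+x. f (fun_upd \<omega> n x) \<partial>traj_kernel m \<pi> n \<omega> \<partial>traj_law_upto m n \<pi>)"
    unfolding upto .
qed

lemma sets_traj_law_upto[simp]: "sets (traj_law_upto m n \<pi>) = sets (PiM {..<n} (\<lambda>_. X))"
  and space_traj_law_upto[simp]: "space (traj_law_upto m n \<pi>) = space (PiM {..<n} (\<lambda>_. X))"
  by (simp_all add: traj_law_upto_def)

lemma measurable_restrict_traj:
  "\<pi> \<in> policies m \<Longrightarrow> (\<lambda>\<omega>. restrict \<omega> {..<n}) \<in> traj_law m \<pi> \<rightarrow>\<^sub>M PiM {..<n} (\<lambda>_. X)"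
  by (subst measurable_cong_sets[OF sets_traj_law refl]) (auto intro!: measurable_restrict)

lemma prob_space_traj_law_upto:
  "\<pi> \<in> policies m \<Longrightarrow> prob_space (traj_law_upto m n \<pi>)"
  unfolding traj_law_upto_def
  by (intro prob_space.prob_space_distr prob_space_traj_law measurable_restrict_traj)

lemma coordinate_in_space:
  "\<pi> \<in> policies m \<Longrightarrow> \<omega> \<in> space (traj_law m \<pi>) \<Longrightarrow> \<omega> t \<in> space X"
  using sets_eq_imp_space_eq[OF sets_traj_law[of \<pi>]] by (auto simp: space_PiM PiE_iff)

lemma measurable_coordinate:
  "\<pi> \<in> policies m \<Longrightarrow> (\<lambda>\<omega>. \<omega> t) \<in> traj_law m \<pi> \<rightarrow>\<^sub>M X"
  by (subst measurable_cong_sets[OF sets_traj_law refl]) auto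

text \<open>Bounded rewards make the geometric series dominate, so expectation and sum over time
  commute. Afterwards only marginals of finite length are needed.\<close>

lemma expected_return_eq_suminf:
  assumes \<pi>: "\<pi> \<in> policies m"
  defines "e \<equiv> \<lambda>t. \<integral>\<omega>. reward m (fst (\<omega> t)) (snd (\<omega> t)) \<partial>traj_law m \<pi>"
  shows "expected_return m \<pi> = (\<Sum>t. discount m ^ t * e t)"
    and "\<bar>e t\<bar> \<le> reward_bound m"
proof -
  interpret prob_space "traj_law m \<pi>" by (rule prob_space_traj_law[OF \<pi>])
  have bound: "\<bar>reward m (fst (\<omega> t)) (snd (\<omega> t))\<bar> \<le> reward_bound m" if "\<omega> \<in> space (traj_law m \<pi>)" for \<omega> t
    using coordinate_in_space[OF \<pi> that, of t] by (intro reward_le) (auto simp: space_pair_measure)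
  have meas: "(\<lambda>\<omega>. reward m (fst (\<omega> t)) (snd (\<omega> t))) \<in> borel_measurable (traj_law m \<pi>)" for t
    using measurable_compose[OF measurable_coordinate[OF \<pi>] reward_measurable, of t]
    by (simp add: case_prod_beta')
  have int: "integrable (traj_law m \<pi>) (\<lambda>\<omega>. reward m (fst (\<omega> t)) (snd (\<omega> t)))" for t
    using bound meas by (intro integrable_const_bound[where B="reward_bound m"]) auto
  have abs_int: "(\<integral>\<omega>. \<bar>reward m (fst (\<omega> t)) (snd (\<omega> t))\<bar> \<partial>traj_law m \<pi>) \<le> reward_bound m" for t
    using bound int by (intro integral_le_const integrable_abs) auto
  then show "\<bar>e t\<bar> \<le> reward_bound m"
    unfolding e_def by (rule order_trans[OF integral_abs_bound])
  have summ: "summable (\<lambda>t. discount m ^ t * reward_bound m)"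
    using discount_pos discount_less_1 by (intro summable_mult2 summable_geometric) auto
  have "(\<integral>\<omega>. (\<Sum>t. discount m ^ t * reward m (fst (\<omega> t)) (snd (\<omega> t))) \<partial>traj_law m \<pi>) =
      (\<Sum>t. \<integral>\<omega>. discount m ^ t * reward m (fst (\<omega> t)) (snd (\<omega> t)) \<partial>traj_law m \<pi>)"
  proof (rule integral_suminf)
    show "AE \<omega> in traj_law m \<pi>. summable (\<lambda>t. norm (discount m ^ t * reward m (fst (\<omega> t)) (snd (\<omega> t))))"
      using bound discount_pos
      by (intro AE_I2 summable_comparison_test'[OF summ]) (auto simp: abs_mult intro!: mult_left_mono)
    show "summable (\<lambda>t. \<integral>\<omega>. norm (discount m ^ t * reward m (fst (\<omega> t)) (snd (\<omega> t))) \<partial>traj_law m \<pi>)"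
      using abs_int discount_pos
      by (intro summable_comparison_test'[OF summ])
        (auto simp: abs_mult intro!: mult_left_mono)
  qed (use int in auto)
  then show "expected_return m \<pi> = (\<Sum>t. discount m ^ t * e t)"
    unfolding expected_return_def e_def by simp
qed

text \<open>A real \<open>SUP\<close> is an upper bound only of a set that is bounded above; the
  geometric series supplies such a bound for all policies at once.\<close>

lemma expected_return_le_optimal:
  assumes "\<pi> \<in> policies m"
  shows "expected_return m \<pi> \<le> optimal_return m"
  unfolding optimal_return_def
proof (rule cSUP_upper[OF assms], rule bdd_aboveI2)
  fix \<pi> assume \<pi>: "\<pi> \<in> policies m"
  let ?e = "\<lambda>t. \<integral>\<omega>. reward m (fst (\<omega> t)) (snd (\<omega> t)) \<partial>traj_law m \<pi>"
  have summ: "summable (\<lambda>t. discount m ^ t * reward_bound m)"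
    using discount_pos discount_less_1 by (intro summable_mult2 summable_geometric) auto
  have le: "norm (discount m ^ t * ?e t) \<le> discount m ^ t * reward_bound m" for t
    using expected_return_eq_suminf(2)[OF \<pi>, of t] discount_pos by (simp add: abs_mult)
  show "expected_return m \<pi> \<le> (\<Sum>t. discount m ^ t * reward_bound m)"
    unfolding expected_return_eq_suminf(1)[OF \<pi>]
    using le by (intro suminf_le summ summable_comparison_test'[OF summ, of 0]) (auto simp: abs_le_iff)
qed

end

section \<open>Score functions and likelihood ratios\<close>

locale smooth_policy = discounted_mdp m for m :: "('s, 'a) mdp" +
  fixes p :: "real^'n \<Rightarrow> 's \<Rightarrow> 'a \<Rightarrow> real" and M\<^sub>g M\<^sub>h :: real
  assumes policy: "is_policy_family m p"
    and pos: "\<And>\<theta> s a. s \<in> space (states m) \<Longrightarrow> a \<in> space (actions m) \<Longrightarrow> 0 < p \<theta> s a"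
    and C2: "\<And>s a. s \<in> space (states m) \<Longrightarrow> a \<in> space (actions m) \<Longrightarrow>
               twice_cont_diff (\<lambda>\<theta>. p \<theta> s a)"
    and Mg: "0 < M\<^sub>g" and Mh: "0 < M\<^sub>h"
    and score_bound: "\<And>\<theta> s a. s \<in> space (states m) \<Longrightarrow> a \<in> space (actions m) \<Longrightarrow>
               norm (grad (\<lambda>\<theta>'. ln (p \<theta>' s a)) \<theta>) \<le> M\<^sub>g"
    and score_hess_bound: "\<And>\<theta> s a. s \<in> space (states m) \<Longrightarrow> a \<in> space (actions m) \<Longrightarrow>
               norm (hess (\<lambda>\<theta>'. ln (p \<theta>' s a)) \<theta>) \<le> M\<^sub>h"
begin

definition loglik :: "real^'n \<Rightarrow> 's \<times> 'a \<Rightarrow> real" where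
  "loglik \<theta> x = ln (p \<theta> (fst x) (snd x))"

definition score :: "real^'n \<Rightarrow> 's \<times> 'a \<Rightarrow> real^'n" where
  "score \<theta> x = grad (\<lambda>\<theta>'. ln (p \<theta>' (fst x) (snd x))) \<theta>"

definition score_hess :: "real^'n \<Rightarrow> 's \<times> 'a \<Rightarrow> (real^'n) \<Rightarrow>\<^sub>L (real^'n)" where
  "score_hess \<theta> x = hess (\<lambda>\<theta>'. ln (p \<theta>' (fst x) (snd x))) \<theta>"

lemma p_measurable[measurable]: "(\<lambda>(s, a). p \<theta> s a) \<in> borel_measurable X"
  and p_integral: "\<And>s. s \<in> space (states m) \<Longrightarrow> (\<integral>\<^sup>+ a. ennreal (p \<theta> s a) \<partial>actions m) = 1"
  using policy unfolding is_policy_family_def by blast+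

lemma loglik_measurable[measurable]: "loglik \<theta> \<in> borel_measurable X"
  using borel_measurable_ln[OF p_measurable[of \<theta>]] unfolding loglik_def[abs_def] by (simp add: case_prod_beta')

lemma param_policy_in_policies: "param_policy m p \<theta> \<in> policies m"
  unfolding policies_def param_policy_def[abs_def]
  using p_integral by (intro measurable_density_prob_algebra sigma_finite_actions) auto

text \<open>The quotient form transfers smoothness: differentiability is assumed of
  \<open>p\<close>, and the score inherits it as a quotient with positive denominator.\<close>

lemma GDERIV_loglik:
  assumes "x \<in> space X"
  shows "GDERIV (\<lambda>\<theta>. loglik \<theta> x) \<theta> :> score \<theta> x"
    and "score \<theta> x = (1 / p \<theta> (fst x) (snd x)) *\<^sub>R grad (\<lambda>\<theta>. p \<theta> (fst x) (snd x)) \<theta>"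
proof -
  have sa: "fst x \<in> space (states m)" "snd x \<in> space (actions m)"
    using assms by (auto simp: space_pair_measure)
  have "GDERIV (\<lambda>\<theta>. p \<theta> (fst x) (snd x)) \<theta> :> grad (\<lambda>\<theta>. p \<theta> (fst x) (snd x)) \<theta>"
    using C2[OF sa] by (intro GDERIV_grad) (simp add: twice_cont_diff_def)
  from GDERIV_DERIV_compose[OF this DERIV_ln_divide[OF pos[OF sa]]]
  have "GDERIV (\<lambda>\<theta>. loglik \<theta> x) \<theta> :> (1 / p \<theta> (fst x) (snd x)) *\<^sub>R grad (\<lambda>\<theta>. p \<theta> (fst x) (snd x)) \<theta>"
    by (simp add: loglik_def)
  then show "GDERIV (\<lambda>\<theta>. loglik \<theta> x) \<theta> :> score \<theta> x"
    and "score \<theta> x = (1 / p \<theta> (fst x) (snd x)) *\<^sub>R grad (\<lambda>\<theta>. p \<theta> (fst x) (snd x)) \<theta>"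
    by (simp_all add: score_def grad_eqI loglik_def)
qed

lemma loglik_has_derivative:
  "x \<in> space X \<Longrightarrow> ((\<lambda>\<theta>. loglik \<theta> x) has_derivative (\<lambda>v. v \<bullet> score \<theta> x)) (at \<theta>)"
  using GDERIV_loglik(1) by (simp add: gderiv_def)

lemma score_has_derivative:
  assumes "x \<in> space X"
  shows "((\<lambda>\<theta>. score \<theta> x) has_derivative score_hess \<theta> x) (at \<theta>)"
proof -
  have sa: "fst x \<in> space (states m)" "snd x \<in> space (actions m)"
    using assms by (auto simp: space_pair_measure)
  have "(\<lambda>\<theta>. score \<theta> x) differentiable (at \<theta>)"
    unfolding GDERIV_loglik(2)[OF assms] using C2[OF sa] pos[OF sa, of \<theta>]
    by (intro differentiable_scaleR differentiable_divide) (auto simp: twice_cont_diff_def)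
  then show ?thesis
    using has_derivative_grad[of "\<lambda>\<theta>'. ln (p \<theta>' (fst x) (snd x))" \<theta>]
    by (simp add: score_def[abs_def] score_hess_def)
qed

lemma norm_score_le: "x \<in> space X \<Longrightarrow> norm (score \<theta> x) \<le> M\<^sub>g"
  unfolding score_def by (rule score_bound) (auto simp: space_pair_measure)

lemma norm_score_hess_le:
  assumes "x \<in> space X"
  shows "norm (score_hess \<theta> x v) \<le> M\<^sub>h * norm v"
proof -
  have "norm (score_hess \<theta> x) \<le> M\<^sub>h"
    unfolding score_hess_def using assms by (intro score_hess_bound) (auto simp: space_pair_measure)
  then show ?thesis
    using norm_blinfun[of "score_hess \<theta> x" v] by (meson mult_right_mono norm_ge_zero order_trans)
qed

text \<open>A bounded score keeps likelihood ratios bounded uniformly over states and actions, which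
  provides the dominating constants for all differentiations under the integral.\<close>

lemma loglik_lipschitz:
  assumes "x \<in> space X"
  shows "\<bar>loglik \<theta>' x - loglik \<theta> x\<bar> \<le> M\<^sub>g * norm (\<theta>' - \<theta>)"
proof -
  have "onorm (\<lambda>v. v \<bullet> score \<theta> x) \<le> M\<^sub>g" for \<theta>
  proof (rule onorm_le)
    fix v
    have "norm (v \<bullet> score \<theta> x) \<le> norm v * norm (score \<theta> x)"
      by (simp add: Cauchy_Schwarz_ineq2)
    also have "\<dots> \<le> norm v * M\<^sub>g"
      by (intro mult_left_mono norm_score_le assms) simp
    finally show "norm (v \<bullet> score \<theta> x) \<le> M\<^sub>g * norm v"
      by (simp add: mult.commute)
  qed
  then have "norm (loglik \<theta>' x - loglik \<theta> x) \<le> M\<^sub>g * norm (\<theta>' - \<theta>)"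
    using loglik_has_derivative[OF assms] by (intro differentiable_bound[of UNIV]) auto
  then show ?thesis by simp
qed

lemma loglik_joint_measurable: "(\<lambda>(\<theta>, x). loglik \<theta> x) \<in> borel_measurable (borel \<Otimes>\<^sub>M X)"
proof (rule borel_measurable_Caratheodory)
  show "continuous_on UNIV (\<lambda>\<theta>. loglik \<theta> x)" if "x \<in> space X" for x
    using has_derivative_continuous[OF loglik_has_derivative[OF that]]
    by (simp add: continuous_on_eq_continuous_at)
qed simp

text \<open>Each component of the score is a limit of difference quotients of the jointly measurable
  log-likelihood.\<close>

lemma score_joint_measurable: "(\<lambda>(\<theta>, x). score \<theta> x) \<in> borel_measurable (borel \<Otimes>\<^sub>M X)"
  unfolding case_prod_beta'
proof (subst borel_measurable_euclidean_space, rule ballI)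
  fix b :: "real^'n"
  define q where "q n z = real (Suc n) *\<^sub>R
    (loglik (fst z + (1 / real (Suc n)) *\<^sub>R b) (snd z) - loglik (fst z) (snd z))" for n z
  have shift: "(\<lambda>z. loglik (fst z + c) (snd z)) \<in> borel_measurable (borel \<Otimes>\<^sub>M X)" for c :: "real^'n"
  proof -
    have "(\<lambda>z. (fst z + c, snd z)) \<in> borel \<Otimes>\<^sub>M X \<rightarrow>\<^sub>M borel \<Otimes>\<^sub>M X"
      by (intro measurable_Pair borel_measurable_add measurable_fst measurable_snd borel_measurable_const)
    from measurable_compose[OF this loglik_joint_measurable] show ?thesis
      by simp
  qed
  have "(\<lambda>z. b \<bullet> score (fst z) (snd z)) \<in> borel_measurable (borel \<Otimes>\<^sub>M X)"
  proof (rule borel_measurable_LIMSEQ_real)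
    show "(\<lambda>n. q n z) \<longlonglongrightarrow> b \<bullet> score (fst z) (snd z)" if "z \<in> space (borel \<Otimes>\<^sub>M X)" for z
      unfolding q_def using that
      by (intro has_derivative_difference_quotient[OF loglik_has_derivative]) (auto simp: space_pair_measure)
    show "q n \<in> borel_measurable (borel \<Otimes>\<^sub>M X)" for n
      unfolding q_def[abs_def] using shift[of "(1 / real (Suc n)) *\<^sub>R b"] shift[of 0]
      by (intro borel_measurable_scaleR borel_measurable_diff) auto
  qed
  then show "(\<lambda>z. score (fst z) (snd z) \<bullet> b) \<in> borel_measurable (borel \<Otimes>\<^sub>M X)"
    by (simp add: inner_commute)
qed

lemma score_measurable[measurable]: "score \<theta> \<in> borel_measurable X"
  using measurable_compose[OF _ score_joint_measurable, of "\<lambda>x. (\<theta>, x)" X] by simp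

lemma
  assumes "\<omega> \<in> space (PiM {0..<n} (\<lambda>_. X))"
  shows prob_space_traj_kernel: "prob_space (traj_kernel m (param_policy m p \<theta>) n \<omega>)"
    and sets_traj_kernel: "sets (traj_kernel m (param_policy m p \<theta>) n \<omega>) = sets X"
  using measurable_space[OF traj_kernel_measurable[OF param_policy_in_policies] assms]
  by (auto simp: space_prob_algebra)

lemma nn_integral_draw_action:
  assumes \<nu>: "sets \<nu> = sets (states m)" and f: "f \<in> borel_measurable X"
  shows "(\<integral>\<^sup>+x. f x \<partial>(\<nu> \<bind> draw_action m (param_policy m p \<theta>))) =
    (\<integral>\<^sup>+s. \<integral>\<^sup>+a. ennreal (p \<theta> s a) * f (s, a) \<partial>actions m \<partial>\<nu>)"
proof -
  have "(\<integral>\<^sup>+x. f x \<partial>(\<nu> \<bind> draw_action m (param_policy m p \<theta>))) =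
      (\<integral>\<^sup>+s. \<integral>\<^sup>+x. f x \<partial>draw_action m (param_policy m p \<theta>) s \<partial>\<nu>)"
    using measurable_prob_algebraD[OF draw_action_measurable[OF param_policy_in_policies]] \<nu>
    by (intro nn_integral_bind[OF f]) (simp cong: measurable_cong_sets)
  also have "\<dots> = (\<integral>\<^sup>+s. \<integral>\<^sup>+a. ennreal (p \<theta> s a) * f (s, a) \<partial>actions m \<partial>\<nu>)"
  proof (rule nn_integral_cong)
    fix s assume "s \<in> space \<nu>"
    then have [measurable]: "s \<in> space (states m)"
      using sets_eq_imp_space_eq[OF \<nu>] by simp
    have [measurable]: "(\<lambda>a. p \<theta> s a) \<in> borel_measurable (actions m)"
      using measurable_compose[OF measurable_Pair1' p_measurable] \<open>s \<in> space (states m)\<close> by simp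
    have [measurable]: "(\<lambda>a. f (s, a)) \<in> borel_measurable (actions m)"
      using f \<open>s \<in> space (states m)\<close> by simp
    show "(\<integral>\<^sup>+x. f x \<partial>draw_action m (param_policy m p \<theta>) s) =
        (\<integral>\<^sup>+a. ennreal (p \<theta> s a) * f (s, a) \<partial>actions m)"
      unfolding draw_action_def param_policy_def
      by (subst nn_integral_distr) (simp_all add: f nn_integral_density)
  qed
  finally show ?thesis .
qed

text \<open>Change of measure for one step: both kernels draw the state from the same law \<nu> and
  differ only in the action density, whose ratio is the exponential.\<close>

lemma nn_integral_traj_kernel:
  assumes \<omega>: "\<omega> \<in> space (PiM {0..<n} (\<lambda>_. X))" and f[measurable]: "f \<in> borel_measurable X"
  shows "(\<integral>\<^sup>+x. f x \<partial>traj_kernel m (param_policy m p \<theta>') n \<omega>) =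
    (\<integral>\<^sup>+x. ennreal (exp (loglik \<theta>' x - loglik \<theta> x)) * f x \<partial>traj_kernel m (param_policy m p \<theta>) n \<omega>)"
proof -
  obtain \<nu> where \<nu>: "sets \<nu> = sets (states m)"
      and K: "\<And>\<pi>. traj_kernel m \<pi> n \<omega> = \<nu> \<bind> draw_action m \<pi>"
  proof (cases n)
    case 0
    then show ?thesis
      by (intro that[of "init m"]) (auto simp: sets_init)
  next
    case (Suc t)
    then show ?thesis
      by (intro that[of "density (states m) (\<lambda>s'. ennreal (transition m (fst (\<omega> t)) (snd (\<omega> t)) s'))"]) auto
  qed
  have "ennreal (p \<theta>' s a) * f (s, a) =
      ennreal (p \<theta> s a) * (ennreal (exp (loglik \<theta>' (s, a) - loglik \<theta> (s, a))) * f (s, a))"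
    if "s \<in> space \<nu>" "a \<in> space (actions m)" for s a
  proof -
    have "s \<in> space (states m)"
      using that sets_eq_imp_space_eq[OF \<nu>] by simp
    from pos[OF this that(2), of \<theta>] pos[OF this that(2), of \<theta>']
    have "ennreal (p \<theta>' s a) = ennreal (p \<theta> s a) * ennreal (exp (loglik \<theta>' (s, a) - loglik \<theta> (s, a)))"
      by (simp add: loglik_def exp_diff flip: ennreal_mult')
    then show ?thesis by (simp add: mult.assoc)
  qed
  then show ?thesis
    unfolding K by (simp add: nn_integral_draw_action[OF \<nu>] cong: nn_integral_cong)
qed

lemma exp_loglik_diff_le:
  assumes "x \<in> space X"
  shows "exp (loglik \<theta>' x - loglik \<theta> x) \<le> exp (M\<^sub>g * norm (\<theta>' - \<theta>))"
  using loglik_lipschitz[OF assms, of \<theta>' \<theta>] by simp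

text \<open>The kernel under \<theta>' has mass 1. Written as an integral of the likelihood ratio
  under \<theta>, this constant has derivative zero, and at \<theta> that derivative is the mean of
  the score.\<close>

lemma integral_score_eq_0:
  assumes \<omega>: "\<omega> \<in> space (PiM {0..<n} (\<lambda>_. X))"
  shows "(\<integral>x. score \<theta> x \<partial>traj_kernel m (param_policy m p \<theta>) n \<omega>) = 0"
proof -
  let ?K = "traj_kernel m (param_policy m p \<theta>) n \<omega>"
  interpret prob_space ?K by (rule prob_space_traj_kernel[OF \<omega>])
  note [measurable_cong] = sets_traj_kernel[OF \<omega>, of \<theta>]
  have space: "space ?K = space X"
    using sets_eq_imp_space_eq[OF sets_traj_kernel[OF \<omega>]] .
  let ?e = "\<lambda>\<theta>' x. exp (loglik \<theta>' x - loglik \<theta> x)"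
  have norm_one: "(\<integral>x. ?e \<theta>' x \<partial>?K) = 1" for \<theta>'
  proof -
    have "(\<integral>\<^sup>+x. ennreal (?e \<theta>' x) \<partial>?K) = 1"
      using nn_integral_traj_kernel[OF \<omega>, of "\<lambda>_. 1" \<theta>' \<theta>]
        prob_space.emeasure_space_1[OF prob_space_traj_kernel[OF \<omega>]] by simp
    then show ?thesis
      by (subst integral_eq_nn_integral) auto
  qed
  have int: "integrable ?K (?e \<theta>')" for \<theta>'
    using exp_loglik_diff_le
    by (intro integrable_const_bound[where B="exp (M\<^sub>g * norm (\<theta>' - \<theta>))"]) (auto simp: space)
  have der: "((\<lambda>\<theta>'. ?e \<theta>' x) has_derivative (\<lambda>v. ?e \<theta>' x * (v \<bullet> score \<theta>' x))) (at \<theta>')"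
    if "x \<in> space ?K" for x \<theta>'
    using that by (auto simp: space intro!: derivative_eq_intros loglik_has_derivative)
  have bound: "norm (?e \<theta>' x * (v \<bullet> score \<theta>' x)) \<le> (exp M\<^sub>g * M\<^sub>g) * norm v"
    if "\<theta>' \<in> ball \<theta> 1" "x \<in> space ?K" for \<theta>' x v
  proof -
    have "M\<^sub>g * norm (\<theta>' - \<theta>) \<le> M\<^sub>g * 1"
      using that Mg by (intro mult_left_mono) (auto simp: dist_norm norm_minus_commute)
    then have "?e \<theta>' x \<le> exp M\<^sub>g"
      using loglik_lipschitz[of x \<theta>' \<theta>] that space by simp
    moreover have "\<bar>v \<bullet> score \<theta>' x\<bar> \<le> norm v * M\<^sub>g"
      using Cauchy_Schwarz_ineq2[of v "score \<theta>' x"] norm_score_le[of x \<theta>'] that space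
      by (smt (verit) mult_left_mono norm_ge_zero)
    ultimately have "?e \<theta>' x * \<bar>v \<bullet> score \<theta>' x\<bar> \<le> exp M\<^sub>g * (norm v * M\<^sub>g)"
      by (intro mult_mono) auto
    then show ?thesis by (simp add: abs_mult mult_ac)
  qed
  have meas: "?e \<theta>' \<in> borel_measurable ?K" for \<theta>' by measurable
  note deriv = has_derivative_integral_bounded[OF finite_measure_axioms meas int der bound]
  have "((\<lambda>\<theta>'. 1) has_derivative (\<lambda>v. \<integral>x. ?e \<theta> x * (v \<bullet> score \<theta> x) \<partial>?K)) (at \<theta>)"
    using deriv(2) unfolding norm_one .
  from has_derivative_unique[OF this has_derivative_const]
  have "(\<integral>x. v \<bullet> score \<theta> x \<partial>?K) = 0" for v
    by (simp add: fun_eq_iff)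
  moreover have "integrable ?K (score \<theta>)"
    using norm_score_le by (intro integrable_const_bound[where B=M\<^sub>g]) (auto simp: space)
  ultimately have "v \<bullet> (\<integral>x. score \<theta> x \<partial>?K) = 0" for v
    by simp
  then show ?thesis
    using inner_eq_zero_iff by blast
qed

end

section \<open>The policy gradient\<close>

context smooth_policy
begin

abbreviation law :: "real^'n \<Rightarrow> nat \<Rightarrow> (nat \<Rightarrow> 's \<times> 'a) measure" where
  "law \<theta> n \<equiv> traj_law_upto m n (param_policy m p \<theta>)"

abbreviation trajectory :: "real^'n \<Rightarrow> (nat \<Rightarrow> 's \<times> 'a) measure" where
  "trajectory \<theta> \<equiv> traj_law m (param_policy m p \<theta>)"

text \<open>The logarithm of the density of one path law with respect to another. Initial and
  transition laws are common to both and cancel, so only action densities enter.\<close>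

definition log_ratio :: "real^'n \<Rightarrow> real^'n \<Rightarrow> nat \<Rightarrow> (nat \<Rightarrow> 's \<times> 'a) \<Rightarrow> real" where
  "log_ratio \<theta> \<theta>' n \<omega> = (\<Sum>t<n. loglik \<theta>' (\<omega> t) - loglik \<theta> (\<omega> t))"

definition score_sum :: "real^'n \<Rightarrow> nat \<Rightarrow> (nat \<Rightarrow> 's \<times> 'a) \<Rightarrow> real^'n" where
  "score_sum \<theta> n \<omega> = (\<Sum>t<n. score \<theta> (\<omega> t))"

lemma space_PiM_coordinate:
  "\<omega> \<in> space (PiM {..<n} (\<lambda>_. X)) \<Longrightarrow> t < n \<Longrightarrow> \<omega> t \<in> space X"
  by (auto simp: space_PiM PiE_iff)

lemma log_ratio_measurable[measurable]:
  "log_ratio \<theta> \<theta>' n \<in> borel_measurable (PiM {..<n} (\<lambda>_. X))"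
  unfolding log_ratio_def[abs_def]
  by (intro borel_measurable_sum borel_measurable_diff measurable_compose[OF _ loglik_measurable] measurable_component_singleton) auto

lemma score_sum_measurable[measurable]:
  "score_sum \<theta> n \<in> borel_measurable (PiM {..<n} (\<lambda>_. X))"
  unfolding score_sum_def[abs_def]
  by (intro borel_measurable_sum measurable_compose[OF _ score_measurable] measurable_component_singleton) auto

lemma log_ratio_fun_upd:
  "log_ratio \<theta> \<theta>' (Suc n) (fun_upd \<omega> n x) = log_ratio \<theta> \<theta>' n \<omega> + (loglik \<theta>' x - loglik \<theta> x)"
  by (simp add: log_ratio_def)

lemma score_sum_fun_upd:
  "score_sum \<theta> (Suc n) (fun_upd \<omega> n x) = score_sum \<theta> n \<omega> + score \<theta> x"
  by (simp add: score_sum_def)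

lemma fun_upd_measurable:
  "(\<lambda>(\<omega>, x). fun_upd \<omega> n x) \<in> PiM {..<n} (\<lambda>_. X) \<Otimes>\<^sub>M X \<rightarrow>\<^sub>M PiM {..<Suc n} (\<lambda>_. X)"
  unfolding case_prod_beta'
  by (intro measurable_fun_upd[where J="{..<n}"]) (auto simp: lessThan_Suc)

lemma nn_integral_traj_kernel_measurable:
  assumes f: "f \<in> borel_measurable (PiM {..<Suc n} (\<lambda>_. X))"
  shows "(\<lambda>\<omega>. \<integral>\<^sup>+x. f (fun_upd \<omega> n x) \<partial>traj_kernel m (param_policy m p \<theta>) n \<omega>)
    \<in> borel_measurable (PiM {..<n} (\<lambda>_. X))"
proof (rule nn_integral_measurable_subprob_algebra2[where N=X])
  show "(\<lambda>(\<omega>, x). f (fun_upd \<omega> n x)) \<in> borel_measurable (PiM {..<n} (\<lambda>_. X) \<Otimes>\<^sub>M X)"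
    using measurable_compose[OF fun_upd_measurable f] by (simp add: case_prod_beta')
  show "traj_kernel m (param_policy m p \<theta>) n \<in> PiM {..<n} (\<lambda>_. X) \<rightarrow>\<^sub>M subprob_algebra X"
    using measurable_prob_algebraD[OF traj_kernel_measurable[OF param_policy_in_policies]]
    by (simp add: lessThan_atLeast0)
qed

text \<open>Change of measure on trajectories, by induction on the length: the last kernel
  contributes one more ratio. The function \<open>f\<close> stays arbitrary because the induction
  hypothesis is applied to the inner integral over the last step.\<close>

lemma nn_integral_law:
  assumes "f \<in> borel_measurable (PiM {..<n} (\<lambda>_. X))"
  shows "(\<integral>\<^sup>+\<omega>. f \<omega> \<partial>law \<theta>' n) = (\<integral>\<^sup>+\<omega>. ennreal (exp (log_ratio \<theta> \<theta>' n \<omega>)) * f \<omega> \<partial>law \<theta> n)"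
  using assms
proof (induction n arbitrary: f)
  case 0
  have "(\<integral>\<^sup>+\<omega>. f \<omega> \<partial>law \<theta>' 0) = (\<integral>\<^sup>+\<omega>. f \<omega> \<partial>law \<theta> 0)"
    by (simp add: traj_law_upto_0 param_policy_in_policies)
  then show ?case
    by (simp add: log_ratio_def)
next
  case (Suc n)
  note f[measurable] = Suc.prems
  let ?K = "\<lambda>\<theta>. traj_kernel m (param_policy m p \<theta>) n"
  have "(\<integral>\<^sup>+\<omega>. f \<omega> \<partial>law \<theta>' (Suc n)) = (\<integral>\<^sup>+\<omega>. \<integral>\<^sup>+x. f (fun_upd \<omega> n x) \<partial>?K \<theta>' \<omega> \<partial>law \<theta>' n)"
    by (intro traj_law_upto_Suc param_policy_in_policies f)
  also have "\<dots> = (\<integral>\<^sup>+\<omega>. ennreal (exp (log_ratio \<theta> \<theta>' n \<omega>)) * (\<integral>\<^sup>+x. f (fun_upd \<omega> n x) \<partial>?K \<theta>' \<omega>) \<partial>law \<theta> n)"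
    by (intro Suc.IH nn_integral_traj_kernel_measurable f)
  also have "\<dots> = (\<integral>\<^sup>+\<omega>. \<integral>\<^sup>+x. ennreal (exp (log_ratio \<theta> \<theta>' (Suc n) (fun_upd \<omega> n x))) * f (fun_upd \<omega> n x) \<partial>?K \<theta> \<omega> \<partial>law \<theta> n)"
  proof (rule nn_integral_cong)
    fix \<omega> assume "\<omega> \<in> space (law \<theta> n)"
    then have \<omega>: "\<omega> \<in> space (PiM {..<n} (\<lambda>_. X))" "\<omega> \<in> space (PiM {0..<n} (\<lambda>_. X))"
      by (simp_all add: lessThan_atLeast0)
    note [measurable_cong] = sets_traj_kernel[OF \<omega>(2)]
    have fu: "(\<lambda>x. f (fun_upd \<omega> n x)) \<in> borel_measurable X"
      using measurable_compose[OF measurable_compose[OF measurable_Pair1'[OF \<omega>(1)] fun_upd_measurable] f]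
      by (simp del: fun_upd_apply add: fun_upd_def)
    show "ennreal (exp (log_ratio \<theta> \<theta>' n \<omega>)) * (\<integral>\<^sup>+x. f (fun_upd \<omega> n x) \<partial>?K \<theta>' \<omega>) =
      (\<integral>\<^sup>+x. ennreal (exp (log_ratio \<theta> \<theta>' (Suc n) (fun_upd \<omega> n x))) * f (fun_upd \<omega> n x) \<partial>?K \<theta> \<omega>)"
      using fu
      by (subst nn_integral_traj_kernel[OF \<omega>(2) fu, of _ \<theta>], subst nn_integral_cmult[symmetric])
        (auto simp: log_ratio_fun_upd exp_add ennreal_mult mult.assoc intro!: nn_integral_cong)
  qed
  also have "\<dots> = (\<integral>\<^sup>+\<omega>. ennreal (exp (log_ratio \<theta> \<theta>' (Suc n) \<omega>)) * f \<omega> \<partial>law \<theta> (Suc n))"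
    by (intro traj_law_upto_Suc[symmetric] param_policy_in_policies) measurable
  finally show ?case .
qed

lemma law_eq_density:
  "law \<theta>' n = density (law \<theta> n) (\<lambda>\<omega>. ennreal (exp (log_ratio \<theta> \<theta>' n \<omega>)))"
proof (rule measure_eqI)
  note [measurable_cong] = sets_traj_law_upto
  fix A assume "A \<in> sets (law \<theta>' n)"
  then have [measurable]: "A \<in> sets (PiM {..<n} (\<lambda>_. X))"
    by simp
  show "emeasure (law \<theta>' n) A = emeasure (density (law \<theta> n) (\<lambda>\<omega>. ennreal (exp (log_ratio \<theta> \<theta>' n \<omega>)))) A"
    using nn_integral_law[of "indicator A" n \<theta>' \<theta>] by (subst emeasure_density) simp_all
qed simp

lemma norm_score_sum_le:
  assumes "\<And>t. t < n \<Longrightarrow> \<omega> t \<in> space X"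
  shows "norm (score_sum \<theta> n \<omega>) \<le> real n * M\<^sub>g"
  unfolding score_sum_def using norm_score_le[OF assms]
  by (intro sum_norm_le[of "{..<n}" _ "\<lambda>_. M\<^sub>g", simplified]) auto

text \<open>The scores of successive steps are martingale differences, hence orthogonal.\<close>

lemma nn_integral_norm_score_sum:
  "(\<integral>\<^sup>+\<omega>. ennreal ((norm (score_sum \<theta> n \<omega>))\<^sup>2) \<partial>law \<theta> n) \<le> ennreal (real n * M\<^sub>g\<^sup>2)"
proof (induction n)
  case 0
  then show ?case
    by (simp add: score_sum_def)
next
  case (Suc n)
  let ?K = "traj_kernel m (param_policy m p \<theta>) n"
  interpret prob_space "law \<theta> n"
    by (intro prob_space_traj_law_upto param_policy_in_policies)
  have "(\<integral>\<^sup>+\<omega>. ennreal ((norm (score_sum \<theta> (Suc n) \<omega>))\<^sup>2) \<partial>law \<theta> (Suc n)) =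
    (\<integral>\<^sup>+\<omega>. \<integral>\<^sup>+x. ennreal ((norm (score_sum \<theta> n \<omega> + score \<theta> x))\<^sup>2) \<partial>?K \<omega> \<partial>law \<theta> n)"
    by (subst traj_law_upto_Suc) (auto simp: score_sum_fun_upd param_policy_in_policies)
  also have "\<dots> \<le> (\<integral>\<^sup>+\<omega>. ennreal ((norm (score_sum \<theta> n \<omega>))\<^sup>2) + ennreal (M\<^sub>g\<^sup>2) \<partial>law \<theta> n)"
  proof (rule nn_integral_mono)
    fix \<omega> assume "\<omega> \<in> space (law \<theta> n)"
    then have \<omega>: "\<omega> \<in> space (PiM {0..<n} (\<lambda>_. X))"
      by (simp add: lessThan_atLeast0)
    interpret K: prob_space "?K \<omega>"
      by (rule prob_space_traj_kernel[OF \<omega>])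
    note [measurable_cong] = sets_traj_kernel[OF \<omega>, of \<theta>]
    have sp: "space (?K \<omega>) = space X"
      using sets_eq_imp_space_eq[OF sets_traj_kernel[OF \<omega>]] .
    let ?s = "score_sum \<theta> n \<omega>"
    have int1: "integrable (?K \<omega>) (score \<theta>)"
      using norm_score_le by (intro K.integrable_const_bound[where B=M\<^sub>g]) (auto simp: sp)
    have sq: "(norm (score \<theta> x))\<^sup>2 \<le> M\<^sub>g\<^sup>2" if "x \<in> space X" for x
      using norm_score_le[OF that] by (simp add: power_mono)
    have int2: "integrable (?K \<omega>) (\<lambda>x. (norm (score \<theta> x))\<^sup>2)"
      using sq by (intro K.integrable_const_bound[where B="M\<^sub>g\<^sup>2"]) (auto simp: sp)
    have eq: "(norm (?s + score \<theta> x))\<^sup>2 = (norm ?s)\<^sup>2 + 2 * (?s \<bullet> score \<theta> x) + (norm (score \<theta> x))\<^sup>2" for x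
      by (simp add: power2_norm_eq_inner inner_add_left inner_add_right inner_commute)
    have "(\<integral>x. (norm (?s + score \<theta> x))\<^sup>2 \<partial>?K \<omega>) = (norm ?s)\<^sup>2 + (\<integral>x. (norm (score \<theta> x))\<^sup>2 \<partial>?K \<omega>)"
      unfolding eq using int1 int2
      by (simp add: integral_score_eq_0[OF \<omega>] K.prob_space)
    also have "\<dots> \<le> (norm ?s)\<^sup>2 + M\<^sub>g\<^sup>2"
      using sq by (intro add_left_mono K.integral_le_const int2) (auto simp: sp)
    finally have le: "(\<integral>x. (norm (?s + score \<theta> x))\<^sup>2 \<partial>?K \<omega>) \<le> (norm ?s)\<^sup>2 + M\<^sub>g\<^sup>2" .
    have "(\<integral>\<^sup>+x. ennreal ((norm (?s + score \<theta> x))\<^sup>2) \<partial>?K \<omega>) = ennreal (\<integral>x. (norm (?s + score \<theta> x))\<^sup>2 \<partial>?K \<omega>)"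
      using int1 int2 by (intro nn_integral_eq_integral AE_I2 zero_le_power2) (auto simp: eq)
    also have "\<dots> \<le> ennreal ((norm ?s)\<^sup>2) + ennreal (M\<^sub>g\<^sup>2)"
      using le by (simp add: ennreal_leI flip: ennreal_plus)
    finally show "(\<integral>\<^sup>+x. ennreal ((norm (?s + score \<theta> x))\<^sup>2) \<partial>?K \<omega>) \<le> ennreal ((norm ?s)\<^sup>2) + ennreal (M\<^sub>g\<^sup>2)" .
  qed
  also have "\<dots> = (\<integral>\<^sup>+\<omega>. ennreal ((norm (score_sum \<theta> n \<omega>))\<^sup>2) \<partial>law \<theta> n) + ennreal (M\<^sub>g\<^sup>2)"
    using emeasure_space_1 by (subst nn_integral_add) (auto cong: measurable_cong_sets)
  also have "\<dots> \<le> ennreal (real n * M\<^sub>g\<^sup>2) + ennreal (M\<^sub>g\<^sup>2)"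
    by (intro add_right_mono Suc.IH)
  also have "\<dots> = ennreal (real (Suc n) * M\<^sub>g\<^sup>2)"
    by (simp add: distrib_right flip: ennreal_plus)
  finally show ?case .
qed

lemma log_ratio_le:
  assumes "\<And>t. t < n \<Longrightarrow> \<omega> t \<in> space X" "\<theta>' \<in> ball \<theta> 1"
  shows "exp (log_ratio \<theta> \<theta>' n \<omega>) \<le> exp (real n * M\<^sub>g)"
proof -
  have "loglik \<theta>' (\<omega> t) - loglik \<theta> (\<omega> t) \<le> M\<^sub>g" if "t < n" for t
  proof -
    have "M\<^sub>g * norm (\<theta>' - \<theta>) \<le> M\<^sub>g * 1"
      using assms(2) Mg by (intro mult_left_mono) (auto simp: dist_norm norm_minus_commute)
    then show ?thesis
      using loglik_lipschitz[OF assms(1)[OF that], of \<theta>' \<theta>] by simp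
  qed
  then have "log_ratio \<theta> \<theta>' n \<omega> \<le> real n * M\<^sub>g"
    unfolding log_ratio_def by (intro sum_bounded_above[of "{..<n}", simplified]) auto
  then show ?thesis by simp
qed

lemma log_ratio_has_derivative:
  assumes "\<And>t. t < n \<Longrightarrow> \<omega> t \<in> space X"
  shows "((\<lambda>\<theta>'. log_ratio \<theta> \<theta>' n \<omega>) has_derivative (\<lambda>v. v \<bullet> score_sum \<theta>' n \<omega>)) (at \<theta>')"
proof -
  have "((\<lambda>\<theta>'. log_ratio \<theta> \<theta>' n \<omega>) has_derivative (\<lambda>v. \<Sum>t<n. v \<bullet> score \<theta>' (\<omega> t) - 0)) (at \<theta>')"
    unfolding log_ratio_def
    by (intro has_derivative_sum has_derivative_diff loglik_has_derivative has_derivative_const assms) auto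
  then show ?thesis
    by (simp add: score_sum_def inner_sum_right)
qed

lemma score_sum_has_derivative:
  assumes "\<And>t. t < n \<Longrightarrow> \<omega> t \<in> space X"
  shows "((\<lambda>\<theta>. score_sum \<theta> n \<omega>) has_derivative (\<lambda>v. \<Sum>t<n. score_hess \<theta> (\<omega> t) v)) (at \<theta>)"
  unfolding score_sum_def by (intro has_derivative_sum score_has_derivative assms) auto

section \<open>Differentiating expectations over trajectories of fixed length\<close>

lemma integral_law:
  fixes f :: "(nat \<Rightarrow> 's \<times> 'a) \<Rightarrow> 'b::{banach, second_countable_topology}"
  assumes "f \<in> borel_measurable (PiM {..<n} (\<lambda>_. X))"
  shows "(\<integral>\<omega>. f \<omega> \<partial>law \<theta>' n) = (\<integral>\<omega>. exp (log_ratio \<theta> \<theta>' n \<omega>) *\<^sub>R f \<omega> \<partial>law \<theta> n)"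
  by (subst law_eq_density[of n \<theta>' \<theta>], subst integral_density)
    (use assms in \<open>auto cong: measurable_cong_sets\<close>)

context
  fixes \<phi> :: "(nat \<Rightarrow> 's \<times> 'a) \<Rightarrow> real" and n :: nat and C :: real
  assumes \<phi>[measurable]: "\<phi> \<in> borel_measurable (PiM {..<n} (\<lambda>_. X))"
    and \<phi>_le: "\<And>\<omega>. \<omega> \<in> space (PiM {..<n} (\<lambda>_. X)) \<Longrightarrow> \<bar>\<phi> \<omega>\<bar> \<le> C"
    and C: "0 \<le> C"
begin

lemma norm_scaled_score_sum_le:
  assumes "\<omega> \<in> space (PiM {..<n} (\<lambda>_. X))"
  shows "norm (\<phi> \<omega> *\<^sub>R score_sum \<theta> n \<omega>) \<le> C * (real n * M\<^sub>g)"
  using \<phi>_le[OF assms] norm_score_sum_le[where n=n and \<theta>=\<theta> and \<omega>=\<omega>, OF space_PiM_coordinate[OF assms]] C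
  by (auto intro!: mult_mono)

lemma abs_inner_score_sum_le:
  assumes "\<omega> \<in> space (PiM {..<n} (\<lambda>_. X))"
  shows "\<bar>v \<bullet> score_sum \<theta> n \<omega>\<bar> \<le> real n * M\<^sub>g * norm v"
  using Cauchy_Schwarz_ineq2[of v "score_sum \<theta> n \<omega>"]
    mult_left_mono[OF norm_score_sum_le[where n=n and \<theta>=\<theta> and \<omega>=\<omega>, OF space_PiM_coordinate[OF assms]] norm_ge_zero[of v]]
  by (simp add: mult.commute)

text \<open>The score-function identity. Under the fixed law at \<open>\<theta>\<^sub>0\<close> the
  parameter occurs only in the density, whose logarithmic derivative is the summed score; at
  \<open>\<theta>\<^sub>0\<close> the density is 1.\<close>

lemma GDERIV_integral_law:
  "GDERIV (\<lambda>\<theta>. \<integral>\<omega>. \<phi> \<omega> \<partial>law \<theta> n) \<theta>\<^sub>0 :> (\<integral>\<omega>. \<phi> \<omega> *\<^sub>R score_sum \<theta>\<^sub>0 n \<omega> \<partial>law \<theta>\<^sub>0 n)"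
proof -
  interpret prob_space "law \<theta>\<^sub>0 n"
    by (intro prob_space_traj_law_upto param_policy_in_policies)
  note [measurable_cong] = sets_traj_law_upto
  have coord: "\<omega> t \<in> space X" if "\<omega> \<in> space (law \<theta>\<^sub>0 n)" "t < n" for \<omega> t
    using that space_PiM_coordinate by simp
  let ?f = "\<lambda>\<theta> \<omega>. exp (log_ratio \<theta>\<^sub>0 \<theta> n \<omega>) *\<^sub>R \<phi> \<omega>"
  let ?f' = "\<lambda>\<theta> \<omega> v. exp (log_ratio \<theta>\<^sub>0 \<theta> n \<omega>) * ((v \<bullet> score_sum \<theta> n \<omega>) * \<phi> \<omega>)"
  have meas: "?f \<theta> \<in> borel_measurable (law \<theta>\<^sub>0 n)" for \<theta>
    by measurable
  have int_law: "integrable (law \<theta> n) \<phi>" for \<theta>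
  proof -
    interpret \<theta>: prob_space "law \<theta> n"
      by (intro prob_space_traj_law_upto param_policy_in_policies)
    show ?thesis
      using \<phi>_le by (intro \<theta>.integrable_const_bound[where B=C]) auto
  qed
  have int: "integrable (law \<theta>\<^sub>0 n) (?f \<theta>)" for \<theta>
    using int_law[of \<theta>] unfolding law_eq_density[of n \<theta> \<theta>\<^sub>0] by (subst (asm) integrable_density) auto
  have der: "((\<lambda>\<theta>. ?f \<theta> \<omega>) has_derivative ?f' \<theta> \<omega>) (at \<theta>)" if "\<omega> \<in> space (law \<theta>\<^sub>0 n)" for \<omega> \<theta>
    by (auto intro!: derivative_eq_intros log_ratio_has_derivative coord[OF that])
  have bound: "norm (?f' \<theta> \<omega> v) \<le> (exp (real n * M\<^sub>g) * (real n * M\<^sub>g * C)) * norm v"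
    if "\<theta> \<in> ball \<theta>\<^sub>0 1" "\<omega> \<in> space (law \<theta>\<^sub>0 n)" for \<theta> \<omega> v
  proof -
    have "exp (log_ratio \<theta>\<^sub>0 \<theta> n \<omega>) * (\<bar>v \<bullet> score_sum \<theta> n \<omega>\<bar> * \<bar>\<phi> \<omega>\<bar>) \<le> exp (real n * M\<^sub>g) * ((real n * M\<^sub>g * norm v) * C)"
      using that Mg abs_inner_score_sum_le[of \<omega> v \<theta>] \<phi>_le[of \<omega>] log_ratio_le[OF coord that(1)]
      by (intro mult_mono) auto
    then show ?thesis
      by (simp add: abs_mult mult_ac)
  qed
  have "((\<lambda>\<theta>. \<integral>\<omega>. ?f \<theta> \<omega> \<partial>law \<theta>\<^sub>0 n) has_derivative (\<lambda>v. \<integral>\<omega>. ?f' \<theta>\<^sub>0 \<omega> v \<partial>law \<theta>\<^sub>0 n)) (at \<theta>\<^sub>0)"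
    by (rule has_derivative_integral_bounded(2)[OF finite_measure_axioms meas int der bound])
  moreover have "(\<integral>\<omega>. ?f' \<theta>\<^sub>0 \<omega> v \<partial>law \<theta>\<^sub>0 n) = v \<bullet> (\<integral>\<omega>. \<phi> \<omega> *\<^sub>R score_sum \<theta>\<^sub>0 n \<omega> \<partial>law \<theta>\<^sub>0 n)" for v
  proof -
    have "integrable (law \<theta>\<^sub>0 n) (\<lambda>\<omega>. \<phi> \<omega> *\<^sub>R score_sum \<theta>\<^sub>0 n \<omega>)"
      using norm_scaled_score_sum_le by (intro integrable_const_bound[where B="C * (real n * M\<^sub>g)"]) auto
    then show ?thesis
      by (subst integral_inner_right[symmetric]) (auto simp: log_ratio_def mult.commute)
  qed
  ultimately show ?thesis
    unfolding gderiv_def by (simp only: integral_law[OF \<phi>, of _ \<theta>\<^sub>0])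
qed

text \<open>Product rule for density times summed score, again under the fixed law at
  \<open>\<theta>\<^sub>0\<close>. The bound is quadratic in \<open>n\<close>, which discounting
  later makes summable.\<close>

lemma has_derivative_integral_score_sum:
  "\<exists>D. ((\<lambda>\<theta>. \<integral>\<omega>. \<phi> \<omega> *\<^sub>R score_sum \<theta> n \<omega> \<partial>law \<theta> n) has_derivative D) (at \<theta>\<^sub>0) \<and>
    (\<forall>v. norm (D v) \<le> C * ((real n * M\<^sub>g)\<^sup>2 + real n * M\<^sub>h) * norm v)"
proof -
  interpret prob_space "law \<theta>\<^sub>0 n"
    by (intro prob_space_traj_law_upto param_policy_in_policies)
  note [measurable_cong] = sets_traj_law_upto
  have coord: "\<omega> t \<in> space X" if "\<omega> \<in> space (law \<theta>\<^sub>0 n)" "t < n" for \<omega> t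
    using that space_PiM_coordinate by simp
  let ?f = "\<lambda>\<theta> \<omega>. exp (log_ratio \<theta>\<^sub>0 \<theta> n \<omega>) *\<^sub>R (\<phi> \<omega> *\<^sub>R score_sum \<theta> n \<omega>)"
  let ?h = "\<lambda>\<theta> \<omega> v. \<phi> \<omega> *\<^sub>R ((v \<bullet> score_sum \<theta> n \<omega>) *\<^sub>R score_sum \<theta> n \<omega> + (\<Sum>t<n. score_hess \<theta> (\<omega> t) v))"
  let ?f' = "\<lambda>\<theta> \<omega> v. exp (log_ratio \<theta>\<^sub>0 \<theta> n \<omega>) *\<^sub>R ?h \<theta> \<omega> v"
  have meas: "?f \<theta> \<in> borel_measurable (law \<theta>\<^sub>0 n)" for \<theta>
    by measurable
  have int_law: "integrable (law \<theta> n) (\<lambda>\<omega>. \<phi> \<omega> *\<^sub>R score_sum \<theta> n \<omega>)" for \<theta>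
  proof -
    interpret \<theta>: prob_space "law \<theta> n"
      by (intro prob_space_traj_law_upto param_policy_in_policies)
    show ?thesis
      using norm_scaled_score_sum_le by (intro \<theta>.integrable_const_bound[where B="C * (real n * M\<^sub>g)"]) auto
  qed
  have int: "integrable (law \<theta>\<^sub>0 n) (?f \<theta>)" for \<theta>
    using int_law[of \<theta>] unfolding law_eq_density[of n \<theta> \<theta>\<^sub>0] by (subst (asm) integrable_density) auto
  have der: "((\<lambda>\<theta>. ?f \<theta> \<omega>) has_derivative ?f' \<theta> \<omega>) (at \<theta>)" if "\<omega> \<in> space (law \<theta>\<^sub>0 n)" for \<omega> \<theta>
    by (rule has_derivative_eq_rhs)
      (auto intro!: derivative_eq_intros log_ratio_has_derivative score_sum_has_derivative coord[OF that]
        simp: algebra_simps)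
  have h_le: "norm (?h \<theta> \<omega> v) \<le> C * ((real n * M\<^sub>g)\<^sup>2 + real n * M\<^sub>h) * norm v"
    if "\<omega> \<in> space (law \<theta>\<^sub>0 n)" for \<theta> \<omega> v
  proof -
    have "norm (\<Sum>t<n. score_hess \<theta> (\<omega> t) v) \<le> real n * (M\<^sub>h * norm v)"
      using norm_score_hess_le[OF coord[OF that]]
      by (intro sum_norm_le[of "{..<n}" _ "\<lambda>_. M\<^sub>h * norm v", simplified]) auto
    moreover have "norm ((v \<bullet> score_sum \<theta> n \<omega>) *\<^sub>R score_sum \<theta> n \<omega>) \<le> (real n * M\<^sub>g * norm v) * (real n * M\<^sub>g)"
      using that Mg abs_inner_score_sum_le[of \<omega> v \<theta>] norm_score_sum_le[where n=n and \<theta>=\<theta> and \<omega>=\<omega>, OF coord[OF that]]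
      by (auto intro!: mult_mono)
    ultimately have "norm ((v \<bullet> score_sum \<theta> n \<omega>) *\<^sub>R score_sum \<theta> n \<omega> + (\<Sum>t<n. score_hess \<theta> (\<omega> t) v))
        \<le> (real n * M\<^sub>g * norm v) * (real n * M\<^sub>g) + real n * (M\<^sub>h * norm v)"
      by (rule norm_triangle_mono[rotated])
    then have "norm (?h \<theta> \<omega> v) \<le> C * ((real n * M\<^sub>g * norm v) * (real n * M\<^sub>g) + real n * (M\<^sub>h * norm v))"
      using \<phi>_le[of \<omega>] that C by (auto intro!: mult_mono)
    then show ?thesis
      by (simp add: algebra_simps power2_eq_square)
  qed
  have bound: "norm (?f' \<theta> \<omega> v) \<le> (exp (real n * M\<^sub>g) * (C * ((real n * M\<^sub>g)\<^sup>2 + real n * M\<^sub>h))) * norm v"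
    if "\<theta> \<in> ball \<theta>\<^sub>0 1" "\<omega> \<in> space (law \<theta>\<^sub>0 n)" for \<theta> \<omega> v
  proof -
    have "norm (?f' \<theta> \<omega> v) = exp (log_ratio \<theta>\<^sub>0 \<theta> n \<omega>) * norm (?h \<theta> \<omega> v)"
      by (simp only: norm_scaleR abs_exp_cancel)
    also have "\<dots> \<le> exp (real n * M\<^sub>g) * (C * ((real n * M\<^sub>g)\<^sup>2 + real n * M\<^sub>h) * norm v)"
      by (intro mult_mono h_le[OF that(2)] log_ratio_le[OF coord[OF that(2)] that(1)]) auto
    finally show ?thesis
      by (simp add: mult.assoc)
  qed
  have D: "((\<lambda>\<theta>. \<integral>\<omega>. ?f \<theta> \<omega> \<partial>law \<theta>\<^sub>0 n) has_derivative (\<lambda>v. \<integral>\<omega>. ?f' \<theta>\<^sub>0 \<omega> v \<partial>law \<theta>\<^sub>0 n)) (at \<theta>\<^sub>0)"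
    and int': "integrable (law \<theta>\<^sub>0 n) (\<lambda>\<omega>. ?f' \<theta>\<^sub>0 \<omega> v)" for v
    using has_derivative_integral_bounded[OF finite_measure_axioms meas int der bound] by blast+
  have "norm (\<integral>\<omega>. ?f' \<theta>\<^sub>0 \<omega> v \<partial>law \<theta>\<^sub>0 n) \<le> C * ((real n * M\<^sub>g)\<^sup>2 + real n * M\<^sub>h) * norm v" for v
  proof -
    have "norm (\<integral>\<omega>. ?f' \<theta>\<^sub>0 \<omega> v \<partial>law \<theta>\<^sub>0 n) \<le> (\<integral>\<omega>. norm (?f' \<theta>\<^sub>0 \<omega> v) \<partial>law \<theta>\<^sub>0 n)"
      by (rule integral_norm_bound)
    also have "\<dots> \<le> C * ((real n * M\<^sub>g)\<^sup>2 + real n * M\<^sub>h) * norm v"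
      using h_le[of _ v \<theta>\<^sub>0] by (intro integral_le_const integrable_norm int' AE_I2) (simp add: log_ratio_def)
    finally show ?thesis .
  qed
  then show ?thesis
    using D by (subst integral_law[of _ n _ \<theta>\<^sub>0]) (auto intro!: exI)
qed

end

end

section \<open>Discounted series with polynomial weights\<close>

lemma
  fixes \<gamma> :: real
  assumes \<gamma>: "0 < \<gamma>" "\<gamma> < 1"
  shows summable_power_sqrt: "summable (\<lambda>k. \<gamma> ^ k * sqrt (real (Suc k)))"
    and suminf_power_sqrt_tail:
      "(\<Sum>k. \<gamma> ^ (k + H) * sqrt (real (Suc (k + H)))) \<le> \<gamma> ^ H * (sqrt (1 / (1 - \<gamma>) + real H) / (1 - \<gamma>))"
proof -
  text \<open>The tangent line of the square root at \<open>Y\<close> reduces the tail to two geometric series.\<close>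
  have tail: "summable (\<lambda>k. \<gamma> ^ (k + H) * sqrt (real (Suc (k + H)))) \<and>
    (\<Sum>k. \<gamma> ^ (k + H) * sqrt (real (Suc (k + H)))) \<le> \<gamma> ^ H * (sqrt (1 / (1 - \<gamma>) + real H) / (1 - \<gamma>))" for H
  proof -
    \<comment> \<open>\<open>Y\<close> is the mean of k + H + 1 under the geometric weights
      \<open>(1 - \<gamma>) * \<gamma> ^ k\<close>, so the tangent at \<open>Y\<close> yields
      exactly Jensen's bound.\<close>
    define Y where "Y = 1 / (1 - \<gamma>) + real H"
    have Y: "Y > 0"
      using \<gamma> by (simp add: Y_def add_pos_nonneg)
    let ?b = "\<lambda>k. \<gamma> ^ H / (2 * sqrt Y) * (real (Suc k) * \<gamma> ^ k + (real H + Y) * \<gamma> ^ k)"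
    have "(\<lambda>k. real (Suc k) * \<gamma> ^ k) sums (1 / (1 - \<gamma>)\<^sup>2)"
      using geometric_deriv_sums[of \<gamma>] \<gamma> by simp
    moreover have "(\<lambda>k. (real H + Y) * \<gamma> ^ k) sums ((real H + Y) * (1 / (1 - \<gamma>)))"
      using \<gamma> by (intro sums_mult geometric_sums) auto
    ultimately have sums: "?b sums (\<gamma> ^ H / (2 * sqrt Y) * (1 / (1 - \<gamma>)\<^sup>2 + (real H + Y) * (1 / (1 - \<gamma>))))"
      by (intro sums_mult[OF sums_add])
    have "1 / (1 - \<gamma>)\<^sup>2 + (real H + Y) * (1 / (1 - \<gamma>)) = 2 * Y / (1 - \<gamma>)"
      by (simp add: Y_def power2_eq_square add_divide_distrib)
    then have total: "\<gamma> ^ H / (2 * sqrt Y) * (1 / (1 - \<gamma>)\<^sup>2 + (real H + Y) * (1 / (1 - \<gamma>))) = \<gamma> ^ H * (sqrt Y / (1 - \<gamma>))"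
    proof -
      have "\<gamma> ^ H / (2 * sqrt Y) * (2 * Y / (1 - \<gamma>)) = \<gamma> ^ H * ((Y / sqrt Y) / (1 - \<gamma>))"
        by simp
      then show ?thesis
        using Y by (simp only: \<open>_ = 2 * Y / (1 - \<gamma>)\<close> real_div_sqrt less_imp_le)
    qed
    have le: "\<gamma> ^ (k + H) * sqrt (real (Suc (k + H))) \<le> ?b k" for k
    proof -
      have "0 \<le> (sqrt (real (Suc (k + H))) - sqrt Y)\<^sup>2"
        by simp
      then have "2 * sqrt Y * sqrt (real (Suc (k + H))) \<le> real (Suc (k + H)) + Y"
        using Y by (simp add: power2_diff mult_ac)
      then have "sqrt (real (Suc (k + H))) \<le> (real (Suc (k + H)) + Y) / (2 * sqrt Y)"
        using Y by (simp add: field_simps)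
      then have "\<gamma> ^ (k + H) * sqrt (real (Suc (k + H))) \<le> \<gamma> ^ (k + H) * ((real (Suc (k + H)) + Y) / (2 * sqrt Y))"
        using \<gamma> by (intro mult_left_mono) auto
      also have "\<dots> = ?b k"
        using Y by (simp add: power_add field_simps)
      finally show ?thesis .
    qed
    have summ: "summable (\<lambda>k. \<gamma> ^ (k + H) * sqrt (real (Suc (k + H))))"
      using le \<gamma> by (intro summable_comparison_test'[OF sums_summable[OF sums], of 0]) auto
    moreover have "(\<Sum>k. \<gamma> ^ (k + H) * sqrt (real (Suc (k + H)))) \<le> (\<Sum>k. ?b k)"
      by (intro suminf_le le summ sums_summable[OF sums])
    ultimately show ?thesis
      using sums_unique[OF sums] total by (simp add: Y_def)
  qed
  show "summable (\<lambda>k. \<gamma> ^ k * sqrt (real (Suc k)))"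
    using tail[of 0] by simp
  show "(\<Sum>k. \<gamma> ^ (k + H) * sqrt (real (Suc (k + H)))) \<le> \<gamma> ^ H * (sqrt (1 / (1 - \<gamma>) + real H) / (1 - \<gamma>))"
    using tail by blast
qed

lemma summable_power_Suc:
  fixes \<gamma> :: real
  assumes "0 < \<gamma>" "\<gamma> < 1"
  shows "summable (\<lambda>k. \<gamma> ^ k * real (Suc k))"
  using geometric_deriv_sums[of \<gamma>] assms by (simp add: sums_iff mult.commute)

text \<open>With \<open>q = sqrt \<gamma>\<close> the terms are squares of
  \<open>q ^ k * real (Suc k)\<close>. That sequence is summable, hence eventually below 1, and so
  it dominates its own squares.\<close>

lemma summable_power_Suc_sq:
  fixes \<gamma> :: real
  assumes \<gamma>: "0 < \<gamma>" "\<gamma> < 1"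
  shows "summable (\<lambda>k. \<gamma> ^ k * (real (Suc k))\<^sup>2)"
proof -
  define q where "q = sqrt \<gamma>"
  have q: "0 < q" "q < 1" "q\<^sup>2 = \<gamma>"
    using \<gamma> by (auto simp: q_def)
  have summ: "summable (\<lambda>k. q ^ k * real (Suc k))"
    using summable_power_Suc q by blast
  have "\<forall>\<^sub>F k in sequentially. q ^ k * real (Suc k) < 1"
    using order_tendstoD(2)[OF summable_LIMSEQ_zero[OF summ]] by auto
  then have "\<forall>\<^sub>F k in sequentially. norm (\<gamma> ^ k * (real (Suc k))\<^sup>2) \<le> q ^ k * real (Suc k)"
  proof eventually_elim
    case (elim k)
    have "\<gamma> ^ k * (real (Suc k))\<^sup>2 = (q ^ k * real (Suc k))\<^sup>2"
      unfolding q(3)[symmetric] by (simp add: power_mult_distrib flip: power_mult add: mult.commute)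
    also have "\<dots> \<le> q ^ k * real (Suc k)"
      using elim q(1) by (simp add: power2_eq_square mult_left_le)
    finally show ?case
      using \<gamma> by simp
  qed
  then show ?thesis
    using summ by (rule summable_comparison_test_ev)
qed

text \<open>Summation over the triangle t <= h in the other order: the reward-to-go form of the
  estimator becomes each reward times the scores up to its time.\<close>

lemma sum_tail_sums_swap:
  fixes v :: "nat \<Rightarrow> 'b::real_vector"
  shows "(\<Sum>t<n. (\<Sum>h=t..<n. a h) *\<^sub>R v t) = (\<Sum>h<n. a h *\<^sub>R (\<Sum>t<Suc h. v t))"
proof (induction n)
  case (Suc n)
  have "(\<Sum>t<Suc n. (\<Sum>h=t..<Suc n. a h) *\<^sub>R v t) = (\<Sum>t<Suc n. (\<Sum>h=t..<n. a h) *\<^sub>R v t + a n *\<^sub>R v t)"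
    by (intro sum.cong) (auto simp: sum.atLeastLessThan_Suc scaleR_add_left)
  also have "\<dots> = (\<Sum>t<n. (\<Sum>h=t..<n. a h) *\<^sub>R v t) + a n *\<^sub>R (\<Sum>t<Suc n. v t)"
    by (simp add: sum.distrib scaleR_sum_right scaleR_add_right)
  finally show ?case
    using Suc by simp
qed simp

section \<open>The discounted series for the objective and its derivatives\<close>

context smooth_policy
begin

text \<open>By \<open>GDERIV_integral_law\<close> this is the gradient of the expected reward at
  time \<open>h\<close>; the law of length \<open>Suc h\<close> suffices because later scores do not
  occur.\<close>

definition reward_grad :: "nat \<Rightarrow> real^'n \<Rightarrow> real^'n" where
  "reward_grad h \<theta> = (\<integral>\<omega>. reward m (fst (\<omega> h)) (snd (\<omega> h)) *\<^sub>R score_sum \<theta> (Suc h) \<omega> \<partial>law \<theta> (Suc h))"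

lemma reward_coordinate_measurable:
  "h < n \<Longrightarrow> (\<lambda>\<omega>. reward m (fst (\<omega> h)) (snd (\<omega> h))) \<in> borel_measurable (PiM {..<n} (\<lambda>_. X))"
  using measurable_compose[OF measurable_component_singleton[of h "{..<n}" "\<lambda>_. X"] reward_measurable]
  by (simp add: case_prod_beta')

lemma abs_reward_coordinate_le:
  assumes "\<omega> \<in> space (PiM {..<n} (\<lambda>_. X))" "h < n"
  shows "\<bar>reward m (fst (\<omega> h)) (snd (\<omega> h))\<bar> \<le> reward_bound m"
  using space_PiM_coordinate[OF assms] by (intro reward_le) (auto simp: space_pair_measure)

text \<open>Consistency of the marginals, needed because \<open>reward_grad\<close> uses length
  \<open>Suc h\<close> while the estimator lives on length \<open>H\<close>.\<close>

lemma law_restrict: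
  assumes "n \<le> N"
  shows "law \<theta> n = distr (law \<theta> N) (PiM {..<n} (\<lambda>_. X)) (\<lambda>\<omega>. restrict \<omega> {..<n})"
proof -
  have "(\<lambda>\<omega>. restrict \<omega> {..<n}) \<in> PiM {..<N} (\<lambda>_. X) \<rightarrow>\<^sub>M PiM {..<n} (\<lambda>_. X)"
    using assms by (intro measurable_restrict measurable_component_singleton) auto
  moreover have "(\<lambda>\<omega>. restrict (restrict \<omega> {..<N}) {..<n}) = (\<lambda>\<omega>::nat \<Rightarrow> 's \<times> 'a. restrict \<omega> {..<n})"
    using assms by (auto simp: restrict_def fun_eq_iff)
  ultimately show ?thesis
    unfolding traj_law_upto_def
    by (subst distr_distr) (simp_all add: measurable_restrict_traj param_policy_in_policies comp_def)
qed

lemma integral_law_restrict: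
  fixes f :: "(nat \<Rightarrow> 's \<times> 'a) \<Rightarrow> 'b::{banach, second_countable_topology}"
  assumes "n \<le> N" "f \<in> borel_measurable (PiM {..<n} (\<lambda>_. X))"
  shows "(\<integral>\<omega>. f \<omega> \<partial>law \<theta> n) = (\<integral>\<omega>. f (restrict \<omega> {..<n}) \<partial>law \<theta> N)"
proof -
  have "(\<lambda>\<omega>. restrict \<omega> {..<n}) \<in> law \<theta> N \<rightarrow>\<^sub>M PiM {..<n} (\<lambda>_. X)"
    using assms by (subst measurable_cong_sets[OF sets_traj_law_upto refl])
      (intro measurable_restrict measurable_component_singleton, auto)
  then show ?thesis
    by (subst law_restrict[OF assms(1)]) (simp add: integral_distr assms(2))
qed

lemma score_sum_restrict: "n \<le> N \<Longrightarrow> score_sum \<theta> n (restrict \<omega> {..<N}) = score_sum \<theta> n \<omega>"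
  by (simp add: score_sum_def)

lemma score_sum_measurable': "n \<le> N \<Longrightarrow> score_sum \<theta> n \<in> borel_measurable (PiM {..<N} (\<lambda>_. X))"
  unfolding score_sum_def[abs_def]
  by (intro borel_measurable_sum measurable_compose[OF _ score_measurable] measurable_component_singleton) auto

lemma
  assumes "n \<le> N"
  shows integrable_norm_score_sum: "integrable (law \<theta> N) (\<lambda>\<omega>. (norm (score_sum \<theta> n \<omega>))\<^sup>2)"
    and integral_norm_score_sum: "(\<integral>\<omega>. (norm (score_sum \<theta> n \<omega>))\<^sup>2 \<partial>law \<theta> N) \<le> real n * M\<^sub>g\<^sup>2"
proof -
  note [measurable_cong] = sets_traj_law_upto
  have int: "integrable (law \<theta> N) (\<lambda>\<omega>. (norm (score_sum \<theta> n \<omega>))\<^sup>2)" if "n \<le> N" for N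
  proof -
    interpret prob_space "law \<theta> N"
      by (intro prob_space_traj_law_upto param_policy_in_policies)
    have "(norm (score_sum \<theta> n \<omega>))\<^sup>2 \<le> (real n * M\<^sub>g)\<^sup>2" if "\<omega> \<in> space (law \<theta> N)" for \<omega>
      using that \<open>n \<le> N\<close> by (intro power_mono norm_score_sum_le space_PiM_coordinate[of \<omega> N]) auto
    then show ?thesis
      using score_sum_measurable'[OF that]
      by (intro integrable_const_bound[where B="(real n * M\<^sub>g)\<^sup>2"]) auto
  qed
  then show "integrable (law \<theta> N) (\<lambda>\<omega>. (norm (score_sum \<theta> n \<omega>))\<^sup>2)"
    using assms .
  have "ennreal (\<integral>\<omega>. (norm (score_sum \<theta> n \<omega>))\<^sup>2 \<partial>law \<theta> n) \<le> ennreal (real n * M\<^sub>g\<^sup>2)"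
    using nn_integral_norm_score_sum[of n \<theta>] by (subst nn_integral_eq_integral[symmetric]) (auto intro: int)
  then have "(\<integral>\<omega>. (norm (score_sum \<theta> n \<omega>))\<^sup>2 \<partial>law \<theta> n) \<le> real n * M\<^sub>g\<^sup>2"
    by (subst (asm) ennreal_le_iff) auto
  then show "(\<integral>\<omega>. (norm (score_sum \<theta> n \<omega>))\<^sup>2 \<partial>law \<theta> N) \<le> real n * M\<^sub>g\<^sup>2"
    by (subst (asm) integral_law_restrict[OF assms]) (auto simp: score_sum_restrict)
qed

text \<open>Orthogonality of the scores gives growth like the square root of h + 1, where the
  triangle inequality would give h + 1. The inequality s <= (s^2 + Y) / (2 sqrt Y), with
  \<open>Y\<close> the second-moment bound, plays the role of Cauchy-Schwarz.\<close>

lemma norm_reward_grad_le: "norm (reward_grad h \<theta>) \<le> reward_bound m * M\<^sub>g * sqrt (real (Suc h))"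
proof -
  note [measurable_cong] = sets_traj_law_upto
  interpret prob_space "law \<theta> (Suc h)"
    by (intro prob_space_traj_law_upto param_policy_in_policies)
  define Y where "Y = real (Suc h) * M\<^sub>g\<^sup>2"
  have Y: "Y > 0" "sqrt Y = sqrt (real (Suc h)) * M\<^sub>g"
    using Mg by (auto simp: Y_def real_sqrt_mult)
  let ?b = "\<lambda>\<omega>. reward_bound m * (((norm (score_sum \<theta> (Suc h) \<omega>))\<^sup>2 + Y) / (2 * sqrt Y))"
  have int: "integrable (law \<theta> (Suc h)) ?b"
    using integrable_norm_score_sum[of "Suc h" "Suc h" \<theta>] by simp
  have le: "norm (reward m (fst (\<omega> h)) (snd (\<omega> h)) *\<^sub>R score_sum \<theta> (Suc h) \<omega>) \<le> ?b \<omega>"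
    if "\<omega> \<in> space (law \<theta> (Suc h))" for \<omega>
  proof -
    have "0 \<le> (norm (score_sum \<theta> (Suc h) \<omega>) - sqrt Y)\<^sup>2"
      by simp
    then have "2 * sqrt Y * norm (score_sum \<theta> (Suc h) \<omega>) \<le> (norm (score_sum \<theta> (Suc h) \<omega>))\<^sup>2 + Y"
      using Y(1) by (simp add: power2_diff mult_ac)
    then have "norm (score_sum \<theta> (Suc h) \<omega>) \<le> ((norm (score_sum \<theta> (Suc h) \<omega>))\<^sup>2 + Y) / (2 * sqrt Y)"
      using Y(1) by (simp add: pos_le_divide_eq mult.commute)
    then show ?thesis
      unfolding norm_scaleR
      using abs_reward_coordinate_le[of \<omega> "Suc h" h] that reward_bound_pos by (intro mult_mono) auto
  qed
  have int': "integrable (law \<theta> (Suc h)) (\<lambda>\<omega>. reward m (fst (\<omega> h)) (snd (\<omega> h)) *\<^sub>R score_sum \<theta> (Suc h) \<omega>)"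
  proof (rule Bochner_Integration.integrable_bound[OF int])
    show "(\<lambda>\<omega>. reward m (fst (\<omega> h)) (snd (\<omega> h)) *\<^sub>R score_sum \<theta> (Suc h) \<omega>) \<in> borel_measurable (law \<theta> (Suc h))"
      using reward_coordinate_measurable[of h "Suc h"] by measurable
    show "AE \<omega> in law \<theta> (Suc h). norm (reward m (fst (\<omega> h)) (snd (\<omega> h)) *\<^sub>R score_sum \<theta> (Suc h) \<omega>) \<le> norm (?b \<omega>)"
      unfolding real_norm_def by (intro AE_I2 order_trans[OF le abs_ge_self])
  qed
  have "norm (reward_grad h \<theta>) \<le>
      (\<integral>\<omega>. norm (reward m (fst (\<omega> h)) (snd (\<omega> h)) *\<^sub>R score_sum \<theta> (Suc h) \<omega>) \<partial>law \<theta> (Suc h))"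
    unfolding reward_grad_def by (rule integral_norm_bound)
  also have "\<dots> \<le> (\<integral>\<omega>. ?b \<omega> \<partial>law \<theta> (Suc h))"
    by (intro integral_mono integrable_norm int int' le)
  also have "\<dots> = reward_bound m * (((\<integral>\<omega>. (norm (score_sum \<theta> (Suc h) \<omega>))\<^sup>2 \<partial>law \<theta> (Suc h)) + Y) / (2 * sqrt Y))"
    using integrable_norm_score_sum[of "Suc h" "Suc h" \<theta>] prob_space by simp
  also have "\<dots> \<le> reward_bound m * ((Y + Y) / (2 * sqrt Y))"
    using reward_bound_pos Y(1) integral_norm_score_sum[of "Suc h" "Suc h" \<theta>]
    by (intro mult_left_mono divide_right_mono add_right_mono) (auto simp: Y_def)
  also have "\<dots> = reward_bound m * sqrt Y"
    using Y(1) real_div_sqrt[of Y] by simp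
  finally show ?thesis
    by (simp add: Y(2) mult_ac)
qed

lemma J_eq_suminf:
  "J m p \<theta> = (\<Sum>h. discount m ^ h * (\<integral>\<omega>. reward m (fst (\<omega> h)) (snd (\<omega> h)) \<partial>law \<theta> (Suc h)))"
  and abs_expected_reward_le: "\<bar>\<integral>\<omega>. reward m (fst (\<omega> h)) (snd (\<omega> h)) \<partial>law \<theta> (Suc h)\<bar> \<le> reward_bound m"
proof -
  have eq: "(\<integral>\<omega>. reward m (fst (\<omega> h)) (snd (\<omega> h)) \<partial>trajectory \<theta>) =
      (\<integral>\<omega>. reward m (fst (\<omega> h)) (snd (\<omega> h)) \<partial>law \<theta> (Suc h))" for h
    unfolding traj_law_upto_def
    by (subst integral_distr) (simp_all add: measurable_restrict_traj param_policy_in_policies reward_coordinate_measurable)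
  show "J m p \<theta> = (\<Sum>h. discount m ^ h * (\<integral>\<omega>. reward m (fst (\<omega> h)) (snd (\<omega> h)) \<partial>law \<theta> (Suc h)))"
    unfolding J_def eq[symmetric] by (intro expected_return_eq_suminf param_policy_in_policies)
  show "\<bar>\<integral>\<omega>. reward m (fst (\<omega> h)) (snd (\<omega> h)) \<partial>law \<theta> (Suc h)\<bar> \<le> reward_bound m"
    unfolding eq[symmetric] by (intro expected_return_eq_suminf param_policy_in_policies)
qed

lemma summable_reward_grad: "summable (\<lambda>h. norm (discount m ^ h *\<^sub>R reward_grad h \<theta>))"
  and norm_discounted_reward_grad_le:
    "norm (discount m ^ h *\<^sub>R reward_grad h \<theta>) \<le> reward_bound m * M\<^sub>g * (discount m ^ h * sqrt (real (Suc h)))"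
proof -
  show le: "norm (discount m ^ h *\<^sub>R reward_grad h \<theta>) \<le> reward_bound m * M\<^sub>g * (discount m ^ h * sqrt (real (Suc h)))" for h
    using mult_left_mono[OF norm_reward_grad_le[of h \<theta>], of "discount m ^ h"] discount_pos
    by (simp add: mult_ac)
  show "summable (\<lambda>h. norm (discount m ^ h *\<^sub>R reward_grad h \<theta>))"
    using le by (intro summable_comparison_test'[OF summable_mult[OF summable_power_sqrt[OF discount_pos discount_less_1]], of 0]) auto
qed

lemma GDERIV_J: "GDERIV (J m p) \<theta> :> (\<Sum>h. discount m ^ h *\<^sub>R reward_grad h \<theta>)"
proof -
  let ?e = "\<lambda>h \<theta>. \<integral>\<omega>. reward m (fst (\<omega> h)) (snd (\<omega> h)) \<partial>law \<theta> (Suc h)"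
  have "((\<lambda>\<theta>. \<Sum>h. discount m ^ h * ?e h \<theta>) has_derivative (\<lambda>v. \<Sum>h. discount m ^ h * (v \<bullet> reward_grad h \<theta>))) (at \<theta>)"
  proof (rule has_derivative_suminf_bounded)
    show "((\<lambda>\<theta>. discount m ^ h * ?e h \<theta>) has_derivative (\<lambda>v. discount m ^ h * (v \<bullet> reward_grad h \<theta>))) (at \<theta>)" for h \<theta>
    proof -
      have "GDERIV (?e h) \<theta> :> reward_grad h \<theta>"
        unfolding reward_grad_def using reward_bound_pos
        by (intro GDERIV_integral_law[where C="reward_bound m"] reward_coordinate_measurable abs_reward_coordinate_le) auto
      then show ?thesis
        unfolding gderiv_def by (rule has_derivative_mult_right)
    qed
    show "norm (discount m ^ h * (v \<bullet> reward_grad h \<theta>)) \<le>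
        (reward_bound m * M\<^sub>g * (discount m ^ h * sqrt (real (Suc h)))) * norm v" for h \<theta> v
    proof -
      have "norm (discount m ^ h * (v \<bullet> reward_grad h \<theta>)) = \<bar>v \<bullet> (discount m ^ h *\<^sub>R reward_grad h \<theta>)\<bar>"
        by simp
      also have "\<dots> \<le> norm v * norm (discount m ^ h *\<^sub>R reward_grad h \<theta>)"
        by (rule Cauchy_Schwarz_ineq2)
      also have "\<dots> \<le> norm v * (reward_bound m * M\<^sub>g * (discount m ^ h * sqrt (real (Suc h))))"
        by (intro mult_left_mono norm_discounted_reward_grad_le) simp
      finally show ?thesis
        by (simp only: mult.commute)
    qed
    show "summable (\<lambda>h. reward_bound m * M\<^sub>g * (discount m ^ h * sqrt (real (Suc h))))"
      by (intro summable_mult summable_power_sqrt discount_pos discount_less_1)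
    have summ: "summable (\<lambda>h. discount m ^ h * reward_bound m)"
      using discount_pos discount_less_1 by (intro summable_mult2 summable_geometric) auto
    show "summable (\<lambda>h. discount m ^ h * ?e h \<theta>)" for \<theta>
      using abs_expected_reward_le discount_pos
      by (intro summable_comparison_test'[OF summ, of 0]) (auto simp: abs_mult intro!: mult_left_mono)
  qed
  moreover have "(\<Sum>h. discount m ^ h * (v \<bullet> reward_grad h \<theta>)) = v \<bullet> (\<Sum>h. discount m ^ h *\<^sub>R reward_grad h \<theta>)" for v
    using bounded_linear.suminf[OF bounded_linear_inner_right summable_norm_cancel[OF summable_reward_grad], of v \<theta>]
    by simp
  ultimately show ?thesis
    unfolding gderiv_def J_eq_suminf[abs_def] by simp
qed

lemma grad_J: "grad (J m p) \<theta> = (\<Sum>h. discount m ^ h *\<^sub>R reward_grad h \<theta>)"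
  by (rule grad_eqI[OF GDERIV_J])

lemma J_has_derivative: "(J m p has_derivative (\<lambda>v. v \<bullet> grad (J m p) \<theta>)) (at \<theta>)"
  using GDERIV_J[of \<theta>] unfolding grad_J gderiv_def .

lemma reward_grad_has_derivative:
  "\<exists>D. (reward_grad h has_derivative D) (at \<theta>) \<and>
    (\<forall>v. norm (D v) \<le> reward_bound m * ((real (Suc h) * M\<^sub>g)\<^sup>2 + real (Suc h) * M\<^sub>h) * norm v)"
  unfolding reward_grad_def[abs_def]
  using reward_bound_pos
  by (intro has_derivative_integral_score_sum reward_coordinate_measurable abs_reward_coordinate_le) auto

text \<open>Termwise differentiation needs only summable bounds. The value of the derivative series
  is discarded: differentiability alone identifies the derivative with \<open>hess\<close>.\<close>

lemma grad_J_has_derivative: "(grad (J m p) has_derivative hess (J m p) \<theta>) (at \<theta>)"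
proof -
  obtain D where D: "\<And>h \<theta>. (reward_grad h has_derivative D h \<theta>) (at \<theta>)"
    and le: "\<And>h \<theta> v. norm (D h \<theta> v) \<le> reward_bound m * ((real (Suc h) * M\<^sub>g)\<^sup>2 + real (Suc h) * M\<^sub>h) * norm v"
    using reward_grad_has_derivative by metis
  have "((\<lambda>\<theta>. \<Sum>h. discount m ^ h *\<^sub>R reward_grad h \<theta>) has_derivative (\<lambda>v. \<Sum>h. discount m ^ h *\<^sub>R D h \<theta> v)) (at \<theta>)"
  proof (rule has_derivative_suminf_bounded)
    show "((\<lambda>\<theta>. discount m ^ h *\<^sub>R reward_grad h \<theta>) has_derivative (\<lambda>v. discount m ^ h *\<^sub>R D h \<theta> v)) (at \<theta>)" for h \<theta>
      by (intro has_derivative_scaleR_right D)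
    show "norm (discount m ^ h *\<^sub>R D h \<theta> v) \<le>
        (reward_bound m * M\<^sub>g\<^sup>2 * (discount m ^ h * (real (Suc h))\<^sup>2) + reward_bound m * M\<^sub>h * (discount m ^ h * real (Suc h))) * norm v" for h \<theta> v
      using mult_left_mono[OF le[of h \<theta> v], of "discount m ^ h"] discount_pos
      by (simp add: power_mult_distrib algebra_simps del: of_nat_Suc)
    show "summable (\<lambda>h. reward_bound m * M\<^sub>g\<^sup>2 * (discount m ^ h * (real (Suc h))\<^sup>2) + reward_bound m * M\<^sub>h * (discount m ^ h * real (Suc h)))"
      by (intro summable_add summable_mult summable_power_Suc_sq summable_power_Suc discount_pos discount_less_1)
    show "summable (\<lambda>h. discount m ^ h *\<^sub>R reward_grad h \<theta>)" for \<theta>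
      by (rule summable_norm_cancel[OF summable_reward_grad])
  qed
  then have "grad (J m p) differentiable (at \<theta>)"
    unfolding grad_J[abs_def] by (rule differentiableI)
  then show ?thesis
    by (rule has_derivative_grad)
qed

text \<open>The difference is the series from time \<open>H\<close> on, and the root in
  \<open>D_grad\<close> is that of the tail estimate. At \<open>H = 0\<close> the sum is empty and
  the gradient itself is bounded.\<close>

lemma norm_grad_J_diff_le:
  "norm (grad (J m p) \<theta> - (\<Sum>h<H. discount m ^ h *\<^sub>R reward_grad h \<theta>)) \<le>
    D_grad (reward_bound m) (discount m) M\<^sub>g H * discount m ^ H"
proof -
  have "grad (J m p) \<theta> - (\<Sum>h<H. discount m ^ h *\<^sub>R reward_grad h \<theta>) =
      (\<Sum>h. discount m ^ (h + H) *\<^sub>R reward_grad (h + H) \<theta>)"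
    unfolding grad_J using suminf_split_initial_segment[OF summable_norm_cancel[OF summable_reward_grad], of \<theta> H] by simp
  also have "norm \<dots> \<le> (\<Sum>h. norm (discount m ^ (h + H) *\<^sub>R reward_grad (h + H) \<theta>))"
    by (intro summable_norm summable_ignore_initial_segment[OF summable_reward_grad])
  also have "\<dots> \<le> (\<Sum>h. reward_bound m * M\<^sub>g * (discount m ^ (h + H) * sqrt (real (Suc (h + H)))))"
    by (intro suminf_le norm_discounted_reward_grad_le summable_mult
        summable_ignore_initial_segment[OF summable_reward_grad]
        summable_ignore_initial_segment[OF summable_power_sqrt] discount_pos discount_less_1)
  also have "\<dots> = reward_bound m * M\<^sub>g * (\<Sum>h. discount m ^ (h + H) * sqrt (real (Suc (h + H))))"
    by (intro suminf_mult summable_ignore_initial_segment[OF summable_power_sqrt] discount_pos discount_less_1)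
  also have "\<dots> \<le> reward_bound m * M\<^sub>g * (discount m ^ H * (sqrt (1 / (1 - discount m) + real H) / (1 - discount m)))"
    using reward_bound_pos Mg
    by (intro mult_left_mono suminf_power_sqrt_tail discount_pos discount_less_1) auto
  also have "\<dots> = D_grad (reward_bound m) (discount m) M\<^sub>g H * discount m ^ H"
    by (simp add: D_grad_def)
  finally show ?thesis .
qed

text \<open>This is why one constant can bound both the gradient and the second moment of the
  estimator.\<close>

lemma sigma_grad_eq: "sigma_grad (reward_bound m) (discount m) M\<^sub>g = D_grad (reward_bound m) (discount m) M\<^sub>g 0"
  using reward_bound_pos Mg discount_less_1
  by (simp add: sigma_grad_def D_grad_def real_sqrt_divide real_sqrt_mult power3_eq_cube)

lemma norm_grad_J_le: "norm (grad (J m p) \<theta>) \<le> sigma_grad (reward_bound m) (discount m) M\<^sub>g"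
  using norm_grad_J_diff_le[of \<theta> 0] by (simp add: sigma_grad_eq)

section \<open>The gradient estimator: measurability, mean and second moment\<close>

lemma pg_estimator_eq:
  "pg_estimator m p H \<tau> \<theta> =
    (\<Sum>h<H. (discount m ^ h * reward m (fst (\<tau> h)) (snd (\<tau> h))) *\<^sub>R score_sum \<theta> (Suc h) \<tau>)"
  unfolding pg_estimator_def score_def[symmetric] score_sum_def by (rule sum_tail_sums_swap)

lemma pg_estimator_measurable:
  "(\<lambda>(\<theta>, \<tau>). pg_estimator m p H \<tau> \<theta>) \<in> borel_measurable (borel \<Otimes>\<^sub>M PiM {..<H} (\<lambda>_. X))"
proof -
  have score: "(\<lambda>z. score (fst z) (snd z t)) \<in> borel_measurable (borel \<Otimes>\<^sub>M PiM {..<H} (\<lambda>_. X))" if "t < H" for t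
  proof -
    have "(\<lambda>z. (fst z, snd z t)) \<in> borel \<Otimes>\<^sub>M PiM {..<H} (\<lambda>_. X) \<rightarrow>\<^sub>M borel \<Otimes>\<^sub>M X"
      using that by (intro measurable_Pair measurable_fst measurable_compose[OF measurable_snd measurable_component_singleton]) auto
    from measurable_compose[OF this score_joint_measurable] show ?thesis
      by simp
  qed
  show ?thesis
    unfolding case_prod_beta' pg_estimator_eq score_sum_def
    by (intro borel_measurable_sum borel_measurable_scaleR borel_measurable_times borel_measurable_const score
        measurable_compose[OF measurable_snd reward_coordinate_measurable]) auto
qed

text \<open>A crude uniform bound that serves integrability and does not enter the rate.\<close>

lemma norm_pg_estimator_le:
  assumes "\<tau> \<in> space (PiM {..<H} (\<lambda>_. X))"
  shows "norm (pg_estimator m p H \<tau> \<theta>) \<le> (\<Sum>h<H. discount m ^ h * reward_bound m * (real (Suc h) * M\<^sub>g))"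
  unfolding pg_estimator_eq
proof (intro sum_norm_le)
  fix h assume "h \<in> {..<H}"
  then have "norm (score_sum \<theta> (Suc h) \<tau>) \<le> real (Suc h) * M\<^sub>g"
    by (intro norm_score_sum_le space_PiM_coordinate[OF assms]) auto
  moreover have "\<bar>reward m (fst (\<tau> h)) (snd (\<tau> h))\<bar> \<le> reward_bound m"
    using \<open>h \<in> {..<H}\<close> by (intro abs_reward_coordinate_le[OF assms]) auto
  ultimately show "norm ((discount m ^ h * reward m (fst (\<tau> h)) (snd (\<tau> h))) *\<^sub>R score_sum \<theta> (Suc h) \<tau>)
      \<le> discount m ^ h * reward_bound m * (real (Suc h) * M\<^sub>g)"
    unfolding norm_scaleR abs_mult using discount_pos reward_bound_pos
    by (intro mult_mono) auto
qed

text \<open>The estimator is unbiased for the truncated gradient, since its summand at time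
  \<open>h\<close> reads only the first \<open>Suc h\<close> coordinates.\<close>

lemma integral_pg_estimator:
  "(\<integral>\<tau>. pg_estimator m p H \<tau> \<theta> \<partial>law \<theta> H) = (\<Sum>h<H. discount m ^ h *\<^sub>R reward_grad h \<theta>)"
proof -
  note [measurable_cong] = sets_traj_law_upto
  interpret prob_space "law \<theta> H"
    by (intro prob_space_traj_law_upto param_policy_in_policies)
  have int: "integrable (law \<theta> H) (\<lambda>\<tau>. reward m (fst (\<tau> h)) (snd (\<tau> h)) *\<^sub>R score_sum \<theta> (Suc h) \<tau>)" if "h < H" for h
  proof (rule integrable_const_bound[where B="reward_bound m * (real (Suc h) * M\<^sub>g)"])
    show "(\<lambda>\<tau>. reward m (fst (\<tau> h)) (snd (\<tau> h)) *\<^sub>R score_sum \<theta> (Suc h) \<tau>) \<in> borel_measurable (law \<theta> H)"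
      using reward_coordinate_measurable[OF that] score_sum_measurable'[of "Suc h" H \<theta>] that by simp
    show "AE \<tau> in law \<theta> H. norm (reward m (fst (\<tau> h)) (snd (\<tau> h)) *\<^sub>R score_sum \<theta> (Suc h) \<tau>) \<le> reward_bound m * (real (Suc h) * M\<^sub>g)"
      unfolding norm_scaleR using that reward_bound_pos
      by (intro AE_I2 mult_mono abs_reward_coordinate_le[of _ H] norm_score_sum_le space_PiM_coordinate[of _ H]) auto
  qed
  have "(\<integral>\<tau>. pg_estimator m p H \<tau> \<theta> \<partial>law \<theta> H) =
      (\<Sum>h<H. discount m ^ h *\<^sub>R (\<integral>\<tau>. reward m (fst (\<tau> h)) (snd (\<tau> h)) *\<^sub>R score_sum \<theta> (Suc h) \<tau> \<partial>law \<theta> H))"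
    unfolding pg_estimator_eq using int by (subst Bochner_Integration.integral_sum) (auto simp flip: scaleR_scaleR)
  also have "\<dots> = (\<Sum>h<H. discount m ^ h *\<^sub>R reward_grad h \<theta>)"
  proof (rule sum.cong)
    fix h assume "h \<in> {..<H}"
    then have "Suc h \<le> H" by simp
    moreover have "(\<lambda>\<tau>. reward m (fst (\<tau> h)) (snd (\<tau> h)) *\<^sub>R score_sum \<theta> (Suc h) \<tau>) \<in> borel_measurable (PiM {..<Suc h} (\<lambda>_. X))"
      using reward_coordinate_measurable[of h "Suc h"] by measurable
    ultimately have "reward_grad h \<theta> = (\<integral>\<tau>. reward m (fst (\<tau> h)) (snd (\<tau> h)) *\<^sub>R score_sum \<theta> (Suc h) \<tau> \<partial>law \<theta> H)"
      unfolding reward_grad_def by (subst integral_law_restrict) (auto simp: score_sum_restrict)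
    then show "discount m ^ h *\<^sub>R (\<integral>\<tau>. reward m (fst (\<tau> h)) (snd (\<tau> h)) *\<^sub>R score_sum \<theta> (Suc h) \<tau> \<partial>law \<theta> H) =
        discount m ^ h *\<^sub>R reward_grad h \<theta>" by simp
  qed simp
  finally show ?thesis .
qed

text \<open>Cauchy-Schwarz with the discount split into two square roots. The sum of
  \<open>\<gamma> ^ h\<close> gives one factor \<open>1 / (1 - \<gamma>)\<close>, and the second
  moments, linear in h + 1, give two more; hence the cube in \<open>sigma_grad\<close>.\<close>

lemma integral_norm_pg_estimator_le:
  "(\<integral>\<tau>. (norm (pg_estimator m p H \<tau> \<theta>))\<^sup>2 \<partial>law \<theta> H) \<le> (sigma_grad (reward_bound m) (discount m) M\<^sub>g)\<^sup>2"
proof -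
  note [measurable_cong] = sets_traj_law_upto
  interpret prob_space "law \<theta> H"
    by (intro prob_space_traj_law_upto param_policy_in_policies)
  let ?\<gamma> = "discount m" and ?r = "reward_bound m"
  let ?w = "?r\<^sup>2 / (1 - ?\<gamma>)"
  have int: "integrable (law \<theta> H) (\<lambda>\<tau>. \<Sum>h<H. ?\<gamma> ^ h * (norm (score_sum \<theta> (Suc h) \<tau>))\<^sup>2)"
    by (intro Bochner_Integration.integrable_sum integrable_mult_right integrable_norm_score_sum) auto
  have le: "(norm (pg_estimator m p H \<tau> \<theta>))\<^sup>2 \<le> ?w * (\<Sum>h<H. ?\<gamma> ^ h * (norm (score_sum \<theta> (Suc h) \<tau>))\<^sup>2)"
    if "\<tau> \<in> space (law \<theta> H)" for \<tau>
  proof -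
    let ?y = "\<lambda>h. norm (score_sum \<theta> (Suc h) \<tau>)"
    have "norm (pg_estimator m p H \<tau> \<theta>) \<le> (\<Sum>h<H. ?r * (?\<gamma> ^ h * ?y h))"
      unfolding pg_estimator_eq
    proof (intro sum_norm_le)
      fix h assume "h \<in> {..<H}"
      then have "\<bar>reward m (fst (\<tau> h)) (snd (\<tau> h))\<bar> \<le> ?r"
        using that by (intro abs_reward_coordinate_le[of \<tau> H]) auto
      then have "\<bar>reward m (fst (\<tau> h)) (snd (\<tau> h))\<bar> * (?\<gamma> ^ h * ?y h) \<le> ?r * (?\<gamma> ^ h * ?y h)"
        using discount_pos by (intro mult_right_mono) auto
      then show "norm ((?\<gamma> ^ h * reward m (fst (\<tau> h)) (snd (\<tau> h))) *\<^sub>R score_sum \<theta> (Suc h) \<tau>) \<le> ?r * (?\<gamma> ^ h * ?y h)"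
        using discount_pos by (simp add: abs_mult mult_ac)
    qed
    then have "(norm (pg_estimator m p H \<tau> \<theta>))\<^sup>2 \<le> (\<Sum>h<H. ?r * (?\<gamma> ^ h * ?y h))\<^sup>2"
      by (intro power_mono) auto
    also have "\<dots> = ?r\<^sup>2 * (\<Sum>h<H. sqrt (?\<gamma> ^ h) * (sqrt (?\<gamma> ^ h) * ?y h))\<^sup>2"
    proof -
      have "sqrt (?\<gamma> ^ h) * (sqrt (?\<gamma> ^ h) * ?y h) = ?\<gamma> ^ h * ?y h" for h
        using discount_pos by (simp flip: mult.assoc)
      then show ?thesis
        by (simp only: sum_distrib_left[symmetric] power_mult_distrib)
    qed
    also have "\<dots> \<le> ?r\<^sup>2 * ((\<Sum>h<H. (sqrt (?\<gamma> ^ h))\<^sup>2) * (\<Sum>h<H. (sqrt (?\<gamma> ^ h) * ?y h)\<^sup>2))"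
      by (intro mult_left_mono Cauchy_Schwarz_ineq_sum) simp
    also have "\<dots> = ?r\<^sup>2 * ((\<Sum>h<H. ?\<gamma> ^ h) * (\<Sum>h<H. ?\<gamma> ^ h * (?y h)\<^sup>2))"
      using discount_pos by (simp add: power_mult_distrib)
    also have "\<dots> \<le> ?r\<^sup>2 * (1 / (1 - ?\<gamma>) * (\<Sum>h<H. ?\<gamma> ^ h * (?y h)\<^sup>2))"
    proof (intro mult_left_mono mult_right_mono)
      show "(\<Sum>h<H. ?\<gamma> ^ h) \<le> 1 / (1 - ?\<gamma>)"
        using discount_pos discount_less_1 by (subst suminf_geometric[symmetric]) (auto intro!: sum_le_suminf)
    qed (use discount_pos in \<open>auto intro!: sum_nonneg\<close>)
    finally show ?thesis by simp
  qed
  have "(\<integral>\<tau>. (norm (pg_estimator m p H \<tau> \<theta>))\<^sup>2 \<partial>law \<theta> H) \<le>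
      (\<integral>\<tau>. ?w * (\<Sum>h<H. ?\<gamma> ^ h * (norm (score_sum \<theta> (Suc h) \<tau>))\<^sup>2) \<partial>law \<theta> H)"
    by (intro integral_mono_AE' AE_I2 order_trans[OF zero_le_power2 le] le integrable_mult_right int)
  also have "\<dots> = ?w * (\<Sum>h<H. ?\<gamma> ^ h * (\<integral>\<tau>. (norm (score_sum \<theta> (Suc h) \<tau>))\<^sup>2 \<partial>law \<theta> H))"
    using integrable_norm_score_sum[of _ H \<theta>] by (simp add: Bochner_Integration.integral_sum)
  also have "\<dots> \<le> ?w * (\<Sum>h<H. ?\<gamma> ^ h * (real (Suc h) * M\<^sub>g\<^sup>2))"
    using discount_less_1 discount_pos
    by (intro mult_left_mono sum_mono integral_norm_score_sum) auto
  also have "\<dots> = ?w * M\<^sub>g\<^sup>2 * (\<Sum>h<H. real (Suc h) * ?\<gamma> ^ h)"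
    unfolding sum_distrib_left by (intro sum.cong) simp_all
  also have "\<dots> \<le> ?w * M\<^sub>g\<^sup>2 * (1 / (1 - ?\<gamma>)\<^sup>2)"
  proof (intro mult_left_mono)
    have *: "(\<lambda>h. real (Suc h) * ?\<gamma> ^ h) sums (1 / (1 - ?\<gamma>)\<^sup>2)"
      using geometric_deriv_sums[of ?\<gamma>] discount_pos discount_less_1 by simp
    show "(\<Sum>h<H. real (Suc h) * ?\<gamma> ^ h) \<le> 1 / (1 - ?\<gamma>)\<^sup>2"
      unfolding sums_unique[OF *]
      using discount_pos by (intro sum_le_suminf sums_summable[OF *]) auto
  qed (use discount_less_1 in auto)
  also have "\<dots> = (sigma_grad ?r ?\<gamma> M\<^sub>g)\<^sup>2"
    using discount_less_1 by (simp add: sigma_grad_def power2_eq_square power3_eq_cube)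
  finally show ?thesis .
qed

text \<open>All laws have densities with respect to the law at parameter 0, jointly measurable in
  parameter and trajectory; the reference point 0 is arbitrary.\<close>

lemma law_measurable: "(\<lambda>\<theta>. law \<theta> H) \<in> borel \<rightarrow>\<^sub>M prob_algebra (PiM {..<H} (\<lambda>_. X))"
proof -
  interpret prob_space "law 0 H"
    by (intro prob_space_traj_law_upto param_policy_in_policies)
  have joint: "(\<lambda>(\<theta>, \<omega>). ennreal (exp (log_ratio 0 \<theta> H \<omega>))) \<in> borel_measurable (borel \<Otimes>\<^sub>M PiM {..<H} (\<lambda>_. X))"
  proof -
    have pair: "(\<lambda>z. (c (fst z), snd z t)) \<in> borel \<Otimes>\<^sub>M PiM {..<H} (\<lambda>_. X) \<rightarrow>\<^sub>M borel \<Otimes>\<^sub>M X"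
      if "t < H" "c \<in> borel_measurable borel" for t and c :: "real^'n \<Rightarrow> real^'n"
      using that by (intro measurable_Pair measurable_compose[OF measurable_fst]
          measurable_compose[OF measurable_snd measurable_component_singleton]) auto
    have "(\<lambda>z. loglik (c (fst z)) (snd z t)) \<in> borel_measurable (borel \<Otimes>\<^sub>M PiM {..<H} (\<lambda>_. X))"
      if "t < H" "c \<in> borel_measurable borel" for t and c :: "real^'n \<Rightarrow> real^'n"
      using measurable_compose[OF pair[OF that] loglik_joint_measurable] by simp
    from this[of _ "\<lambda>x. x"] this[of _ "\<lambda>_. 0"] show ?thesis
      unfolding case_prod_beta' log_ratio_def
      by (intro measurable_compose[OF _ measurable_ennreal] borel_measurable_exp measurable_compose[OF _ borel_measurable_exp]
          borel_measurable_sum borel_measurable_diff) auto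
  qed
  have "(\<lambda>\<theta>. density (law 0 H) (\<lambda>\<omega>. ennreal (exp (log_ratio 0 \<theta> H \<omega>)))) \<in> borel \<rightarrow>\<^sub>M prob_algebra (law 0 H)"
  proof (rule measurable_density_prob_algebra)
    show "sigma_finite_measure (law 0 H)"
      by (rule sigma_finite_measure_axioms)
    show "(\<lambda>(\<theta>, \<omega>). ennreal (exp (log_ratio 0 \<theta> H \<omega>))) \<in> borel_measurable (borel \<Otimes>\<^sub>M law 0 H)"
      using joint by (simp cong: measurable_cong_sets sets_pair_measure_cong)
    show "(\<integral>\<^sup>+\<omega>. ennreal (exp (log_ratio 0 \<theta> H \<omega>)) \<partial>law 0 H) = 1" for \<theta>
      using nn_integral_law[of "\<lambda>_. 1" H \<theta> 0]
        prob_space.emeasure_space_1[OF prob_space_traj_law_upto[OF param_policy_in_policies], of H \<theta>] by simp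
  qed
  then show ?thesis
    unfolding law_eq_density[of H _ 0, symmetric]
    by (simp add: prob_algebra_def subprob_algebra_cong[OF sets_traj_law_upto])
qed

lemma J_le_optimal: "J m p \<theta> \<le> optimal_return m"
  unfolding J_def by (intro expected_return_le_optimal param_policy_in_policies)

end

section \<open>Analysis of N-PG-IGT\<close>

text \<open>Jensen's inequality by a tangent of the square root, taken at \<open>Y\<close> so that
  an upper bound on the expectation is enough.\<close>

lemma (in prob_space) nn_integral_sqrt_le:
  assumes X: "integrable M X" "\<And>x. x \<in> space M \<Longrightarrow> 0 \<le> X x" and Y: "expectation X \<le> Y" "0 < Y"
  shows "(\<integral>\<^sup>+x. ennreal (sqrt (X x)) \<partial>M) \<le> ennreal (sqrt Y)"
proof -
  have "sqrt (X x) \<le> (X x + Y) / (2 * sqrt Y)" if "x \<in> space M" for x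
  proof -
    have "0 \<le> (sqrt (X x) - sqrt Y)\<^sup>2"
      by simp
    then have "2 * sqrt Y * sqrt (X x) \<le> X x + Y"
      using X(2)[OF that] Y(2) by (simp add: power2_diff mult_ac)
    then show ?thesis
      using Y(2) by (simp add: pos_le_divide_eq mult.commute)
  qed
  then have "(\<integral>\<^sup>+x. ennreal (sqrt (X x)) \<partial>M) \<le> (\<integral>\<^sup>+x. ennreal ((X x + Y) / (2 * sqrt Y)) \<partial>M)"
    by (intro nn_integral_mono ennreal_leI)
  also have "\<dots> = ennreal (\<integral>x. (X x + Y) / (2 * sqrt Y) \<partial>M)"
    using X Y(2) by (intro nn_integral_eq_integral) auto
  also have "(\<integral>x. (X x + Y) / (2 * sqrt Y) \<partial>M) = (expectation X + Y) / (2 * sqrt Y)"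
    using X by (simp add: prob_space)
  also have "\<dots> \<le> (Y + Y) / (2 * sqrt Y)"
    using Y by (intro divide_right_mono) auto
  also have "\<dots> = sqrt Y"
    using Y(2) real_div_sqrt[of Y] by simp
  finally show ?thesis
    by (simp add: ennreal_leI)
qed

text \<open>Centred noise is orthogonal to the constant \<open>a\<close>, and a variance is at most
  the second moment.\<close>

lemma (in prob_space)
  fixes g :: "'a \<Rightarrow> 'b::euclidean_space"
  assumes g: "g \<in> borel_measurable M" "\<And>x. x \<in> space M \<Longrightarrow> norm (g x) \<le> B"
  shows integrable_norm_noise: "integrable M (\<lambda>x. (norm (a + \<eta> *\<^sub>R (g x - expectation g)))\<^sup>2)"
    and expectation_norm_noise_le: "expectation (\<lambda>x. (norm (a + \<eta> *\<^sub>R (g x - expectation g)))\<^sup>2)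
      \<le> (norm a)\<^sup>2 + \<eta>\<^sup>2 * expectation (\<lambda>x. (norm (g x))\<^sup>2)"
proof -
  let ?e = "expectation g"
  have int: "integrable M g"
    using g by (intro integrable_const_bound[where B=B]) auto
  have int2: "integrable M (\<lambda>x. (norm (g x))\<^sup>2)"
    using g(1) power_mono[OF g(2) norm_ge_zero, of _ 2] by (intro integrable_const_bound[where B="B\<^sup>2"]) auto
  have eq: "(norm (a + \<eta> *\<^sub>R (g x - ?e)))\<^sup>2 = (norm a)\<^sup>2 + 2 * \<eta> * (a \<bullet> g x - a \<bullet> ?e)
      + \<eta>\<^sup>2 * ((norm (g x))\<^sup>2 - 2 * (?e \<bullet> g x) + ?e \<bullet> ?e)" for x
    unfolding power2_norm_eq_inner
    by (simp add: inner_add_left inner_add_right inner_diff_left inner_diff_right inner_commute algebra_simps power2_eq_square)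
  show "integrable M (\<lambda>x. (norm (a + \<eta> *\<^sub>R (g x - ?e)))\<^sup>2)"
    unfolding eq using int int2 by simp
  have "expectation (\<lambda>x. (norm (a + \<eta> *\<^sub>R (g x - ?e)))\<^sup>2) = (norm a)\<^sup>2 + \<eta>\<^sup>2 * (expectation (\<lambda>x. (norm (g x))\<^sup>2) - ?e \<bullet> ?e)"
    unfolding eq using int int2 by (simp add: prob_space)
  also have "\<dots> \<le> (norm a)\<^sup>2 + \<eta>\<^sup>2 * expectation (\<lambda>x. (norm (g x))\<^sup>2)"
    by (intro add_left_mono mult_left_mono) auto
  finally show "expectation (\<lambda>x. (norm (a + \<eta> *\<^sub>R (g x - ?e)))\<^sup>2) \<le> (norm a)\<^sup>2 + \<eta>\<^sup>2 * expectation (\<lambda>x. (norm (g x))\<^sup>2)" .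
qed

text \<open>Separates the optimization argument from the decision process. \<open>b\<close> is the
  bias of the oracle, \<open>B\<close> serves only integrability, and \<open>W\<close> carries the
  sigma-algebra common to all trajectory laws.\<close>

locale igt_oracle =
  fixes m :: "('s, 'a) mdp" and p :: "real^'n \<Rightarrow> 's \<Rightarrow> 'a \<Rightarrow> real"
    and H :: nat and W :: "(nat \<Rightarrow> 's \<times> 'a) measure" and \<sigma> b L J\<^sub>m\<^sub>a\<^sub>x B :: real
    and \<eta> \<alpha> :: "nat \<Rightarrow> real"
    and \<theta>\<^sub>0 :: "real^'n" and I :: "((real^'n) \<times> (real^'n)) measure"
  assumes law_measurable: "(\<lambda>\<theta>. traj_law_upto m H (param_policy m p \<theta>)) \<in> borel \<rightarrow>\<^sub>M prob_algebra W"
    and g_measurable: "(\<lambda>(\<theta>, \<tau>). pg_estimator m p H \<tau> \<theta>) \<in> borel_measurable (borel \<Otimes>\<^sub>M W)"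
    and g_bound: "\<And>\<theta> \<tau>. \<tau> \<in> space W \<Longrightarrow> norm (pg_estimator m p H \<tau> \<theta>) \<le> B"
    and g_second_moment: "\<And>\<theta>. (\<integral>\<tau>. (norm (pg_estimator m p H \<tau> \<theta>))\<^sup>2 \<partial>traj_law_upto m H (param_policy m p \<theta>)) \<le> \<sigma>\<^sup>2"
    and g_bias: "\<And>\<theta>. norm ((\<integral>\<tau>. pg_estimator m p H \<tau> \<theta> \<partial>traj_law_upto m H (param_policy m p \<theta>)) - grad (J m p) \<theta>) \<le> b"
    and mean_measurable: "(\<lambda>\<theta>. \<integral>\<tau>. pg_estimator m p H \<tau> \<theta> \<partial>traj_law_upto m H (param_policy m p \<theta>)) \<in> borel_measurable borel"
    and J_deriv: "\<And>\<theta>. (J m p has_derivative (\<lambda>v. v \<bullet> grad (J m p) \<theta>)) (at \<theta>)"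
    and grad_deriv: "\<And>\<theta>. (grad (J m p) has_derivative hess (J m p) \<theta>) (at \<theta>)"
    and grad_le: "\<And>\<theta>. norm (grad (J m p) \<theta>) \<le> \<sigma>"
    and hess_lipschitz: "L-lipschitz_on UNIV (hess (J m p))"
    and J_le: "\<And>\<theta>. J m p \<theta> \<le> J\<^sub>m\<^sub>a\<^sub>x"
    and \<sigma>_pos: "0 < \<sigma>"
    and \<eta>_pos: "\<And>t. 0 < \<eta> t" and \<eta>_less_1: "\<And>t. \<eta> (Suc t) < 1"
    and \<alpha>_nonneg: "\<And>t. 0 \<le> \<alpha> t"
    and I_prob: "prob_space I" and sets_I: "sets I = sets (borel \<Otimes>\<^sub>M borel)"
    and I_step: "AE (\<theta>\<^sub>1, d\<^sub>0) in I. norm (\<theta>\<^sub>1 - \<theta>\<^sub>0) \<le> \<alpha> 0"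
    and I_dir: "(\<integral>\<^sup>+ (\<theta>\<^sub>1, d\<^sub>0). ennreal (norm d\<^sub>0) \<partial>I) \<le> ennreal \<sigma>"
begin

abbreviation P where "P \<theta> \<equiv> traj_law_upto m H (param_policy m p \<theta>)"
abbreviation g where "g \<tau> \<theta> \<equiv> pg_estimator m p H \<tau> \<theta>"
abbreviation GJ where "GJ \<equiv> grad (J m p)"
abbreviation mean where "mean \<theta> \<equiv> \<integral>\<tau>. g \<tau> \<theta> \<partial>P \<theta>"
abbreviation update where "update n \<equiv> igt_update m p H \<eta> \<alpha> (Suc n)"
abbreviation run where "run \<equiv> igt_run m p H \<eta> \<alpha> \<theta>\<^sub>0 I"
abbreviation space_config :: "((nat \<Rightarrow> real^'n) \<times> (real^'n)) measure" where
  "space_config \<equiv> config_space"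

lemma L_nonneg: "0 \<le> L"
  using hess_lipschitz by (rule lipschitz_on_nonneg)

lemma b_nonneg: "0 \<le> b"
  using g_bias[of 0] norm_ge_zero order_trans by blast

lemma prob_space_P: "prob_space (P \<theta>)" and sets_P: "sets (P \<theta>) = sets W"
  using measurable_space[OF law_measurable, of \<theta>] by (auto simp: space_prob_algebra)

lemma space_P: "space (P \<theta>) = space W"
  by (rule sets_eq_imp_space_eq[OF sets_P])

lemma g_measurable_P: "(\<lambda>\<tau>. g \<tau> \<theta>) \<in> borel_measurable (P \<theta>')"
  using measurable_compose[OF _ g_measurable, of "\<lambda>\<tau>. (\<theta>, \<tau>)"] by (simp cong: measurable_cong_sets add: sets_P)

subsection \<open>Smoothness of the objective\<close>

lemma hess_diff_le: "norm (hess (J m p) x v - hess (J m p) y v) \<le> L * norm (x - y) * norm v"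
proof -
  have "norm (hess (J m p) x v - hess (J m p) y v) \<le> norm (hess (J m p) x - hess (J m p) y) * norm v"
    using norm_blinfun[of "hess (J m p) x - hess (J m p) y" v] by (simp add: blinfun.diff_left)
  also have "norm (hess (J m p) x - hess (J m p) y) \<le> L * norm (x - y)"
    using lipschitz_onD[OF hess_lipschitz, of x y] by (simp add: dist_norm)
  finally show ?thesis
    by (simp add: mult_right_mono)
qed

lemma closed_segment_dist: "z \<in> closed_segment x y \<Longrightarrow> norm (z - x) \<le> norm (y - x)" for x y z :: "real^'n"
  using segment_bound(1)[of z x y] by (simp add: norm_minus_commute)

text \<open>Mean value inequality on the segment after subtracting the linear part; the sharper
  factor 1/2 is given up.\<close>

lemma grad_taylor: "norm (GJ y - GJ x - hess (J m p) x (y - x)) \<le> L * (norm (y - x))\<^sup>2"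
proof -
  have "norm ((GJ y - hess (J m p) x y) - (GJ x - hess (J m p) x x)) \<le> (L * norm (y - x)) * norm (y - x)"
  proof (rule differentiable_bound[of "closed_segment x y"])
    show "((\<lambda>z. GJ z - hess (J m p) x z) has_derivative (\<lambda>v. hess (J m p) z v - hess (J m p) x v)) (at z within closed_segment x y)" for z
      by (intro has_derivative_diff has_derivative_at_withinI[OF grad_deriv]
          bounded_linear_imp_has_derivative blinfun.bounded_linear_right)
    show "onorm (\<lambda>v. hess (J m p) z v - hess (J m p) x v) \<le> L * norm (y - x)" if "z \<in> closed_segment x y" for z
    proof (rule onorm_le)
      show "norm (hess (J m p) z v - hess (J m p) x v) \<le> L * norm (y - x) * norm v" for v
        using mult_right_mono[OF mult_left_mono[OF closed_segment_dist[OF that] L_nonneg] norm_ge_zero[of v]]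
        by (rule order_trans[OF hess_diff_le])
    qed
  qed auto
  then show ?thesis
    by (simp add: blinfun.diff_right algebra_simps power2_eq_square)
qed

text \<open>A Landau-type bound, obtained from a Taylor step of length 1. It replaces \<open>L\<^sub>g\<close> in the descent
  estimate.\<close>

lemma norm_hess_le: "norm (hess (J m p) x v) \<le> (2 * \<sigma> + L) * norm v"
proof (cases "v = 0")
  case False
  define u where "u = v /\<^sub>R norm v"
  have "hess (J m p) x u = GJ (x + u) - GJ x - (GJ (x + u) - GJ x - hess (J m p) x ((x + u) - x))"
    by simp
  also have "norm \<dots> \<le> (norm (GJ (x + u)) + norm (GJ x)) + L * (norm ((x + u) - x))\<^sup>2"
    by (intro norm_triangle_le_diff add_mono grad_taylor norm_triangle_ineq4)
  also have "\<dots> \<le> (\<sigma> + \<sigma>) + L * 1"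
    using False by (intro add_mono grad_le) (simp add: u_def)
  finally have "norm v * norm (hess (J m p) x u) \<le> norm v * (2 * \<sigma> + L)"
    by (intro mult_left_mono) auto
  moreover have "hess (J m p) x v = norm v *\<^sub>R hess (J m p) x u"
    using False by (simp add: u_def blinfun.scaleR_right)
  ultimately show ?thesis
    by (simp add: mult.commute)
qed (simp add: blinfun.zero_right)

lemma grad_lipschitz: "norm (GJ x - GJ y) \<le> (2 * \<sigma> + L) * norm (x - y)"
  using grad_deriv norm_hess_le by (intro differentiable_bound[of UNIV]) (auto intro!: onorm_le)

lemma J_lipschitz: "\<bar>J m p x - J m p y\<bar> \<le> \<sigma> * norm (x - y)"
proof -
  have "onorm (\<lambda>v. v \<bullet> GJ z) \<le> \<sigma>" for z
  proof (rule onorm_le)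
    show "norm (v \<bullet> GJ z) \<le> \<sigma> * norm v" for v
      using Cauchy_Schwarz_ineq2[of v "GJ z"] mult_left_mono[OF grad_le[of z] norm_ge_zero[of v]]
      by (simp add: mult.commute)
  qed
  then have "norm (J m p x - J m p y) \<le> \<sigma> * norm (x - y)"
    using J_deriv by (intro differentiable_bound[of UNIV]) auto
  then show ?thesis by simp
qed

text \<open>The objective is maximized, so the usual descent inequality appears as a lower bound on
  the gain.\<close>

lemma J_descent: "J m p y \<ge> J m p x + (y - x) \<bullet> GJ x - (2 * \<sigma> + L) * (norm (y - x))\<^sup>2"
proof -
  have "norm ((J m p y - y \<bullet> GJ x) - (J m p x - x \<bullet> GJ x)) \<le> ((2 * \<sigma> + L) * norm (y - x)) * norm (y - x)"
  proof (rule differentiable_bound[of "closed_segment x y"])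
    show "((\<lambda>z. J m p z - z \<bullet> GJ x) has_derivative (\<lambda>v. v \<bullet> GJ z - v \<bullet> GJ x)) (at z within closed_segment x y)" for z
      by (intro has_derivative_diff has_derivative_at_withinI[OF J_deriv]
          bounded_linear_imp_has_derivative bounded_linear_inner_left)
    show "onorm (\<lambda>v. v \<bullet> GJ z - v \<bullet> GJ x) \<le> (2 * \<sigma> + L) * norm (y - x)" if "z \<in> closed_segment x y" for z
    proof (rule onorm_le)
      fix v
      have "norm (v \<bullet> GJ z - v \<bullet> GJ x) \<le> norm v * norm (GJ z - GJ x)"
        using Cauchy_Schwarz_ineq2[of v "GJ z - GJ x"] by (simp add: inner_diff_right)
      also have "\<dots> \<le> norm v * ((2 * \<sigma> + L) * norm (y - x))"
        using \<sigma>_pos L_nonneg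
        by (intro mult_left_mono order_trans[OF grad_lipschitz] closed_segment_dist[OF that]) auto
      finally show "norm (v \<bullet> GJ z - v \<bullet> GJ x) \<le> (2 * \<sigma> + L) * norm (y - x) * norm v"
        by (simp add: mult.commute)
    qed
  qed auto
  then show ?thesis
    by (simp add: abs_le_iff inner_diff_left power2_eq_square algebra_simps)
qed

text \<open>The linear gain of a normalized step is at least \<open>a\<close> times
  \<open>norm d\<close> minus the error of \<open>d\<close>. Replacing \<open>norm d\<close> by the
  gradient norm costs that error once more, hence the factor 2.\<close>

lemma normalized_step:
  fixes d x :: "real^'n"
  assumes "0 \<le> a"
  defines "y \<equiv> x + (a / norm d) *\<^sub>R d"
  shows "norm (y - x) \<le> a"
    and "a * norm (GJ x) \<le> J m p y - J m p x + 2 * a * norm (d - GJ x) + (2 * \<sigma> + L) * a\<^sup>2"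
proof -
  show le: "norm (y - x) \<le> a"
    using assms(1) by (simp add: y_def)
  have "a * (norm (GJ x) - 2 * norm (d - GJ x)) \<le> (y - x) \<bullet> GJ x"
  \<comment> \<open>Division by zero gives \<open>y = x\<close>; the error is then the full gradient
    norm and the left-hand side is not positive.\<close>
  proof (cases "d = 0")
    case True
    then show ?thesis
      using assms(1) by (simp add: y_def mult_nonneg_nonpos)
  next
    case False
    have "d \<bullet> GJ x = (norm d)\<^sup>2 - d \<bullet> (d - GJ x)"
      by (simp add: power2_norm_eq_inner inner_diff_right)
    also have "\<dots> \<ge> norm d * (norm d - norm (d - GJ x))"
      using norm_cauchy_schwarz[of d "d - GJ x"] by (simp add: power2_eq_square right_diff_distrib)
    finally have "norm d * (norm d - norm (d - GJ x)) \<le> d \<bullet> GJ x" .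
    then have "norm d - norm (d - GJ x) \<le> d \<bullet> GJ x / norm d"
      using False by (simp add: pos_le_divide_eq mult.commute)
    moreover have "norm (GJ x) \<le> norm d + norm (d - GJ x)"
      using norm_triangle_sub[of "GJ x" d] by (simp add: norm_minus_commute)
    ultimately have "a * (norm (GJ x) - 2 * norm (d - GJ x)) \<le> a * (d \<bullet> GJ x / norm d)"
      using assms(1) by (intro mult_left_mono) auto
    then show ?thesis
      by (simp add: y_def)
  qed
  moreover have "(2 * \<sigma> + L) * (norm (y - x))\<^sup>2 \<le> (2 * \<sigma> + L) * a\<^sup>2"
    using \<sigma>_pos L_nonneg le by (intro mult_left_mono power_mono) auto
  ultimately show "a * norm (GJ x) \<le> J m p y - J m p x + 2 * a * norm (d - GJ x) + (2 * \<sigma> + L) * a\<^sup>2"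
    using J_descent[of x y] by (simp add: algebra_simps)
qed

subsection \<open>The law of the run\<close>

text \<open>The case \<open>d' = 0\<close> of the algorithm disappears, because division by zero
  makes the scaled direction zero as well.\<close>

lemma update_eq:
  "update n (\<theta>, d) \<tau> =
    (let d' = (1 - \<eta> (Suc n)) *\<^sub>R d + \<eta> (Suc n) *\<^sub>R g \<tau> (lookahead \<eta> (Suc n) \<theta>)
     in (\<theta>(Suc (Suc n) := \<theta> (Suc n) + (\<alpha> (Suc n) / norm d') *\<^sub>R d'), d'))"
  by (simp add: igt_update_def Let_def)

lemma coordinate_measurable[measurable]: "(\<lambda>c. fst c k) \<in> borel_measurable space_config"
  by (intro measurable_compose[OF measurable_fst] measurable_component_singleton) simp

lemma lookahead_measurable[measurable]: "(\<lambda>c. lookahead \<eta> n (fst c)) \<in> borel_measurable space_config"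
  unfolding lookahead_def by measurable

lemma GJ_measurable[measurable]: "GJ \<in> borel_measurable borel"
  using grad_deriv has_derivative_continuous
  by (intro borel_measurable_continuous_onI continuous_at_imp_continuous_on) blast

lemma J_measurable[measurable]: "J m p \<in> borel_measurable borel"
  using J_deriv has_derivative_continuous
  by (intro borel_measurable_continuous_onI continuous_at_imp_continuous_on) blast

lemma update_measurable: "(\<lambda>(c, \<tau>). update n c \<tau>) \<in> space_config \<Otimes>\<^sub>M W \<rightarrow>\<^sub>M space_config"
proof -
  have "(\<lambda>z. (lookahead \<eta> (Suc n) (fst (fst z)), snd z)) \<in> space_config \<Otimes>\<^sub>M W \<rightarrow>\<^sub>M borel \<Otimes>\<^sub>M W"
    by (intro measurable_Pair measurable_compose[OF measurable_fst lookahead_measurable] measurable_snd)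
  from measurable_compose[OF this g_measurable]
  have [measurable]: "(\<lambda>z. g (snd z) (lookahead \<eta> (Suc n) (fst (fst z)))) \<in> borel_measurable (space_config \<Otimes>\<^sub>M W)"
    by simp
  have [measurable]: "(\<lambda>z. fst (fst z) k) \<in> borel_measurable (space_config \<Otimes>\<^sub>M W)" for k
    by (rule measurable_compose[OF measurable_fst coordinate_measurable])
  have [measurable]: "(\<lambda>z. snd (fst z)) \<in> borel_measurable (space_config \<Otimes>\<^sub>M W)"
    by (intro measurable_compose[OF measurable_fst] measurable_snd)
  have "(\<lambda>z. update n (fst z) (snd z)) = (\<lambda>z.
    ((fst (fst z))(Suc (Suc n) := fst (fst z) (Suc n) + (\<alpha> (Suc n) / norm ((1 - \<eta> (Suc n)) *\<^sub>R snd (fst z) + \<eta> (Suc n) *\<^sub>R g (snd z) (lookahead \<eta> (Suc n) (fst (fst z)))))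
       *\<^sub>R ((1 - \<eta> (Suc n)) *\<^sub>R snd (fst z) + \<eta> (Suc n) *\<^sub>R g (snd z) (lookahead \<eta> (Suc n) (fst (fst z))))),
     (1 - \<eta> (Suc n)) *\<^sub>R snd (fst z) + \<eta> (Suc n) *\<^sub>R g (snd z) (lookahead \<eta> (Suc n) (fst (fst z)))))"
    by (auto simp: update_eq Let_def fun_eq_iff split_beta)
  also have "\<dots> \<in> space_config \<Otimes>\<^sub>M W \<rightarrow>\<^sub>M space_config"
    by (intro measurable_Pair measurable_fun_upd[where J=UNIV] measurable_compose[OF measurable_fst measurable_fst])
      (auto, measurable)
  finally show ?thesis
    by (simp add: case_prod_beta')
qed

lemma kernel_measurable:
  "(\<lambda>c. distr (P (lookahead \<eta> (Suc n) (fst c))) space_config (update n c)) \<in> space_config \<rightarrow>\<^sub>M prob_algebra space_config"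
  by (intro measurable_distr_prob_space2[OF _ update_measurable] measurable_compose[OF lookahead_measurable law_measurable])

lemma init_config_measurable:
  "(\<lambda>(\<theta>\<^sub>1, d\<^sub>0). (\<lambda>k. if k = 0 then \<theta>\<^sub>0 else \<theta>\<^sub>1, d\<^sub>0)) \<in> I \<rightarrow>\<^sub>M space_config"
proof -
  have "(\<lambda>z. (\<lambda>k. if k = 0 then \<theta>\<^sub>0 else fst z)) \<in> borel \<Otimes>\<^sub>M borel \<rightarrow>\<^sub>M PiM UNIV (\<lambda>_::nat. borel)"
    by (intro measurable_PiM_single') auto
  then have "(\<lambda>z. ((\<lambda>k. if k = 0 then \<theta>\<^sub>0 else fst z), snd z)) \<in> borel \<Otimes>\<^sub>M borel \<rightarrow>\<^sub>M space_config"
    by (intro measurable_Pair measurable_snd)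
  then show ?thesis
    by (simp add: case_prod_beta' sets_I cong: measurable_cong_sets)
qed

lemma run_in_prob_algebra: "run n \<in> space (prob_algebra space_config)"
proof (induction n)
  case 0
  interpret prob_space I by (rule I_prob)
  show ?case
    using prob_space_distr[OF init_config_measurable] by (simp add: space_prob_algebra)
next
  case (Suc n)
  then show ?case
    using prob_space_bind'[OF Suc kernel_measurable] sets_bind'[OF Suc kernel_measurable]
    by (simp add: space_prob_algebra)
qed

lemma prob_space_run: "prob_space (run n)" and sets_run[measurable_cong]: "sets (run n) = sets space_config"
  using run_in_prob_algebra[of n] by (auto simp: space_prob_algebra)

lemma update_measurable': "update n c \<in> P \<theta> \<rightarrow>\<^sub>M space_config"
proof -
  have "c \<in> space space_config"
    by (simp add: space_pair_measure space_PiM)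
  then have "(\<lambda>\<tau>. update n c \<tau>) \<in> W \<rightarrow>\<^sub>M space_config"
    using measurable_compose[OF measurable_Pair1' update_measurable] by simp
  then show ?thesis
    by (simp cong: measurable_cong_sets add: sets_P)
qed

lemma nn_integral_run_Suc:
  assumes [measurable]: "f \<in> borel_measurable space_config"
  shows "(\<integral>\<^sup>+c. f c \<partial>run (Suc n)) = (\<integral>\<^sup>+c. \<integral>\<^sup>+\<tau>. f (update n c \<tau>) \<partial>P (lookahead \<eta> (Suc n) (fst c)) \<partial>run n)"
proof -
  have "(\<lambda>c. distr (P (lookahead \<eta> (Suc n) (fst c))) space_config (update n c)) \<in> run n \<rightarrow>\<^sub>M subprob_algebra space_config"
    using measurable_prob_algebraD[OF kernel_measurable] by (simp cong: measurable_cong_sets add: sets_run)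
  from nn_integral_bind[OF assms this] show ?thesis
    by (simp add: nn_integral_distr update_measurable')
qed

text \<open>Properties of one update, checked for every trajectory in \<open>space W\<close>, carry
  over to the law of the run.\<close>

lemma AE_run_Suc:
  assumes Q: "Measurable.pred space_config Q" and ae: "AE c in run n. \<forall>\<tau>\<in>space W. Q (update n c \<tau>)"
  shows "AE c in run (Suc n). Q c"
proof -
  have K: "(\<lambda>c. distr (P (lookahead \<eta> (Suc n) (fst c))) space_config (update n c)) \<in> run n \<rightarrow>\<^sub>M subprob_algebra space_config"
    using measurable_prob_algebraD[OF kernel_measurable] by (simp cong: measurable_cong_sets add: sets_run)
  have "AE c in run n. AE c' in distr (P (lookahead \<eta> (Suc n) (fst c))) space_config (update n c). Q c'"
    using ae Q by (auto simp: AE_distr_iff[OF update_measurable'] space_P pred_def elim!: eventually_mono)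
  then show ?thesis
    unfolding igt_run.simps AE_bind[OF K Q] .
qed

subsection \<open>Noise and drift of the direction\<close>

text \<open>The direction that the algorithm would compute if every gradient estimate were replaced by
  its conditional mean. It is a function of the iterates, and \<open>d - noiseless n \<theta>\<close> is driven by the
  martingale noise alone.\<close>

primrec noiseless :: "nat \<Rightarrow> (nat \<Rightarrow> real^'n) \<Rightarrow> real^'n" where
  "noiseless 0 \<theta> = GJ (\<theta> 0)"
| "noiseless (Suc n) \<theta> = (1 - \<eta> (Suc n)) *\<^sub>R noiseless n \<theta> + \<eta> (Suc n) *\<^sub>R mean (lookahead \<eta> (Suc n) \<theta>)"

text \<open>Variance bound for noise started at zero; the contribution of the initial direction is
  kept apart in \<open>init_error\<close>.\<close>

primrec noise_var :: "nat \<Rightarrow> real" where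
  "noise_var 0 = 0"
| "noise_var (Suc n) = (1 - \<eta> (Suc n))\<^sup>2 * noise_var n + (\<eta> (Suc n))\<^sup>2 * \<sigma>\<^sup>2"

text \<open>The start \<open>2 * \<sigma>\<close> bounds the mean of \<open>norm d\<^sub>0\<close>
  plus the gradient norm at \<open>\<theta>\<^sub>0\<close>.\<close>

primrec init_error :: "nat \<Rightarrow> real" where
  "init_error 0 = 2 * \<sigma>"
| "init_error (Suc n) = (1 - \<eta> (Suc n)) * init_error n"

text \<open>The last summand bounds the two Taylor remainders, at the previous iterate and at the
  lookahead point, taken together.\<close>

primrec drift :: "nat \<Rightarrow> real" where
  "drift 0 = 0"
| "drift (Suc n) = (1 - \<eta> (Suc n)) * drift n + \<eta> (Suc n) * b + L * (\<alpha> n)\<^sup>2 / \<eta> (Suc n)"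

lemma lookahead_cong: "\<theta> n = \<theta>' n \<Longrightarrow> \<theta> (n - 1) = \<theta>' (n - 1) \<Longrightarrow> lookahead \<eta> n \<theta> = lookahead \<eta> n \<theta>'"
  by (simp add: lookahead_def)

text \<open>\<open>update n\<close> writes only index \<open>Suc (Suc n)\<close>, while
  \<open>noiseless (Suc n)\<close> reads indices up to \<open>Suc n\<close> and is therefore
  unchanged by it.\<close>

lemma noiseless_cong: "(\<And>k. k \<le> n \<Longrightarrow> \<theta> k = \<theta>' k) \<Longrightarrow> noiseless n \<theta> = noiseless n \<theta>'"
proof (induction n)
  case (Suc n)
  have "lookahead \<eta> (Suc n) \<theta> = lookahead \<eta> (Suc n) \<theta>'"
    using Suc.prems by (intro lookahead_cong) auto
  then show ?case
    using Suc by simp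
qed simp

lemma noiseless_measurable[measurable]: "(\<lambda>c. noiseless n (fst c)) \<in> borel_measurable space_config"
proof (induction n)
  case 0
  then show ?case
    by simp
next
  case (Suc n)
  then show ?case
    using measurable_compose[OF lookahead_measurable mean_measurable, of "Suc n"] by simp
qed

lemma noise_var_nonneg: "0 \<le> noise_var n"
  by (induction n) auto

lemma noise_var_pos: "0 < noise_var (Suc n)"
  using noise_var_nonneg[of n] \<sigma>_pos \<eta>_pos[of "Suc n"] by (simp add: add_nonneg_pos)

lemma update_noise:
  assumes "c = (\<theta>, d)"
  shows "snd (update n c \<tau>) - noiseless (Suc n) (fst (update n c \<tau>)) =
    (1 - \<eta> (Suc n)) *\<^sub>R (d - noiseless n \<theta>) + \<eta> (Suc n) *\<^sub>R (g \<tau> (lookahead \<eta> (Suc n) \<theta>) - mean (lookahead \<eta> (Suc n) \<theta>))"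
proof -
  have "noiseless (Suc n) (fst (update n c \<tau>)) = noiseless (Suc n) \<theta>"
    by (intro noiseless_cong) (simp add: assms update_eq Let_def)
  then show ?thesis
    by (simp add: assms update_eq Let_def algebra_simps)
qed

text \<open>Only the first moment of \<open>d\<^sub>0\<close> is controlled. The functions \<open>sqrt (c\<^sup>2 + \<bar>x\<bar>\<^sup>2)\<close> interpolate
  between first and second moments and are stable under one step of the recursion.\<close>

lemma noise_bound:
  assumes "0 < c"
  shows "(\<integral>\<^sup>+z. ennreal (sqrt (c\<^sup>2 + (norm (snd z - noiseless n (fst z)))\<^sup>2)) \<partial>run n)
    \<le> ennreal (sqrt (c\<^sup>2 + noise_var n) + init_error n)"
  using assms
proof (induction n arbitrary: c)
  case 0
  interpret prob_space I by (rule I_prob)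
  have "(\<integral>\<^sup>+z. ennreal (sqrt (c\<^sup>2 + (norm (snd z - noiseless 0 (fst z)))\<^sup>2)) \<partial>run 0) =
      (\<integral>\<^sup>+z. ennreal (sqrt (c\<^sup>2 + (norm (snd z - GJ \<theta>\<^sub>0))\<^sup>2)) \<partial>I)"
    unfolding igt_run.simps
    by (subst nn_integral_distr[OF init_config_measurable]) (measurable, simp add: case_prod_beta')
  also have "\<dots> \<le> (\<integral>\<^sup>+z. ennreal (c + \<sigma>) + ennreal (norm (snd z)) \<partial>I)"
  proof (rule nn_integral_mono)
    fix z :: "(real^'n) \<times> (real^'n)"
    have "sqrt (c\<^sup>2 + (norm (snd z - GJ \<theta>\<^sub>0))\<^sup>2) \<le> c + norm (snd z - GJ \<theta>\<^sub>0)"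
      using 0 by (intro sqrt_sum_squares_le_sum) auto
    also have "\<dots> \<le> (c + \<sigma>) + norm (snd z)"
      using norm_triangle_ineq4[of "snd z" "GJ \<theta>\<^sub>0"] grad_le[of \<theta>\<^sub>0] by simp
    finally show "ennreal (sqrt (c\<^sup>2 + (norm (snd z - GJ \<theta>\<^sub>0))\<^sup>2)) \<le> ennreal (c + \<sigma>) + ennreal (norm (snd z))"
      using 0 \<sigma>_pos by (simp add: ennreal_leI flip: ennreal_plus)
  qed
  also have "\<dots> = ennreal (c + \<sigma>) + (\<integral>\<^sup>+z. ennreal (norm (snd z)) \<partial>I)"
    by (subst nn_integral_add) (auto simp: emeasure_space_1 sets_I cong: measurable_cong_sets)
  also have "\<dots> \<le> ennreal (c + \<sigma>) + ennreal \<sigma>"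
    using I_dir by (intro add_left_mono) (simp add: case_prod_beta')
  also have "\<dots> = ennreal (sqrt (c\<^sup>2 + noise_var 0) + init_error 0)"
    using 0 \<sigma>_pos by (simp flip: ennreal_plus)
  finally show ?case .
next
  case (Suc n)
  let ?\<eta> = "\<eta> (Suc n)"
  let ?D = "\<lambda>z. snd z - noiseless n (fst z)"
  \<comment> \<open>Chosen so that the common factor (1 - \<eta>)^2 comes out of the root (fact
    \<open>scale\<close>); the induction hypothesis is then used at \<open>c'\<close>, hence the
    generalization over \<open>c\<close>.\<close>
  define c' where "c' = sqrt (c\<^sup>2 + ?\<eta>\<^sup>2 * \<sigma>\<^sup>2) / (1 - ?\<eta>)"
  have \<eta>: "0 < ?\<eta>" "?\<eta> < 1"
    using \<eta>_pos \<eta>_less_1 by auto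
  have c': "0 < c'"
    unfolding c'_def using Suc.prems \<eta> by (intro divide_pos_pos) (auto intro: add_pos_nonneg)
  have c'_sq: "((1 - ?\<eta>) * c')\<^sup>2 = c\<^sup>2 + ?\<eta>\<^sup>2 * \<sigma>\<^sup>2"
    using \<eta> by (simp add: c'_def)
  have scale: "sqrt (c\<^sup>2 + ?\<eta>\<^sup>2 * \<sigma>\<^sup>2 + (1 - ?\<eta>)\<^sup>2 * x) = (1 - ?\<eta>) * sqrt (c'\<^sup>2 + x)" for x
  proof -
    have "c\<^sup>2 + ?\<eta>\<^sup>2 * \<sigma>\<^sup>2 + (1 - ?\<eta>)\<^sup>2 * x = (1 - ?\<eta>)\<^sup>2 * (c'\<^sup>2 + x)"
      unfolding c'_sq[symmetric] by (simp add: power_mult_distrib distrib_left)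
    then show ?thesis
      using \<eta> by (simp add: real_sqrt_mult)
  qed
  have "(\<integral>\<^sup>+z. ennreal (sqrt (c\<^sup>2 + (norm (snd z - noiseless (Suc n) (fst z)))\<^sup>2)) \<partial>run (Suc n)) =
      (\<integral>\<^sup>+z. \<integral>\<^sup>+\<tau>. ennreal (sqrt (c\<^sup>2 + (norm ((1 - ?\<eta>) *\<^sub>R ?D z + ?\<eta> *\<^sub>R
        (g \<tau> (lookahead \<eta> (Suc n) (fst z)) - mean (lookahead \<eta> (Suc n) (fst z)))))\<^sup>2)) \<partial>P (lookahead \<eta> (Suc n) (fst z)) \<partial>run n)"
    by (subst nn_integral_run_Suc) (measurable, simp only: update_noise[OF prod.collapse[symmetric]])
  also have "\<dots> \<le> (\<integral>\<^sup>+z. ennreal ((1 - ?\<eta>) * sqrt (c'\<^sup>2 + (norm (?D z))\<^sup>2)) \<partial>run n)"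
  proof (rule nn_integral_mono)
    fix z :: "(nat \<Rightarrow> real^'n) \<times> (real^'n)"
    let ?l = "lookahead \<eta> (Suc n) (fst z)"
    interpret P: prob_space "P ?l" by (rule prob_space_P)
    let ?a = "(1 - ?\<eta>) *\<^sub>R ?D z"
    let ?X = "\<lambda>\<tau>. c\<^sup>2 + (norm (?a + ?\<eta> *\<^sub>R (g \<tau> ?l - mean ?l)))\<^sup>2"
    note noise = P.integrable_norm_noise[OF g_measurable_P g_bound[unfolded space_P[symmetric, of ?l]], where a = ?a and \<eta> = ?\<eta>]
      P.expectation_norm_noise_le[OF g_measurable_P g_bound[unfolded space_P[symmetric, of ?l]], where a = ?a and \<eta> = ?\<eta>]
    have "(\<integral>\<^sup>+\<tau>. ennreal (sqrt (?X \<tau>)) \<partial>P ?l) \<le> ennreal (sqrt (c\<^sup>2 + ?\<eta>\<^sup>2 * \<sigma>\<^sup>2 + (1 - ?\<eta>)\<^sup>2 * (norm (?D z))\<^sup>2))"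
    proof (rule P.nn_integral_sqrt_le)
      show "integrable (P ?l) ?X"
        using noise(1) by simp
      have "P.expectation ?X = c\<^sup>2 + P.expectation (\<lambda>\<tau>. (norm (?a + ?\<eta> *\<^sub>R (g \<tau> ?l - mean ?l)))\<^sup>2)"
        using noise(1) P.prob_space by simp
      also have "\<dots> \<le> c\<^sup>2 + ((norm ?a)\<^sup>2 + ?\<eta>\<^sup>2 * \<sigma>\<^sup>2)"
        by (intro add_left_mono order_trans[OF noise(2)] mult_left_mono g_second_moment) auto
      finally show "P.expectation ?X \<le> c\<^sup>2 + ?\<eta>\<^sup>2 * \<sigma>\<^sup>2 + (1 - ?\<eta>)\<^sup>2 * (norm (?D z))\<^sup>2"
        by (simp add: power_mult_distrib)
      show "0 < c\<^sup>2 + ?\<eta>\<^sup>2 * \<sigma>\<^sup>2 + (1 - ?\<eta>)\<^sup>2 * (norm (?D z))\<^sup>2"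
        using Suc.prems by (intro add_pos_nonneg) auto
    qed auto
    then show "(\<integral>\<^sup>+\<tau>. ennreal (sqrt (?X \<tau>)) \<partial>P ?l) \<le> ennreal ((1 - ?\<eta>) * sqrt (c'\<^sup>2 + (norm (?D z))\<^sup>2))"
      unfolding scale .
  qed
  also have "\<dots> = ennreal (1 - ?\<eta>) * (\<integral>\<^sup>+z. ennreal (sqrt (c'\<^sup>2 + (norm (?D z))\<^sup>2)) \<partial>run n)"
    using \<eta> by (subst nn_integral_cmult[symmetric]) (measurable, simp add: ennreal_mult)
  also have "\<dots> \<le> ennreal (1 - ?\<eta>) * ennreal (sqrt (c'\<^sup>2 + noise_var n) + init_error n)"
    by (intro mult_left_mono Suc.IH c') simp
  also have "\<dots> = ennreal ((1 - ?\<eta>) * sqrt (c'\<^sup>2 + noise_var n) + (1 - ?\<eta>) * init_error n)"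
    using \<eta> by (simp add: distrib_left flip: ennreal_mult')
  also have "\<dots> = ennreal (sqrt (c\<^sup>2 + noise_var (Suc n)) + init_error (Suc n))"
    unfolding scale[symmetric] by (simp add: algebra_simps)
  finally show ?case .
qed

lemma drift_bound:
  assumes "\<And>k. k < n \<Longrightarrow> norm (\<theta> (Suc k) - \<theta> k) \<le> \<alpha> k"
  shows "norm (noiseless n \<theta> - GJ (\<theta> n)) \<le> drift n"
  using assms
proof (induction n)
  case (Suc n)
  let ?\<eta> = "\<eta> (Suc n)"
  let ?x = "\<theta> (Suc n)" and ?y = "\<theta> n" and ?z = "lookahead \<eta> (Suc n) \<theta>"
  let ?h = "hess (J m p) ?x"
  have \<eta>: "0 < ?\<eta>" "?\<eta> < 1"
    using \<eta>_pos \<eta>_less_1 by auto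
  have step: "norm (?x - ?y) \<le> \<alpha> n"
    using Suc.prems by simp
  have z: "?z - ?x = ((1 - ?\<eta>) / ?\<eta>) *\<^sub>R (?x - ?y)"
    by (simp add: lookahead_def)
  \<comment> \<open>The lookahead point is chosen so that the second-order terms cancel.\<close>
  have cancel: "(1 - ?\<eta>) *\<^sub>R ?h (?y - ?x) + ?\<eta> *\<^sub>R ?h (?z - ?x) = 0"
  proof -
    have "?h (?y - ?x) = - ?h (?x - ?y)"
      by (simp add: blinfun.diff_right)
    then show ?thesis
      unfolding z blinfun.scaleR_right using \<eta> by simp
  qed
  have "noiseless (Suc n) \<theta> - GJ ?x =
      (1 - ?\<eta>) *\<^sub>R (noiseless n \<theta> - GJ ?y) + (1 - ?\<eta>) *\<^sub>R (GJ ?y - GJ ?x - ?h (?y - ?x)) +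
      ?\<eta> *\<^sub>R (mean ?z - GJ ?z) + ?\<eta> *\<^sub>R (GJ ?z - GJ ?x - ?h (?z - ?x)) +
      ((1 - ?\<eta>) *\<^sub>R ?h (?y - ?x) + ?\<eta> *\<^sub>R ?h (?z - ?x))"
    by (simp add: algebra_simps)
  then have eq: "noiseless (Suc n) \<theta> - GJ ?x =
      (1 - ?\<eta>) *\<^sub>R (noiseless n \<theta> - GJ ?y) + (1 - ?\<eta>) *\<^sub>R (GJ ?y - GJ ?x - ?h (?y - ?x)) +
      ?\<eta> *\<^sub>R (mean ?z - GJ ?z) + ?\<eta> *\<^sub>R (GJ ?z - GJ ?x - ?h (?z - ?x))"
    unfolding cancel by simp
  have "norm (noiseless (Suc n) \<theta> - GJ ?x) \<le> (1 - ?\<eta>) * drift n + (1 - ?\<eta>) * (L * (\<alpha> n)\<^sup>2) + ?\<eta> * b +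
      ?\<eta> * (L * (((1 - ?\<eta>) / ?\<eta>) * \<alpha> n)\<^sup>2)"
    unfolding eq
  proof (intro norm_triangle_mono)
    show "norm ((1 - ?\<eta>) *\<^sub>R (noiseless n \<theta> - GJ ?y)) \<le> (1 - ?\<eta>) * drift n"
      using \<eta> Suc by simp
    have "norm (GJ ?y - GJ ?x - ?h (?y - ?x)) \<le> L * (\<alpha> n)\<^sup>2"
      using L_nonneg step
      by (intro order_trans[OF grad_taylor] mult_left_mono power_mono) (auto simp: norm_minus_commute)
    then show "norm ((1 - ?\<eta>) *\<^sub>R (GJ ?y - GJ ?x - ?h (?y - ?x))) \<le> (1 - ?\<eta>) * (L * (\<alpha> n)\<^sup>2)"
      using \<eta> by simp
    show "norm (?\<eta> *\<^sub>R (mean ?z - GJ ?z)) \<le> ?\<eta> * b"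
      using \<eta> g_bias by simp
    have "norm (?z - ?x) \<le> ((1 - ?\<eta>) / ?\<eta>) * \<alpha> n"
      unfolding z using \<eta> step by (auto intro!: divide_right_mono mult_left_mono)
    then have "norm (GJ ?z - GJ ?x - ?h (?z - ?x)) \<le> L * (((1 - ?\<eta>) / ?\<eta>) * \<alpha> n)\<^sup>2"
      using L_nonneg by (intro order_trans[OF grad_taylor] mult_left_mono power_mono) auto
    then show "norm (?\<eta> *\<^sub>R (GJ ?z - GJ ?x - ?h (?z - ?x))) \<le> ?\<eta> * (L * (((1 - ?\<eta>) / ?\<eta>) * \<alpha> n)\<^sup>2)"
      using \<eta> by simp
  qed
  also have "\<dots> = (1 - ?\<eta>) * drift n + ?\<eta> * b + (1 - ?\<eta>) * (L * (\<alpha> n)\<^sup>2 / ?\<eta>)"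
  proof -
    have "(1 - ?\<eta>) * (L * (\<alpha> n)\<^sup>2) + ?\<eta> * (L * (((1 - ?\<eta>) / ?\<eta>) * \<alpha> n)\<^sup>2) = (1 - ?\<eta>) * (L * (\<alpha> n)\<^sup>2 / ?\<eta>)"
  proof -
    \<comment> \<open>Since (1 - \<eta>) + \<eta> \<kappa>^2 = (1 - \<eta>)(1 + \<kappa>) = (1 -
      \<eta>) / \<eta>, the two Taylor remainders merge into one term.\<close>
    define \<kappa> where "\<kappa> = (1 - ?\<eta>) / ?\<eta>"
    have \<kappa>: "?\<eta> * \<kappa> = 1 - ?\<eta>" "1 + \<kappa> = 1 / ?\<eta>"
      using \<eta> by (simp add: \<kappa>_def, simp add: \<kappa>_def diff_divide_distrib)
    have "(1 - ?\<eta>) * (L * (\<alpha> n)\<^sup>2) + ?\<eta> * (L * (\<kappa> * \<alpha> n)\<^sup>2) =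
        (1 - ?\<eta>) * (L * (\<alpha> n)\<^sup>2) + (?\<eta> * \<kappa>) * (L * (\<alpha> n)\<^sup>2 * \<kappa>)"
      by (simp add: power2_eq_square)
    also have "\<dots> = (1 - ?\<eta>) * (L * (\<alpha> n)\<^sup>2 * (1 + \<kappa>))"
      unfolding \<kappa>(1) by (simp add: distrib_left)
    finally show ?thesis
      unfolding \<kappa>(2) unfolding \<kappa>_def by simp
  qed
    then show ?thesis
      by simp
  qed
  also have "\<dots> \<le> drift (Suc n)"
    using \<eta> L_nonneg mult_right_mono[of "1 - ?\<eta>" 1 "L * (\<alpha> n)\<^sup>2 / ?\<eta>"] by simp
  finally show ?case .
qed simp

text \<open>After iterations 1 to n the iterates exist up to \<open>Suc n\<close>, hence steps 0 to
  n. Step 0 is the assumption on the inputs; normalization bounds the others.\<close>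

lemma AE_step:
  "AE c in run n. fst c 0 = \<theta>\<^sub>0 \<and> (\<forall>k\<in>{..n}. norm (fst c (Suc k) - fst c k) \<le> \<alpha> k)"
proof (induction n)
  case 0
  show ?case
    unfolding igt_run.simps
    by (subst AE_distr_iff[OF init_config_measurable]) (measurable, use I_step in \<open>simp add: case_prod_beta'\<close>)
next
  case (Suc n)
  show ?case
  proof (rule AE_run_Suc)
    show "Measurable.pred space_config (\<lambda>c. fst c 0 = \<theta>\<^sub>0 \<and> (\<forall>k\<in>{..Suc n}. norm (fst c (Suc k) - fst c k) \<le> \<alpha> k))"
      by measurable
    show "AE c in run n. \<forall>\<tau>\<in>space W. fst (update n c \<tau>) 0 = \<theta>\<^sub>0 \<and>
        (\<forall>k\<in>{..Suc n}. norm (fst (update n c \<tau>) (Suc k) - fst (update n c \<tau>) k) \<le> \<alpha> k)"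
      using Suc
    proof eventually_elim
      case (elim c)
      obtain \<theta> d where c: "c = (\<theta>, d)" by force
      show ?case
        using elim normalized_step(1)[OF \<alpha>_nonneg[of "Suc n"], of "\<theta> (Suc n)"]
        by (auto simp: c update_eq Let_def atMost_Suc simp del: norm_scaleR)
    qed
  qed
qed

lemma GJ_coordinate_measurable[measurable]: "(\<lambda>c. GJ (fst c k)) \<in> borel_measurable space_config"
  and J_coordinate_measurable[measurable]: "(\<lambda>c. J m p (fst c k)) \<in> borel_measurable space_config"
  by (rule measurable_compose[OF coordinate_measurable GJ_measurable],
      rule measurable_compose[OF coordinate_measurable J_measurable])

lemma AE_descent:
  "AE c in run (Suc n). \<alpha> (Suc n) * norm (GJ (fst c (Suc n))) \<le>
    J m p (fst c (Suc (Suc n))) - J m p (fst c (Suc n)) +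
    2 * \<alpha> (Suc n) * norm (snd c - GJ (fst c (Suc n))) + (2 * \<sigma> + L) * (\<alpha> (Suc n))\<^sup>2"
proof (rule AE_run_Suc)
  show "Measurable.pred space_config (\<lambda>c. \<alpha> (Suc n) * norm (GJ (fst c (Suc n))) \<le>
    J m p (fst c (Suc (Suc n))) - J m p (fst c (Suc n)) +
    2 * \<alpha> (Suc n) * norm (snd c - GJ (fst c (Suc n))) + (2 * \<sigma> + L) * (\<alpha> (Suc n))\<^sup>2)"
    unfolding pred_def
    by (intro borel_measurable_le borel_measurable_times borel_measurable_add borel_measurable_diff
        measurable_compose[OF _ borel_measurable_norm] borel_measurable_const GJ_coordinate_measurable J_coordinate_measurable measurable_snd)
  show "AE c in run n. \<forall>\<tau>\<in>space W. \<alpha> (Suc n) * norm (GJ (fst (update n c \<tau>) (Suc n))) \<le>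
    J m p (fst (update n c \<tau>) (Suc (Suc n))) - J m p (fst (update n c \<tau>) (Suc n)) +
    2 * \<alpha> (Suc n) * norm (snd (update n c \<tau>) - GJ (fst (update n c \<tau>) (Suc n))) + (2 * \<sigma> + L) * (\<alpha> (Suc n))\<^sup>2"
  proof (intro AE_I2 ballI)
    fix c :: "(nat \<Rightarrow> real^'n) \<times> (real^'n)" and \<tau>
    obtain \<theta> d where c: "c = (\<theta>, d)" by force
    show "\<alpha> (Suc n) * norm (GJ (fst (update n c \<tau>) (Suc n))) \<le>
      J m p (fst (update n c \<tau>) (Suc (Suc n))) - J m p (fst (update n c \<tau>) (Suc n)) +
      2 * \<alpha> (Suc n) * norm (snd (update n c \<tau>) - GJ (fst (update n c \<tau>) (Suc n))) + (2 * \<sigma> + L) * (\<alpha> (Suc n))\<^sup>2"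
      using normalized_step(2)[OF \<alpha>_nonneg[of "Suc n"], of "\<theta> (Suc n)"]
      by (simp add: c update_eq Let_def)
  qed
qed

subsection \<open>Summing the descent inequality\<close>

text \<open>The 2 under the root comes from applying \<open>noise_bound\<close> with
  \<open>c\<close> equal to the root of the variance.\<close>

definition error_bound :: "nat \<Rightarrow> real" where
  "error_bound n = sqrt (2 * noise_var n) + init_error n + drift n"

definition step_bound :: "nat \<Rightarrow> real" where
  "step_bound n = 2 * \<alpha> n * error_bound n + (2 * \<sigma> + L) * (\<alpha> n)\<^sup>2"

text \<open>A Lyapunov function: accumulated weighted gradient norms plus the remaining gap. Index 0
  is left out because no direction is computed there.\<close>

definition potential :: "nat \<Rightarrow> (nat \<Rightarrow> real^'n) \<Rightarrow> real" where
  "potential n \<theta> = (\<Sum>k=1..n. \<alpha> k * norm (GJ (\<theta> k))) + (J\<^sub>m\<^sub>a\<^sub>x - J m p (\<theta> (Suc n)))"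

lemma init_error_nonneg: "0 \<le> init_error n"
proof (induction n)
  case (Suc n)
  then show ?case
    using \<eta>_less_1[of n] by simp
qed (use \<sigma>_pos in simp)

lemma drift_nonneg: "0 \<le> drift n"
proof (induction n)
  case (Suc n)
  then show ?case
    using \<eta>_less_1[of n] \<eta>_pos[of "Suc n"] b_nonneg L_nonneg by simp
qed simp

lemma potential_nonneg: "0 \<le> potential n \<theta>"
  using J_le[of "\<theta> (Suc n)"] \<alpha>_nonneg by (auto simp: potential_def intro!: add_nonneg_nonneg sum_nonneg)

lemma step_bound_nonneg: "0 \<le> step_bound n"
  using \<alpha>_nonneg init_error_nonneg[of n] drift_nonneg[of n] noise_var_nonneg[of n] \<sigma>_pos L_nonneg
  by (auto simp: step_bound_def error_bound_def)

lemma potential_measurable[measurable]: "(\<lambda>c. potential n (fst c)) \<in> borel_measurable space_config"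
  unfolding potential_def by measurable

lemma direction_noise_bound:
  "(\<integral>\<^sup>+c. ennreal (norm (snd c - noiseless (Suc n) (fst c))) \<partial>run (Suc n))
    \<le> ennreal (sqrt (2 * noise_var (Suc n)) + init_error (Suc n))"
proof -
  \<comment> \<open>The noise bound requires a positive \<open>c\<close>; this value costs only a
    factor 2 under the root and spares a limit.\<close>
  let ?c = "sqrt (noise_var (Suc n))"
  have sq: "?c\<^sup>2 = noise_var (Suc n)"
    using noise_var_pos[of n] by (simp del: noise_var.simps)
  have "(\<integral>\<^sup>+c. ennreal (norm (snd c - noiseless (Suc n) (fst c))) \<partial>run (Suc n)) \<le>
      (\<integral>\<^sup>+c. ennreal (sqrt (?c\<^sup>2 + (norm (snd c - noiseless (Suc n) (fst c)))\<^sup>2)) \<partial>run (Suc n))"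
    by (intro nn_integral_mono ennreal_leI real_le_rsqrt) simp
  also have "\<dots> \<le> ennreal (sqrt (?c\<^sup>2 + noise_var (Suc n)) + init_error (Suc n))"
    using noise_var_pos[of n] by (intro noise_bound) (simp del: noise_var.simps)
  finally show ?thesis
    unfolding sq by (simp only: mult_2)
qed

text \<open>One iteration raises the expected potential by at most \<open>step_bound\<close>,
  because the change of the objective telescopes. The term \<open>\<sigma> * \<alpha> 0\<close> pays
  for the arbitrary first step, along which the objective may drop.\<close>

lemma potential_bound:
  "(\<integral>\<^sup>+c. ennreal (potential n (fst c)) \<partial>run n) \<le>
    ennreal (J\<^sub>m\<^sub>a\<^sub>x - J m p \<theta>\<^sub>0 + \<sigma> * \<alpha> 0 + (\<Sum>k=1..n. step_bound k))"
proof (induction n)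
  case 0
  interpret prob_space "run 0" by (rule prob_space_run)
  have "(\<integral>\<^sup>+c. ennreal (potential 0 (fst c)) \<partial>run 0) \<le> (\<integral>\<^sup>+c. ennreal (J\<^sub>m\<^sub>a\<^sub>x - J m p \<theta>\<^sub>0 + \<sigma> * \<alpha> 0) \<partial>run 0)"
  proof (rule nn_integral_mono_AE)
    show "AE c in run 0. ennreal (potential 0 (fst c)) \<le> ennreal (J\<^sub>m\<^sub>a\<^sub>x - J m p \<theta>\<^sub>0 + \<sigma> * \<alpha> 0)"
      using AE_step[of 0]
    proof eventually_elim
      case (elim c)
      then have "\<sigma> * norm (\<theta>\<^sub>0 - fst c (Suc 0)) \<le> \<sigma> * \<alpha> 0"
        using \<sigma>_pos by (intro mult_left_mono) (auto simp: norm_minus_commute)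
      then have "J m p \<theta>\<^sub>0 - J m p (fst c (Suc 0)) \<le> \<sigma> * \<alpha> 0"
        using J_lipschitz[of \<theta>\<^sub>0 "fst c (Suc 0)"] by linarith
      then show ?case
        by (intro ennreal_leI) (simp add: potential_def)
    qed
  qed
  also have "\<dots> = ennreal (J\<^sub>m\<^sub>a\<^sub>x - J m p \<theta>\<^sub>0 + \<sigma> * \<alpha> 0)"
    using emeasure_space_1 by (simp only: nn_integral_const mult_1_right)
  finally show ?case
    by simp
next
  case (Suc n)
  interpret prob_space "run (Suc n)" by (rule prob_space_run)
  let ?N = "\<lambda>c. norm (snd c - noiseless (Suc n) (fst c))"
  let ?a = "\<alpha> (Suc n)"
  let ?r = "2 * ?a * drift (Suc n) + (2 * \<sigma> + L) * ?a\<^sup>2"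
  have r: "0 \<le> ?r"
    using \<alpha>_nonneg drift_nonneg[of "Suc n"] \<sigma>_pos L_nonneg by (simp del: drift.simps)
  have "(\<integral>\<^sup>+c. ennreal (potential (Suc n) (fst c)) \<partial>run (Suc n)) \<le>
      (\<integral>\<^sup>+c. ennreal (potential n (fst c)) + (ennreal (2 * ?a) * ennreal (?N c) + ennreal ?r) \<partial>run (Suc n))"
  proof (rule nn_integral_mono_AE)
    show "AE c in run (Suc n). ennreal (potential (Suc n) (fst c)) \<le>
        ennreal (potential n (fst c)) + (ennreal (2 * ?a) * ennreal (?N c) + ennreal ?r)"
      using AE_step[of "Suc n"] AE_descent[of n]
    proof eventually_elim
      case (elim c)
      have "norm (noiseless (Suc n) (fst c) - GJ (fst c (Suc n))) \<le> drift (Suc n)"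
        using elim(1) by (intro drift_bound) auto
      then have "norm (snd c - GJ (fst c (Suc n))) \<le> ?N c + drift (Suc n)"
        using norm_triangle_ineq[of "snd c - noiseless (Suc n) (fst c)" "noiseless (Suc n) (fst c) - GJ (fst c (Suc n))"]
        by (simp del: drift.simps noiseless.simps)
      then have "2 * ?a * norm (snd c - GJ (fst c (Suc n))) \<le> 2 * ?a * (?N c + drift (Suc n))"
        using \<alpha>_nonneg[of "Suc n"] by (intro mult_left_mono) auto
      then have "potential (Suc n) (fst c) \<le> potential n (fst c) + (2 * ?a * ?N c + ?r)"
        using elim(2) by (simp add: potential_def distrib_left del: drift.simps noiseless.simps)
      then have "ennreal (potential (Suc n) (fst c)) \<le> ennreal (potential n (fst c) + (2 * ?a * ?N c + ?r))"
        by (rule ennreal_leI)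
      also have "\<dots> = ennreal (potential n (fst c)) + (ennreal (2 * ?a) * ennreal (?N c) + ennreal ?r)"
        using r \<alpha>_nonneg[of "Suc n"] potential_nonneg[of n "fst c"]
        by (simp add: ennreal_plus ennreal_mult del: drift.simps noiseless.simps)
      finally show ?case .
    qed
  qed
  also have "\<dots> = (\<integral>\<^sup>+c. ennreal (potential n (fst c)) \<partial>run (Suc n)) +
      (ennreal (2 * ?a) * (\<integral>\<^sup>+c. ennreal (?N c) \<partial>run (Suc n)) + ennreal ?r)"
  proof -
    have [measurable]: "(\<lambda>c. ennreal (?N c)) \<in> borel_measurable (run (Suc n))"
      using noiseless_measurable[of "Suc n"] by (simp cong: measurable_cong_sets add: sets_run del: noiseless.simps igt_run.simps)
    have [measurable]: "(\<lambda>c. ennreal (potential n (fst c))) \<in> borel_measurable (run (Suc n))"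
      using potential_measurable[of n] by (simp cong: measurable_cong_sets add: sets_run del: igt_run.simps)
    show ?thesis
      using emeasure_space_1
      by (simp add: nn_integral_add nn_integral_cmult del: drift.simps noiseless.simps igt_run.simps)
  qed
  \<comment> \<open>The potential at n reads iterates up to \<open>Suc n\<close>, whereas the new
    iteration writes only index \<open>Suc (Suc n)\<close>.\<close>
  also have "(\<integral>\<^sup>+c. ennreal (potential n (fst c)) \<partial>run (Suc n)) = (\<integral>\<^sup>+c. ennreal (potential n (fst c)) \<partial>run n)"
  proof -
    have "potential n (fst (update n c \<tau>)) = potential n (fst c)" for c \<tau>
    proof -
      obtain \<theta> d where "c = (\<theta>, d)" by force
      then show ?thesis
        by (simp add: potential_def update_eq Let_def)
    qed
    then show ?thesis
      using prob_space.emeasure_space_1[OF prob_space_P]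
      by (subst nn_integral_run_Suc[OF measurable_compose[OF potential_measurable measurable_ennreal]]) simp
  qed
  also have "\<dots> + (ennreal (2 * ?a) * (\<integral>\<^sup>+c. ennreal (?N c) \<partial>run (Suc n)) + ennreal ?r) \<le>
      ennreal (J\<^sub>m\<^sub>a\<^sub>x - J m p \<theta>\<^sub>0 + \<sigma> * \<alpha> 0 + (\<Sum>k=1..n. step_bound k)) +
      (ennreal (2 * ?a) * ennreal (sqrt (2 * noise_var (Suc n)) + init_error (Suc n)) + ennreal ?r)"
    by (intro add_mono Suc.IH mult_left_mono direction_noise_bound) auto
  also have "\<dots> = ennreal (J\<^sub>m\<^sub>a\<^sub>x - J m p \<theta>\<^sub>0 + \<sigma> * \<alpha> 0 + (\<Sum>k=1..n. step_bound k) + step_bound (Suc n))"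
  proof -
    have "0 \<le> J\<^sub>m\<^sub>a\<^sub>x - J m p \<theta>\<^sub>0 + \<sigma> * \<alpha> 0 + (\<Sum>k=1..n. step_bound k)"
      using J_le[of \<theta>\<^sub>0] \<sigma>_pos \<alpha>_nonneg[of 0] step_bound_nonneg by (intro add_nonneg_nonneg sum_nonneg) auto
    moreover have "0 \<le> sqrt (2 * noise_var (Suc n)) + init_error (Suc n)"
      using noise_var_pos[of n] init_error_nonneg[of "Suc n"] by (simp del: noise_var.simps init_error.simps)
    moreover have "step_bound (Suc n) = 2 * ?a * (sqrt (2 * noise_var (Suc n)) + init_error (Suc n)) + ?r"
      by (simp add: step_bound_def error_bound_def distrib_left del: noise_var.simps init_error.simps drift.simps)
    ultimately show ?thesis
      using r \<alpha>_nonneg[of "Suc n"]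
      by (simp add: ennreal_plus ennreal_mult del: noise_var.simps init_error.simps drift.simps)
  qed
  finally show ?case
    by (simp add: add.assoc)
qed

text \<open>The second \<open>\<sigma> * \<alpha> 0\<close> covers the gradient at index 0, which
  the potential omits.\<close>

lemma sum_grad_bound:
  assumes "1 \<le> T"
  shows "(\<integral>\<^sup>+c. ennreal (\<Sum>k<T. \<alpha> k * norm (GJ (fst c k))) \<partial>run (T - 1)) \<le>
    ennreal (J\<^sub>m\<^sub>a\<^sub>x - J m p \<theta>\<^sub>0 + 2 * \<sigma> * \<alpha> 0 + (\<Sum>k=1..<T. step_bound k))"
proof -
  interpret prob_space "run (T - 1)" by (rule prob_space_run)
  have [measurable]: "(\<lambda>c. ennreal (potential (T - 1) (fst c))) \<in> borel_measurable (run (T - 1))"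
    using potential_measurable[of "T - 1"] by (simp cong: measurable_cong_sets add: sets_run)
  have "(\<integral>\<^sup>+c. ennreal (\<Sum>k<T. \<alpha> k * norm (GJ (fst c k))) \<partial>run (T - 1)) \<le>
      (\<integral>\<^sup>+c. ennreal (\<sigma> * \<alpha> 0) + ennreal (potential (T - 1) (fst c)) \<partial>run (T - 1))"
  proof (rule nn_integral_mono)
    fix c :: "(nat \<Rightarrow> real^'n) \<times> (real^'n)"
    have "{..<T} = insert 0 {1..T - 1}"
      using assms by auto
    then have "(\<Sum>k<T. \<alpha> k * norm (GJ (fst c k))) = \<alpha> 0 * norm (GJ (fst c 0)) + (\<Sum>k=1..T - 1. \<alpha> k * norm (GJ (fst c k)))"
      by simp
    also have "\<dots> \<le> \<sigma> * \<alpha> 0 + potential (T - 1) (fst c)"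
      using mult_left_mono[OF grad_le[of "fst c 0"] \<alpha>_nonneg[of 0]] J_le[of "fst c (Suc (T - 1))"]
      by (simp add: potential_def mult.commute)
    finally show "ennreal (\<Sum>k<T. \<alpha> k * norm (GJ (fst c k))) \<le> ennreal (\<sigma> * \<alpha> 0) + ennreal (potential (T - 1) (fst c))"
      using potential_nonneg[of "T - 1" "fst c"] \<sigma>_pos \<alpha>_nonneg[of 0]
      by (simp add: ennreal_leI flip: ennreal_plus)
  qed
  also have "\<dots> = ennreal (\<sigma> * \<alpha> 0) + (\<integral>\<^sup>+c. ennreal (potential (T - 1) (fst c)) \<partial>run (T - 1))"
    using emeasure_space_1 by (simp add: nn_integral_add)
  also have "\<dots> \<le> ennreal (\<sigma> * \<alpha> 0) + ennreal (J\<^sub>m\<^sub>a\<^sub>x - J m p \<theta>\<^sub>0 + \<sigma> * \<alpha> 0 + (\<Sum>k=1..T - 1. step_bound k))"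
    by (intro add_left_mono potential_bound)
  also have "\<dots> = ennreal (\<sigma> * \<alpha> 0 + (J\<^sub>m\<^sub>a\<^sub>x - J m p \<theta>\<^sub>0 + \<sigma> * \<alpha> 0 + (\<Sum>k=1..T - 1. step_bound k)))"
    using J_le[of \<theta>\<^sub>0] \<sigma>_pos \<alpha>_nonneg[of 0] step_bound_nonneg
    by (intro ennreal_plus[symmetric] add_nonneg_nonneg sum_nonneg) auto
  also have "{1..T - 1} = {1..<T}"
    using assms by auto
  finally show ?thesis
    by (simp add: algebra_simps)
qed

text \<open>The random index is independent of the run, so Tonelli turns the expected gradient norm
  into the weighted average over the iterates.\<close>

lemma output_bound:
  assumes T: "1 \<le> T" and pos: "0 < (\<Sum>s<T. \<alpha> s)"
  defines "out \<equiv> igt_output m p H \<eta> \<alpha> \<theta>\<^sub>0 I T"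
  shows "integrable out (\<lambda>\<theta>. norm (GJ \<theta>))"
    and "(\<integral>\<theta>. norm (GJ \<theta>) \<partial>out) \<le>
      (J\<^sub>m\<^sub>a\<^sub>x - J m p \<theta>\<^sub>0 + 2 * \<sigma> * \<alpha> 0 + (\<Sum>k=1..<T. step_bound k)) / (\<Sum>s<T. \<alpha> s)"
proof -
  let ?\<Sigma> = "\<Sum>s<T. \<alpha> s"
  let ?R = "run (T - 1)"
  let ?K = "igt_index \<alpha> T"
  let ?S = "J\<^sub>m\<^sub>a\<^sub>x - J m p \<theta>\<^sub>0 + 2 * \<sigma> * \<alpha> 0 + (\<Sum>k=1..<T. step_bound k)"
  interpret R: prob_space ?R by (rule prob_space_run)
  have "emeasure ?K (space ?K) = (\<Sum>k<T. ennreal (\<alpha> k / ?\<Sigma>))"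
    unfolding igt_index_def by (subst emeasure_point_measure_finite) (auto simp: space_point_measure)
  also have "\<dots> < \<infinity>"
    by simp
  finally interpret K: finite_measure ?K
    by (intro finite_measureI) auto
  have sets_K: "sets ?K = Pow {..<T}"
    by (simp add: igt_index_def sets_point_measure)
  have K_count: "?K \<rightarrow>\<^sub>M N = count_space {..<T} \<rightarrow>\<^sub>M N" for N :: "'b measure"
    by (intro measurable_cong_sets) (auto simp: sets_K)
  have meas: "(\<lambda>((\<theta>, d), k). \<theta> k) \<in> borel_measurable (?R \<Otimes>\<^sub>M ?K)"
  proof -
    have "(\<lambda>z. fst (fst z) (snd z)) \<in> borel_measurable (space_config \<Otimes>\<^sub>M count_space {..<T})"
    proof (rule measurable_compose_countable'[where I="{..<T}"])
      show "(\<lambda>z. fst (fst z) k) \<in> borel_measurable (space_config \<Otimes>\<^sub>M count_space {..<T})" for k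
        by (rule measurable_compose[OF measurable_fst coordinate_measurable])
    qed auto
    then show ?thesis
      unfolding case_prod_beta'
      by (subst measurable_cong_sets[OF sets_pair_measure_cong[OF sets_run, of ?K "count_space {..<T}"] refl])
        (simp_all add: sets_K)
  qed
  have "(\<integral>\<^sup>+\<theta>. ennreal (norm (GJ \<theta>)) \<partial>out) = (\<integral>\<^sup>+z. ennreal (norm (GJ (fst (fst z) (snd z)))) \<partial>(?R \<Otimes>\<^sub>M ?K))"
    unfolding out_def igt_output_def by (subst nn_integral_distr[OF meas]) (auto simp: case_prod_beta')
  also have "\<dots> = (\<integral>\<^sup>+c. \<integral>\<^sup>+k. ennreal (norm (GJ (fst c k))) \<partial>?K \<partial>?R)"
  proof -
    have "(\<lambda>z. ennreal (norm (GJ (fst (fst z) (snd z))))) \<in> borel_measurable (?R \<Otimes>\<^sub>M ?K)"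
      using measurable_compose[OF meas, of "\<lambda>\<theta>. ennreal (norm (GJ \<theta>))" borel] by (simp add: case_prod_beta')
    from K.nn_integral_fst[OF this] show ?thesis
      by simp
  qed
  also have "\<dots> = (\<integral>\<^sup>+c. ennreal (1 / ?\<Sigma>) * ennreal (\<Sum>k<T. \<alpha> k * norm (GJ (fst c k))) \<partial>?R)"
  proof (rule nn_integral_cong)
    fix c :: "(nat \<Rightarrow> real^'n) \<times> (real^'n)"
    have "(\<integral>\<^sup>+k. ennreal (norm (GJ (fst c k))) \<partial>?K) = (\<Sum>k<T. ennreal (\<alpha> k / ?\<Sigma>) * ennreal (norm (GJ (fst c k))))"
      unfolding igt_index_def by (rule nn_integral_point_measure_finite) simp
    also have "\<dots> = (\<Sum>k<T. ennreal (1 / ?\<Sigma> * (\<alpha> k * norm (GJ (fst c k)))))"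
      using pos \<alpha>_nonneg by (intro sum.cong refl) (simp flip: ennreal_mult)
    also have "\<dots> = ennreal (1 / ?\<Sigma>) * ennreal (\<Sum>k<T. \<alpha> k * norm (GJ (fst c k)))"
      using pos \<alpha>_nonneg
      by (simp add: sum_ennreal sum_nonneg sum_distrib_left flip: ennreal_mult)
    finally show "(\<integral>\<^sup>+k. ennreal (norm (GJ (fst c k))) \<partial>?K) = ennreal (1 / ?\<Sigma>) * ennreal (\<Sum>k<T. \<alpha> k * norm (GJ (fst c k)))" .
  qed
  also have "\<dots> = ennreal (1 / ?\<Sigma>) * (\<integral>\<^sup>+c. ennreal (\<Sum>k<T. \<alpha> k * norm (GJ (fst c k))) \<partial>?R)"
    by (intro nn_integral_cmult) measurable
  also have "\<dots> \<le> ennreal (1 / ?\<Sigma>) * ennreal ?S"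
    by (intro mult_left_mono sum_grad_bound T) simp
  also have "\<dots> = ennreal (?S / ?\<Sigma>)"
    using pos by (simp flip: ennreal_mult')
  finally have le: "(\<integral>\<^sup>+\<theta>. ennreal (norm (GJ \<theta>)) \<partial>out) \<le> ennreal (?S / ?\<Sigma>)" .
  have meas_out: "(\<lambda>\<theta>. norm (GJ \<theta>)) \<in> borel_measurable out"
    unfolding out_def igt_output_def by simp
  show int: "integrable out (\<lambda>\<theta>. norm (GJ \<theta>))"
    using meas_out le_less_trans[OF le] by (intro integrableI_bounded) auto
  have S: "0 \<le> ?S / ?\<Sigma>"
    using pos J_le[of \<theta>\<^sub>0] \<sigma>_pos \<alpha>_nonneg[of 0] step_bound_nonneg
    by (intro divide_nonneg_nonneg add_nonneg_nonneg sum_nonneg less_imp_le[OF pos]) auto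
  show "(\<integral>\<theta>. norm (GJ \<theta>) \<partial>out) \<le> ?S / ?\<Sigma>"
    using le S by (subst (asm) nn_integral_eq_integral[OF int]) auto
qed

end

subsection \<open>Rates for the polynomial schedule\<close>

definition schedule :: "nat \<Rightarrow> real" where
  "schedule k = (2 / (real k + 2)) powr (2 / 7)"

lemma schedule_pos: "0 < schedule k" and schedule_le_1: "schedule k \<le> 1" and schedule_0: "schedule 0 = 1"
  by (auto simp: schedule_def intro!: powr_le1)

lemma momentum_eq: "momentum k = (schedule k)\<^sup>2"
  unfolding momentum_def schedule_def by (subst powr_power) auto

lemma step_size_sq: "(step_size k)\<^sup>2 = schedule k ^ 5"
  unfolding step_size_def schedule_def by (subst (1 2) powr_power) auto

lemma step_size_schedule: "step_size k * schedule k = 2 / (real k + 2)"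
  unfolding step_size_def schedule_def by (simp flip: powr_add)

lemma step_size_pos: "0 < step_size k"
  by (auto simp: step_size_def)

lemma step_size_sq_le: "(step_size k)\<^sup>2 \<le> 2 / (real k + 2)"
proof -
  have "step_size k = schedule k * schedule k powr (3 / 2)"
    unfolding step_size_def schedule_def by (simp add: powr_powr flip: powr_add)
  also have "\<dots> \<le> schedule k * 1"
    using schedule_pos[of k] schedule_le_1[of k] by (intro mult_left_mono powr_le1) auto
  finally have "step_size k * step_size k \<le> step_size k * schedule k"
    using step_size_pos[of k] by (intro mult_left_mono) auto
  then show ?thesis
    by (simp add: step_size_schedule power2_eq_square)
qed

lemma momentum_ge: "2 / (real k + 2) \<le> momentum k"
proof -
  have "(2 / (real k + 2)) powr 1 \<le> (2 / (real k + 2)) powr (4 / 7)"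
    by (intro powr_mono') auto
  then show ?thesis
    by (simp add: momentum_def)
qed

lemma schedule_ratio: "schedule k \<le> schedule (Suc k) * (1 + 3 / 8 * momentum (Suc k))"
proof -
  let ?u = "1 / (real k + 2)"
  have u_eq: "1 + ?u = (real (Suc k) + 2) / (real k + 2)"
    by (simp add: field_simps)
  have cancel: "2 / a = 2 / b * (b / a)" if "b \<noteq> 0" for a b :: real
    using that by simp
  have "2 / (real k + 2) = 2 / (real (Suc k) + 2) * (1 + ?u)"
    unfolding u_eq by (rule cancel) simp
  then have "schedule k = (2 / (real (Suc k) + 2) * (1 + ?u)) powr (2 / 7)"
    by (simp only: schedule_def)
  also have "\<dots> = schedule (Suc k) * (1 + ?u) powr (2 / 7)"
    unfolding schedule_def by (subst powr_mult) auto
  also have "(1 + ?u) powr (2 / 7) \<le> (1 + ?u) powr (1 / 2)"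
    by (intro powr_mono) auto
  also have "\<dots> = sqrt (1 + ?u)"
    by (simp add: powr_half_sqrt)
  also have "\<dots> \<le> 1 + ?u / 2"
  proof -
    have *: "sqrt (1 + u) \<le> 1 + u / 2" if "0 \<le> u" for u :: real
      using that by (intro real_le_lsqrt) (auto simp: power2_sum)
    show ?thesis
      by (rule *) simp
  qed
  \<comment> \<open>Equivalent to 4(k+3) <= 6(k+2), an equality at k = 0: this fixes the constant
    3/8.\<close>
  also have "?u / 2 \<le> 3 / 8 * (2 / (real (Suc k) + 2))"
    by (simp add: field_simps)
  also have "\<dots> \<le> 3 / 8 * momentum (Suc k)"
    by (intro mult_left_mono momentum_ge) simp
  finally show ?thesis
    using schedule_pos[of "Suc k"] by simp
qed

text \<open>The damping 1 - \<eta> beats the decay of the schedule, and 5/8 of it survives to absorb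
  the source terms of the error recursions.\<close>

lemma contraction_schedule:
  "(1 - momentum (Suc k)) * schedule k \<le> (1 - 5 / 8 * momentum (Suc k)) * schedule (Suc k)"
proof -
  let ?\<eta> = "momentum (Suc k)"
  have \<eta>: "0 \<le> ?\<eta>" "?\<eta> \<le> 1"
    using schedule_pos[of "Suc k"] schedule_le_1[of "Suc k"] by (auto simp: momentum_eq power_le_one)
  have "(1 - ?\<eta>) * schedule k \<le> (1 - ?\<eta>) * (schedule (Suc k) * (1 + 3 / 8 * ?\<eta>))"
    using \<eta> by (intro mult_left_mono schedule_ratio) auto
  also have "\<dots> = (1 - 5 / 8 * ?\<eta> - 3 / 8 * ?\<eta>\<^sup>2) * schedule (Suc k)"
    by (simp add: field_simps power2_eq_square)
  also have "\<dots> \<le> (1 - 5 / 8 * ?\<eta>) * schedule (Suc k)"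
    using schedule_pos[of "Suc k"] by (intro mult_right_mono) auto
  finally show ?thesis .
qed

text \<open>Every summand is at least (1/(T+1))^(5/7), and T >= (T+1)/2.\<close>

lemma sum_step_size_ge:
  assumes "1 \<le> T"
  shows "(real T + 1) powr (2 / 7) / 2 \<le> (\<Sum>k<T. step_size k)"
proof -
  have "(real T + 1) powr (2 / 7) = (real T + 1) * (1 / (real T + 1)) powr (5 / 7)"
  proof -
    have "(real T + 1) powr (2 / 7) = (real T + 1) powr (1 + - (5 / 7))"
      by simp
    also have "\<dots> = (real T + 1) powr 1 * (real T + 1) powr - (5 / 7)"
      by (rule powr_add)
    finally show ?thesis
      by (simp add: powr_minus_divide powr_divide)
  qed
  then have "(real T + 1) powr (2 / 7) / 2 = ((real T + 1) / 2) * (1 / (real T + 1)) powr (5 / 7)"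
    by simp
  also have "\<dots> \<le> real T * (1 / (real T + 1)) powr (5 / 7)"
    using assms by (intro mult_right_mono) auto
  also have "\<dots> = (\<Sum>k<T. (1 / (real T + 1)) powr (5 / 7))"
    by simp
  also have "\<dots> \<le> (\<Sum>k<T. step_size k)"
    unfolding step_size_def by (intro sum_mono powr_mono2) (auto simp: field_simps)
  finally show ?thesis .
qed

lemma one_minus_inverse_le_ln: "0 < x \<Longrightarrow> 1 - inverse x \<le> ln x" for x :: real
  using ln_le_minus_one[of "inverse x"] by (simp add: ln_inverse)

lemma sum_harmonic_le:
  assumes "1 \<le> T"
  shows "(\<Sum>k=1..<T. 2 / (real k + 2)) \<le> 2 * ln (real T + 1)"
  using assms
proof (induction T rule: dec_induct)
  case (step T)
  have "1 - inverse ((real T + 2) / (real T + 1)) \<le> ln ((real T + 2) / (real T + 1))"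
    by (rule one_minus_inverse_le_ln) simp
  then have "1 / (real T + 2) \<le> ln (real T + 2) - ln (real T + 1)"
    by (simp add: ln_div field_simps)
  then show ?case
    using step by (simp add: add.commute)
qed simp

section \<open>The error recursions under the polynomial schedule\<close>

context igt_oracle
begin

context
  assumes \<eta>: "\<And>k. \<eta> k = momentum k" and \<alpha>: "\<And>k. \<alpha> k = step_size k"
begin

text \<open>With y the schedule value, contraction removes at least
  \<open>5/4 * \<sigma>\<^sup>2 * \<eta> * y\<^sup>2\<close>, while fresh noise adds
  \<open>\<sigma>\<^sup>2 * \<eta>\<^sup>2 = \<sigma>\<^sup>2 * \<eta> * y\<^sup>2\<close>; thus the
  constant 2 is preserved.\<close>

lemma noise_var_le: "noise_var n \<le> 2 * \<sigma>\<^sup>2 * (schedule n)\<^sup>2"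
proof (induction n)
  case (Suc n)
  let ?\<eta> = "momentum (Suc n)" and ?y = "schedule (Suc n)"
  have \<eta>': "0 < ?\<eta>" "?\<eta> < 1"
    using \<eta>_pos \<eta>_less_1 by (auto simp: \<eta>)
  have "(1 - ?\<eta>)\<^sup>2 * noise_var n \<le> (1 - ?\<eta>)\<^sup>2 * (2 * \<sigma>\<^sup>2 * (schedule n)\<^sup>2)"
    by (intro mult_left_mono Suc.IH) simp
  also have "\<dots> = 2 * \<sigma>\<^sup>2 * ((1 - ?\<eta>) * schedule n)\<^sup>2"
    by (simp add: power_mult_distrib)
  also have "\<dots> \<le> 2 * \<sigma>\<^sup>2 * ((1 - 5 / 8 * ?\<eta>) * ?y)\<^sup>2"
    using \<eta>' schedule_pos[of n] by (intro mult_left_mono power_mono contraction_schedule) auto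
  also have "\<dots> = 2 * \<sigma>\<^sup>2 * ((1 - 5 / 8 * ?\<eta>)\<^sup>2 * ?y\<^sup>2)"
    by (simp add: power_mult_distrib)
  also have "\<dots> \<le> 2 * \<sigma>\<^sup>2 * ((1 - 5 / 8 * ?\<eta>) * ?y\<^sup>2)"
    using \<eta>' by (intro mult_left_mono mult_right_mono) (auto simp: power2_eq_square mult_left_le)
  finally have "noise_var (Suc n) \<le> 2 * \<sigma>\<^sup>2 * ((1 - 5 / 8 * ?\<eta>) * ?y\<^sup>2) + ?\<eta>\<^sup>2 * \<sigma>\<^sup>2"
    by (simp add: \<eta>)
  also have "\<dots> = 2 * \<sigma>\<^sup>2 * ?y\<^sup>2 - (1 / 4) * (\<sigma>\<^sup>2 * ?\<eta> * ?y\<^sup>2)"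
    by (simp add: momentum_eq power2_eq_square algebra_simps)
  also have "\<dots> \<le> 2 * \<sigma>\<^sup>2 * ?y\<^sup>2"
    using \<eta>' by simp
  finally show ?case .
qed simp

lemma init_error_le: "init_error n \<le> 2 * \<sigma> * schedule n"
proof (induction n)
  case (Suc n)
  let ?\<eta> = "momentum (Suc n)"
  have \<eta>': "0 < ?\<eta>" "?\<eta> < 1"
    using \<eta>_pos \<eta>_less_1 by (auto simp: \<eta>)
  have "init_error (Suc n) \<le> (1 - ?\<eta>) * (2 * \<sigma> * schedule n)"
    unfolding init_error.simps \<eta>[of "Suc n"] using \<eta>' by (intro mult_left_mono Suc.IH) auto
  also have "\<dots> = 2 * \<sigma> * ((1 - ?\<eta>) * schedule n)"
    by simp
  also have "\<dots> \<le> 2 * \<sigma> * ((1 - 5 / 8 * ?\<eta>) * schedule (Suc n))"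
    using \<sigma>_pos by (intro mult_left_mono contraction_schedule) auto
  also have "\<dots> \<le> 2 * \<sigma> * (1 * schedule (Suc n))"
    using \<sigma>_pos \<eta>' schedule_pos[of "Suc n"] by (intro mult_left_mono mult_right_mono) auto
  finally show ?case
    by simp
qed (simp add: schedule_0)

text \<open>The bias \<open>b\<close> is a fixed point of the recursion. The constant 8 is chosen so
  that contraction removes 8 * 5/8 = 5 units, matching the Taylor source.\<close>

lemma drift_le: "drift n \<le> b + 8 * L * schedule n"
proof (induction n)
  case 0
  then show ?case
    using b_nonneg L_nonneg by (simp add: schedule_0)
next
  case (Suc n)
  let ?\<eta> = "momentum (Suc n)" and ?y = "schedule (Suc n)"
  have \<eta>': "0 < ?\<eta>" "?\<eta> < 1"
    using \<eta>_pos \<eta>_less_1 by (auto simp: \<eta>)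
  have y: "0 < ?y"
    by (rule schedule_pos)
  have "schedule n \<le> ?y * (11 / 8)"
    using \<eta>' y by (intro order_trans[OF schedule_ratio] mult_left_mono) auto
  then have "(step_size n)\<^sup>2 \<le> (?y * (11 / 8)) ^ 5"
    unfolding step_size_sq using schedule_pos[of n] by (intro power_mono) auto
  \<comment> \<open>(11/8)^5 is about 4.915; the index shift from n to \<open>Suc n\<close> costs
    the factor 11/8 = 1 + 3/8, as the momentum is at most 1.\<close>
  also have "\<dots> \<le> 5 * ?y ^ 5"
    using y by (simp add: power_mult_distrib power_divide)
  also have "?y ^ 5 = ?\<eta> * (?\<eta> * ?y)"
    by (simp add: momentum_eq power2_eq_square eval_nat_numeral)
  finally have "(step_size n)\<^sup>2 / ?\<eta> \<le> 5 * (?\<eta> * ?y)"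
    using \<eta>' by (simp add: pos_divide_le_eq mult_ac)
  then have source: "L * (step_size n)\<^sup>2 / ?\<eta> \<le> L * (5 * (?\<eta> * ?y))"
    using L_nonneg by (simp add: mult_left_mono flip: times_divide_eq_right)
  have "(1 - ?\<eta>) * drift n \<le> (1 - ?\<eta>) * (b + 8 * L * schedule n)"
    using \<eta>' by (intro mult_left_mono Suc.IH) auto
  also have "\<dots> = (1 - ?\<eta>) * b + 8 * L * ((1 - ?\<eta>) * schedule n)"
    by (simp add: distrib_left)
  also have "\<dots> \<le> (1 - ?\<eta>) * b + 8 * L * ((1 - 5 / 8 * ?\<eta>) * ?y)"
    using L_nonneg by (intro add_left_mono mult_left_mono contraction_schedule) auto
  finally have "drift (Suc n) \<le> (1 - ?\<eta>) * b + 8 * L * ((1 - 5 / 8 * ?\<eta>) * ?y) + ?\<eta> * b + L * (5 * (?\<eta> * ?y))"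
    using source by (simp add: \<eta> \<alpha>)
  also have "\<dots> = b + 8 * L * ?y"
    by (simp add: algebra_simps)
  finally show ?case .
qed

lemma step_bound_le: "step_bound n \<le> 2 * b * step_size n + 17 * (L + \<sigma>) * (2 / (real n + 2))"
proof -
  have "sqrt (2 * noise_var n) \<le> 2 * \<sigma> * schedule n"
    using noise_var_le[of n] \<sigma>_pos schedule_pos[of n]
    by (intro real_le_lsqrt) (auto simp: power_mult_distrib)
  then have "error_bound n \<le> b + (4 * \<sigma> + 8 * L) * schedule n"
    using init_error_le[of n] drift_le[of n] unfolding error_bound_def by (simp add: algebra_simps)
  then have "2 * step_size n * error_bound n \<le> 2 * step_size n * (b + (4 * \<sigma> + 8 * L) * schedule n)"
    using step_size_pos[of n] by (intro mult_left_mono) auto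
  also have "\<dots> = 2 * b * step_size n + 2 * (4 * \<sigma> + 8 * L) * (step_size n * schedule n)"
    by (simp add: algebra_simps)
  also have "\<dots> = 2 * b * step_size n + 2 * (4 * \<sigma> + 8 * L) * (2 / (real n + 2))"
    by (simp only: step_size_schedule)
  finally have "step_bound n \<le> 2 * b * step_size n + 2 * (4 * \<sigma> + 8 * L) * (2 / (real n + 2)) + (2 * \<sigma> + L) * (2 / (real n + 2))"
    unfolding step_bound_def \<alpha> using \<sigma>_pos L_nonneg by (intro add_mono mult_left_mono step_size_sq_le) auto
  \<comment> \<open>10 = 2 * 4 + 2 and 17 = 2 * 8 + 1, the last summand coming from the smoothness
    term; both are then raised to 17.\<close>
  also have "\<dots> = 2 * b * step_size n + (10 * \<sigma> + 17 * L) * (2 / (real n + 2))"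
    by (simp add: algebra_simps add_divide_distrib)
  also have "\<dots> \<le> 2 * b * step_size n + 17 * (L + \<sigma>) * (2 / (real n + 2))"
    using \<sigma>_pos by (intro add_left_mono mult_right_mono) auto
  finally show ?thesis .
qed

lemma rate:
  assumes T: "1 \<le> T"
  defines "out \<equiv> igt_output m p H \<eta> \<alpha> \<theta>\<^sub>0 I T"
  shows "integrable out (\<lambda>\<theta>. norm (GJ \<theta>))"
    and "(\<integral>\<theta>. norm (GJ \<theta>) \<partial>out) \<le>
      2 * (J\<^sub>m\<^sub>a\<^sub>x - J m p \<theta>\<^sub>0) / (real T + 1) powr (2 / 7) + 2 * b +
      76 * ((L + \<sigma>) * ln (real T + 1) / (real T + 1) powr (2 / 7))"
proof -
  let ?\<Sigma> = "\<Sum>k<T. step_size k" and ?l = "ln (real T + 1)" and ?R = "(real T + 1) powr (2 / 7)"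
  have R: "0 < ?R"
    by simp
  have \<Sigma>: "0 < ?\<Sigma>" "?R / 2 \<le> ?\<Sigma>"
    using sum_step_size_ge[OF T] R by linarith+
  have sum_\<alpha>: "(\<Sum>s<T. \<alpha> s) = ?\<Sigma>"
    by (intro sum.cong \<alpha> refl)
  have pos: "0 < (\<Sum>s<T. \<alpha> s)"
    using \<Sigma> by (simp only: sum_\<alpha>)
  show "integrable out (\<lambda>\<theta>. norm (GJ \<theta>))"
    unfolding out_def by (rule output_bound(1)[OF T pos])
  have l: "1 / 2 \<le> ?l"
  proof -
    have "1 - inverse (real T + 1) \<le> ?l"
      using T by (intro one_minus_inverse_le_ln) simp
    moreover have "inverse (real T + 1) \<le> 1 / 2"
      using T by (simp add: field_simps)
    ultimately show ?thesis by linarith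
  qed
  have "(\<Sum>k=1..<T. step_bound k) \<le> (\<Sum>k=1..<T. 2 * b * step_size k + 17 * (L + \<sigma>) * (2 / (real k + 2)))"
    by (intro sum_mono step_bound_le)
  also have "\<dots> = 2 * b * (\<Sum>k=1..<T. step_size k) + 17 * (L + \<sigma>) * (\<Sum>k=1..<T. 2 / (real k + 2))"
    by (simp only: sum.distrib sum_distrib_left)
  also have "\<dots> \<le> 2 * b * ?\<Sigma> + 17 * (L + \<sigma>) * (2 * ?l)"
    using b_nonneg L_nonneg \<sigma>_pos step_size_pos
    by (intro add_mono mult_left_mono sum_harmonic_le T sum_mono2) (auto intro: less_imp_le)
  finally have sum: "(\<Sum>k=1..<T. step_bound k) \<le> 2 * b * ?\<Sigma> + 34 * ((L + \<sigma>) * ?l)"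
    by (simp add: algebra_simps)
  \<comment> \<open>For T >= 1 the logarithm is at least 1/2, so the constant
    \<open>2 * \<sigma>\<close> is absorbed: 34 + 4 = 38, doubled to 76 on dividing by half of
    \<open>?R\<close>.\<close>
  have "\<sigma> * 1 \<le> (L + \<sigma>) * (2 * ?l)"
    using l L_nonneg \<sigma>_pos by (intro mult_mono) auto
  moreover have "\<alpha> 0 = 1"
    by (simp add: \<alpha> step_size_def)
  ultimately have "J\<^sub>m\<^sub>a\<^sub>x - J m p \<theta>\<^sub>0 + 2 * \<sigma> * \<alpha> 0 + (\<Sum>k=1..<T. step_bound k) \<le>
      (J\<^sub>m\<^sub>a\<^sub>x - J m p \<theta>\<^sub>0 + 38 * ((L + \<sigma>) * ?l)) + 2 * b * ?\<Sigma>"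
    using sum by simp
  then have "(J\<^sub>m\<^sub>a\<^sub>x - J m p \<theta>\<^sub>0 + 2 * \<sigma> * \<alpha> 0 + (\<Sum>k=1..<T. step_bound k)) / ?\<Sigma> \<le>
      ((J\<^sub>m\<^sub>a\<^sub>x - J m p \<theta>\<^sub>0 + 38 * ((L + \<sigma>) * ?l)) + 2 * b * ?\<Sigma>) / ?\<Sigma>"
    using \<Sigma> by (intro divide_right_mono) auto
  also have "\<dots> = (J\<^sub>m\<^sub>a\<^sub>x - J m p \<theta>\<^sub>0 + 38 * ((L + \<sigma>) * ?l)) / ?\<Sigma> + 2 * b"
    using \<Sigma> by (simp add: add_divide_distrib)
  also have "(J\<^sub>m\<^sub>a\<^sub>x - J m p \<theta>\<^sub>0 + 38 * ((L + \<sigma>) * ?l)) / ?\<Sigma> \<le> (J\<^sub>m\<^sub>a\<^sub>x - J m p \<theta>\<^sub>0 + 38 * ((L + \<sigma>) * ?l)) / (?R / 2)"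
    using R J_le[of \<theta>\<^sub>0] L_nonneg \<sigma>_pos l
    by (intro divide_left_mono \<Sigma> mult_pos_pos add_nonneg_nonneg mult_nonneg_nonneg) auto
  also have "\<dots> = 2 * (J\<^sub>m\<^sub>a\<^sub>x - J m p \<theta>\<^sub>0) / ?R + 76 * ((L + \<sigma>) * ?l / ?R)"
    by (simp add: add_divide_distrib)
  finally show "(\<integral>\<theta>. norm (GJ \<theta>) \<partial>out) \<le>
      2 * (J\<^sub>m\<^sub>a\<^sub>x - J m p \<theta>\<^sub>0) / ?R + 2 * b + 76 * ((L + \<sigma>) * ?l / ?R)"
    using output_bound(2)[OF T pos] unfolding out_def sum_\<alpha> by linarith
qed

end

end

section \<open>The rate for the discounted decision process\<close>

theorem theorem5:
  fixes m :: "('s, 'a) mdp"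
    and p :: "real^'n \<Rightarrow> 's \<Rightarrow> 'a \<Rightarrow> real"
    and M\<^sub>g M\<^sub>h l\<^sub>2 :: real
    and T :: nat
    and \<theta>\<^sub>0 :: "real^'n"
    and I :: "((real^'n) \<times> (real^'n)) measure"
  defines "\<gamma> \<equiv> discount m" and "r \<equiv> reward_bound m"
  defines "H \<equiv> horizon \<gamma> T"
  defines "L\<^sub>g \<equiv> L_grad r \<gamma> M\<^sub>g M\<^sub>h"
    and "\<sigma>\<^sub>g \<equiv> sigma_grad r \<gamma> M\<^sub>g"
    and "D\<^sub>g \<equiv> D_grad r \<gamma> M\<^sub>g H"
    and "D\<^sub>h \<equiv> D_hess r \<gamma> M\<^sub>g M\<^sub>h H"
    and "L\<^sub>h \<equiv> L_hess r \<gamma> M\<^sub>g M\<^sub>h l\<^sub>2"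
  defines "out \<equiv> igt_output m p H momentum step_size \<theta>\<^sub>0 I T"
  assumes mdp: "is_mdp m" and policy: "is_policy_family m p"
    and pos: "\<And>\<theta> s a. s \<in> space (states m) \<Longrightarrow> a \<in> space (actions m) \<Longrightarrow> 0 < p \<theta> s a"
    and C2: "\<And>s a. s \<in> space (states m) \<Longrightarrow> a \<in> space (actions m) \<Longrightarrow>
               twice_cont_diff (\<lambda>\<theta>. p \<theta> s a)"
    and Mg: "0 < M\<^sub>g" and Mh: "0 < M\<^sub>h"
    and score_bound: "\<And>\<theta> s a. s \<in> space (states m) \<Longrightarrow> a \<in> space (actions m) \<Longrightarrow>
               norm (grad (\<lambda>\<theta>'. ln (p \<theta>' s a)) \<theta>) \<le> M\<^sub>g"
    and score_hess_bound: "\<And>\<theta> s a. s \<in> space (states m) \<Longrightarrow> a \<in> space (actions m) \<Longrightarrow>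
               norm (hess (\<lambda>\<theta>'. ln (p \<theta>' s a)) \<theta>) \<le> M\<^sub>h"
    and l2: "0 < l\<^sub>2"
    and score_hess_lipschitz: "\<And>\<theta> \<theta>' s a. s \<in> space (states m) \<Longrightarrow> a \<in> space (actions m) \<Longrightarrow>
               norm (hess (\<lambda>\<theta>''. ln (p \<theta>'' s a)) \<theta> - hess (\<lambda>\<theta>''. ln (p \<theta>'' s a)) \<theta>')
                 \<le> l\<^sub>2 * norm (\<theta> - \<theta>')"
    and J_hess_lipschitz: "L\<^sub>h-lipschitz_on UNIV (hess (J m p))"
    and init_law: "prob_space I" "sets I = sets (borel \<Otimes>\<^sub>M borel)"
    and init_step: "AE (\<theta>\<^sub>1, d\<^sub>0) in I. norm (\<theta>\<^sub>1 - \<theta>\<^sub>0) \<le> step_size 0"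
    and init_dir: "(\<integral>\<^sup>+ (\<theta>\<^sub>1, d\<^sub>0). ennreal (norm d\<^sub>0) \<partial>I) \<le> ennreal \<sigma>\<^sub>g"
    and T: "1 \<le> T"
  shows "integrable out (\<lambda>\<theta>. norm (grad (J m p) \<theta>)) \<and>
    (\<integral>\<theta>. norm (grad (J m p) \<theta>) \<partial>out) \<le> 1000 *
      ((optimal_return m - J m p \<theta>\<^sub>0) / (real T + 1) powr (2 / 7)
       + L\<^sub>g / (real T + 1) powr (5 / 7)
       + D\<^sub>g / (real T + 1)
       + D\<^sub>h / (real T + 1) powr (13 / 7)
       + (L\<^sub>h + \<sigma>\<^sub>g) * ln (real T + 1) / (real T + 1) powr (2 / 7))"
proof -
  let ?\<theta>law = "\<lambda>\<theta>. traj_law_upto m H (param_policy m p \<theta>)"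
  interpret smooth_policy m p M\<^sub>g M\<^sub>h
    using mdp policy pos C2 Mg Mh score_bound score_hess_bound by unfold_locales
  define b where "b = D\<^sub>g * \<gamma> ^ H"
  have \<gamma>: "0 < \<gamma>" "\<gamma> < 1" and r: "0 < r"
    unfolding \<gamma>_def r_def by (rule discount_pos discount_less_1 reward_bound_pos)+
  have L\<^sub>h: "0 \<le> L\<^sub>h"
    using J_hess_lipschitz by (rule lipschitz_on_nonneg)
  have \<sigma>\<^sub>g: "0 < \<sigma>\<^sub>g"
    using \<gamma> r Mg by (simp add: \<sigma>\<^sub>g_def sigma_grad_def)
  have D\<^sub>g: "0 \<le> D\<^sub>g"
    using \<gamma> r Mg by (simp add: D\<^sub>g_def D_grad_def)
  have L\<^sub>g: "0 \<le> L\<^sub>g"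
    using \<gamma> r Mg Mh by (simp add: L\<^sub>g_def L_grad_def)
  have D\<^sub>h: "0 \<le> D\<^sub>h"
    using \<gamma> r Mg Mh by (simp add: D\<^sub>h_def D_hess_def)
  interpret igt_oracle m p H "PiM {..<H} (\<lambda>_. state_actions m)" \<sigma>\<^sub>g b L\<^sub>h "optimal_return m"
    "\<Sum>h<H. discount m ^ h * reward_bound m * (real (Suc h) * M\<^sub>g)" momentum step_size \<theta>\<^sub>0 I
  proof (rule igt_oracle.intro)
    show "?\<theta>law \<in> borel \<rightarrow>\<^sub>M prob_algebra (PiM {..<H} (\<lambda>_. state_actions m))"
      by (rule law_measurable)
    show "(\<lambda>(\<theta>, \<tau>). pg_estimator m p H \<tau> \<theta>) \<in> borel_measurable (borel \<Otimes>\<^sub>M PiM {..<H} (\<lambda>_. state_actions m))"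
      by (rule pg_estimator_measurable)
    show "norm ((\<integral>\<tau>. pg_estimator m p H \<tau> \<theta> \<partial>?\<theta>law \<theta>) - grad (J m p) \<theta>) \<le> b" for \<theta>
      using norm_grad_J_diff_le[of \<theta> H]
      by (simp add: integral_pg_estimator norm_minus_commute b_def D\<^sub>g_def r_def \<gamma>_def)
    show "(\<lambda>\<theta>. \<integral>\<tau>. pg_estimator m p H \<tau> \<theta> \<partial>?\<theta>law \<theta>) \<in> borel_measurable borel"
    proof -
      have "continuous_on UNIV (reward_grad h)" for h
        using reward_grad_has_derivative[of h] has_derivative_continuous
        by (intro continuous_at_imp_continuous_on) blast
      then show ?thesis
        unfolding integral_pg_estimator
        by (intro borel_measurable_continuous_onI continuous_on_sum continuous_on_scaleR continuous_on_const)
    qed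
    show "momentum (Suc t) < 1" for t
      using powr_less_mono2[of "4 / 7" "2 / (real (Suc t) + 2)" 1] by (simp add: momentum_def)
    show "0 < momentum t" for t
      by (auto simp: momentum_def)
    show "0 \<le> step_size t" for t
      using step_size_pos[of t] by simp
    show "L\<^sub>h-lipschitz_on UNIV (hess (J m p))" "prob_space I" "sets I = sets (borel \<Otimes>\<^sub>M borel)"
      "AE (\<theta>\<^sub>1, d\<^sub>0) in I. norm (\<theta>\<^sub>1 - \<theta>\<^sub>0) \<le> step_size 0"
      "(\<integral>\<^sup>+ (\<theta>\<^sub>1, d\<^sub>0). ennreal (norm d\<^sub>0) \<partial>I) \<le> ennreal \<sigma>\<^sub>g" "0 < \<sigma>\<^sub>g"
      by (fact J_hess_lipschitz init_law init_step init_dir \<sigma>\<^sub>g)+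
    show "(\<integral>\<tau>. (norm (pg_estimator m p H \<tau> \<theta>))\<^sup>2 \<partial>?\<theta>law \<theta>) \<le> \<sigma>\<^sub>g\<^sup>2" for \<theta>
      unfolding \<sigma>\<^sub>g_def r_def \<gamma>_def by (rule integral_norm_pg_estimator_le)
    show "norm (grad (J m p) \<theta>) \<le> \<sigma>\<^sub>g" for \<theta>
      unfolding \<sigma>\<^sub>g_def r_def \<gamma>_def by (rule norm_grad_J_le)
  qed (fact norm_pg_estimator_le J_has_derivative grad_J_has_derivative J_le_optimal)+
  \<comment> \<open>Rounding the horizon up keeps (1 - \<gamma>) H >= ln (T + 1), and - ln \<gamma>
    >= 1 - \<gamma>; this turns the truncation bias into the term in
    \<open>D\<^sub>g\<close>.\<close>
  have "\<gamma> ^ H \<le> 1 / (real T + 1)"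
  proof -
    have "ln (real T + 1) / (1 - \<gamma>) \<le> real H"
      unfolding H_def horizon_def by linarith
    then have "ln (real T + 1) \<le> (1 - \<gamma>) * real H"
      using \<gamma> by (simp add: pos_divide_le_eq mult.commute)
    also have "\<dots> \<le> - ln \<gamma> * real H"
      using ln_le_minus_one[of \<gamma>] \<gamma> by (intro mult_right_mono) auto
    finally have "exp (ln (real T + 1)) \<le> exp (- (real H * ln \<gamma>))"
      by (simp only: exp_le_cancel_iff mult_minus_left mult.commute)
    then have "real T + 1 \<le> 1 / \<gamma> ^ H"
      using \<gamma> by (simp add: exp_minus exp_of_nat_mult inverse_eq_divide)
    then show ?thesis
      using \<gamma> by (simp add: field_simps)
  qed
  then have b_le: "b \<le> D\<^sub>g / (real T + 1)"
    using mult_left_mono[OF _ D\<^sub>g] by (fastforce simp: b_def)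
  note rate = rate[OF refl refl T, folded out_def]
  have "(\<integral>\<theta>. norm (grad (J m p) \<theta>) \<partial>out) \<le>
      2 * (optimal_return m - J m p \<theta>\<^sub>0) / (real T + 1) powr (2 / 7) + 2 * b +
      76 * ((L\<^sub>h + \<sigma>\<^sub>g) * ln (real T + 1) / (real T + 1) powr (2 / 7))"
    by (rule rate(2))
  \<comment> \<open>The largest constant produced is 76; 1000 is a round absolute constant above
    it.\<close>
  also have "\<dots> \<le> 1000 *
      ((optimal_return m - J m p \<theta>\<^sub>0) / (real T + 1) powr (2 / 7)
       + L\<^sub>g / (real T + 1) powr (5 / 7)
       + D\<^sub>g / (real T + 1)
       + D\<^sub>h / (real T + 1) powr (13 / 7)
       + (L\<^sub>h + \<sigma>\<^sub>g) * ln (real T + 1) / (real T + 1) powr (2 / 7))"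
  proof -
    have "0 \<le> (optimal_return m - J m p \<theta>\<^sub>0) / (real T + 1) powr (2 / 7)"
      using J_le_optimal[of \<theta>\<^sub>0] by simp
    moreover have "0 \<le> (L\<^sub>h + \<sigma>\<^sub>g) * ln (real T + 1) / (real T + 1) powr (2 / 7)"
      using L\<^sub>h \<sigma>\<^sub>g by simp
    moreover have "0 \<le> L\<^sub>g / (real T + 1) powr (5 / 7)" "0 \<le> D\<^sub>h / (real T + 1) powr (13 / 7)" "0 \<le> D\<^sub>g / (real T + 1)"
      using L\<^sub>g D\<^sub>h D\<^sub>g by simp_all
    ultimately show ?thesis
      using b_le unfolding distrib_left times_divide_eq_right[symmetric] by linarith
  qed
  finally show ?thesis
    using rate(1) by blast
qed

end
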